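(* Let $1\le p\le 2$, $\sigma\in M^p(\mathbb{Z}^n\times\mathbb{T}^n)$, let $\Phi$ be a Young function with $\Phi(x)=-x^2\log x$ for $0\le x\le e^{-2/3}$, and let $g_1,g_2\in M^\Phi(\mathbb{Z}^n)$. Then the localization operator $\mathfrak{L}^{g_1,g_2}_\sigma:\ell^2(\mathbb{Z}^n)\to\ell^2(\mathbb{Z}^n)$ is compact.
   Context: A Young function is a convex function $\Phi:[0,\infty]\to[0,\infty]$ with $\Phi(0)=0$ and $\lim_{t\to\infty}\Phi(t)=\Phi(\infty)=\infty$. $\mathcal{S}(\mathbb{Z}^n)$ is the space of rapidly decreasing functions on $\mathbb{Z}^n$ ($|g(k)|\le C_{g,M}(1+|k|)^{-M}$ for every $M$) with seminorms $\sup_k(1+|k|)^j|g(k)|$, $j\in\mathbb{N}_0$; $\mathcal{S}'(\mathbb{Z}^n)$ is its topological dual. Translation and modulation are $T_kf(m)=f(m-k)$, $M_wf(m)=e^{2\pi i w\cdot m}f(m)$. The short-time Fourier transform is $V_gf(m,w)=\langle f,M_wT_mg\rangle=\sum_{k\in\mathbb{Z}^n}f(k)\overline{g(k-m)}e^{-2\pi i w\cdot k}$, $(m,w)\in\mathbb{Z}^n\times\mathbb{T}^n$. $L^\Phi(\mathbb{Z}^n\times\mathbb{T}^n)$ has norm $\|F\|_{L^\Phi}=\inf\{b>0:\sum_{m}\int_{\mathbb{T}^n}\Phi(|F(m,w)|/b)\,dw\le 1\}$. With a fixed non-zero window $g\in\mathcal{S}(\mathbb{Z}^n)$, $M^\Phi(\mathbb{Z}^n)$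 is the space of $f\in\mathcal{S}'(\mathbb{Z}^n)$ with $\|f\|_{M^\Phi(\mathbb{Z}^n)}=\|V_gf\|_{L^\Phi(\mathbb{Z}^n\times\mathbb{T}^n)}<\infty$; the space is independent of the choice of window. $M^p(\mathbb{Z}^n\times\mathbb{T}^n)$, $1\le p\le\infty$, is the standard modulation space on the locally compact abelian group $\mathbb{Z}^n\times\mathbb{T}^n$ (dual group $\mathbb{T}^n\times\mathbb{Z}^n$): with a fixed non-zero Schwartz window $G$ on $\mathbb{Z}^n\times\mathbb{T}^n$, $\|\sigma\|_{M^p}$ is the $L^p$-norm over $(\mathbb{Z}^n\times\mathbb{T}^n)\times(\mathbb{T}^n\times\mathbb{Z}^n)$ of $V_G\sigma((m,w),(x,l))=\sum_{k\in\mathbb{Z}^n}\int_{\mathbb{T}^n}\sigma(k,y)\overline{G(k-m,y-w)}e^{-2\pi i(x\cdot k+l\cdot y)}\,dy$. The localization operator with symbol $\sigma$ and windows $g_1,g_2$ is $\mathfrak{L}^{g_1,g_2}_\sigma f(k)=\sum_{m\in\mathbb{Z}^n}\int_{\mathbb{T}^n}\sigma(m,w)V_{g_1}f(m,w)\,M_wT_mg_2(k)\,dw$, understood in the weak sense: for $f,h\in\ell^2(\mathbb{Z}^n)$, $\langle\mathfrak{L}^{g_1,g_2}_\sigma f,h\rangle_{\ell^2(\mathbb{Z}^n)}=\sum_{m\in\mathbb{Z}^n}\int_{\mathbb{T}^n}\sigma(m,w)V_{g_1}f(m,w)\overline{V_{g_2}h(m,w)}\,dw$.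
   Formalization: No Young function equals -x^2 log x on all of [0, e^{-2/3}], as this is not convex beyond e^{-3/2}; the formal theorem instead assumes Φ(x) = -x^2 log x for 0 ≤ x ≤ r with any 0 < r ≤ e^{-2/3}, which includes the printed case and r = e^{-3/2}. *)

theory Defs
  imports "HOL-Analysis.Analysis"
begin

section \<open>Young functions\<close>

definition young_function :: "(ennreal \<Rightarrow> ennreal) \<Rightarrow> bool" where
  "young_function \<Phi> \<longleftrightarrow>
     (\<forall>a b t. 0 \<le> t \<and> t \<le> 1 \<longrightarrow>
        \<Phi> (ennreal t * a + ennreal (1 - t) * b) \<le> ennreal t * \<Phi> a + ennreal (1 - t) * \<Phi> b) \<and>
     \<Phi> 0 = 0 \<and>
     ((\<lambda>t::real. \<Phi> (ennreal t)) \<longlongrightarrow> \<infinity>) at_top \<and>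
     \<Phi> \<infinity> = \<infinity>"

definition entropy_like_upto :: "real \<Rightarrow> (ennreal \<Rightarrow> ennreal) \<Rightarrow> bool" where
  \<comment> \<open>The value at \<open>x = 0\<close> is \<open>0\<close>, by the convention \<open>ln 0 = 0\<close>.\<close>
  "entropy_like_upto r \<Phi> \<longleftrightarrow> (\<forall>x. 0 \<le> x \<and> x \<le> r \<longrightarrow> \<Phi> (ennreal x) = ennreal (- (x\<^sup>2 * ln x)))"

text \<open>
  The function \<open>- x\<^sup>2 ln x\<close> is convex exactly on \<open>[0, exp (- 3/2)]\<close>, so no Young function agrees
  with it on the whole of \<open>[0, exp (- 2/3)]\<close>, as the next lemma shows.  This is why the length \<open>r\<close>
  of the interval is kept as a parameter with \<open>0 < r \<le> exp (- 2/3)\<close>: the value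
  \<open>r = exp (- 2/3)\<close> is included, and for \<open>r \<le> exp (- 3/2)\<close> the condition can be satisfied.
\<close>

lemma no_young_function_entropy_like:
  assumes Y: "young_function \<Phi>" and E: "entropy_like_upto (exp (- 2/3)) \<Phi>"
  shows False
proof -
  define b where "b = exp (- 2/3 :: real)"
  have b: "b > 0" "ln b = - 2/3" by (auto simp: b_def)
  define f where "f s = b\<^sup>2 * s\<^sup>2 * (2/3 - ln s)" for s :: real
  have \<Phi>: "\<Phi> (ennreal (b * s)) = ennreal (f s)" if "0 < s" "s \<le> 1" for s
  proof -
    have "b * s \<le> b" using b that by (simp add: mult_le_cancel_left1)
    then have "\<Phi> (ennreal (b * s)) = ennreal (- ((b * s)\<^sup>2 * ln (b * s)))"
      using E b that unfolding entropy_like_upto_def b_def[symmetric] by simp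
    also have "- ((b * s)\<^sup>2 * ln (b * s)) = f s"
      using b that by (simp add: f_def ln_mult power_mult_distrib algebra_simps)
    finally show ?thesis .
  qed
  have f0: "f s \<ge> 0" if "0 < s" "s \<le> 1" for s
  proof -
    have "ln s \<le> 0" using that by simp
    then show ?thesis by (auto simp: f_def intro!: mult_nonneg_nonneg)
  qed
  have comb: "ennreal (1/2) * ennreal x + ennreal (1 - 1/2) * ennreal y = ennreal (1/2 * x + 1/2 * y)"
    if "x \<ge> 0" "y \<ge> 0" for x y
  proof -
    have "ennreal (1/2 * x + 1/2 * y) = ennreal (1/2 * x) + ennreal (1/2 * y)"
      using that by (intro ennreal_plus) auto
    also have "\<dots> = ennreal (1/2) * ennreal x + ennreal (1/2) * ennreal y"
      using that by (intro arg_cong2[where f = "(+)"] ennreal_mult) auto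
    also have "1/2 = (1 - 1/2 :: real)" by simp
    finally show ?thesis by simp
  qed
  have conv: "\<Phi> (ennreal (1/2) * x + ennreal (1 - 1/2) * y) \<le> ennreal (1/2) * \<Phi> x + ennreal (1 - 1/2) * \<Phi> y"
    for x y
  proof -
    have "(0::real) \<le> 1/2 \<and> (1/2 :: real) \<le> 1" by simp
    then show ?thesis using Y unfolding young_function_def by blast
  qed
  have "b * (3/4) = 1/2 * (b * 1) + 1/2 * (b * (1/2))" by simp
  then have "ennreal (b * (3/4)) = ennreal (1/2) * ennreal (b * 1) + ennreal (1 - 1/2) * ennreal (b * (1/2))"
    using comb[of "b * 1" "b * (1/2)"] b by (metis less_imp_le mult_nonneg_nonneg zero_le_one
        half_gt_zero zero_less_one)
  then have "\<Phi> (ennreal (b * (3/4))) \<le>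
      ennreal (1/2) * \<Phi> (ennreal (b * 1)) + ennreal (1 - 1/2) * \<Phi> (ennreal (b * (1/2)))"
    using conv by metis
  also have "\<dots> = ennreal (1/2 * f 1 + 1/2 * f (1/2))"
    using comb[of "f 1" "f (1/2)"] f0[of 1] f0[of "1/2"] \<Phi>[of 1] \<Phi>[of "1/2"] by simp
  also have "\<Phi> (ennreal (b * (3/4))) = ennreal (f (3/4))" by (rule \<Phi>) auto
  finally have "f (3/4) \<le> 1/2 * f 1 + 1/2 * f (1/2)"
    using f0[of 1] f0[of "1/2"] by (subst (asm) ennreal_le_iff) auto
  then have "b\<^sup>2 * ((9/16) * (2/3 - ln (3/4))) \<le> b\<^sup>2 * (1/2 * (2/3) + 1/2 * (1/4 * (2/3 - ln (1/2))))"
    by (simp add: f_def power2_eq_square algebra_simps)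
  then have "(9/16) * (2/3 - ln (3/4::real)) \<le> 1/2 * (2/3) + 1/2 * (1/4 * (2/3 - ln (1/2)))"
    using b by (simp add: mult_le_cancel_left)
  moreover have "ln (3/4::real) \<le> - 1/4"
    using ln_le_minus_one[of "3/4::real"] by simp
  moreover have "ln (1/2::real) = - ln 2" by (simp add: ln_div)
  moreover have "ln (2::real) \<le> 25/36" by (rule ln2_le_25_over_36)
  ultimately show False by (simp add: field_simps)
qed


section \<open>Topological duals of function spaces\<close>

text \<open>
  \<open>top_dual S p\<close>: linear functionals on the function space \<open>S\<close>, continuous for the locally convex
  topology generated by the seminorms \<open>p 0, p 1, \<dots>\<close>.  Their values outside \<open>S\<close> are irrelevant.
\<close>

definition top_dual ::
  "('a \<Rightarrow> complex) set \<Rightarrow> (nat \<Rightarrow> ('a \<Rightarrow> complex) \<Rightarrow> real) \<Rightarrow> (('a \<Rightarrow> complex) \<Rightarrow> complex) set" where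
  "top_dual S p =
     {L. (\<forall>\<phi>\<in>S. \<forall>\<psi>\<in>S. L (\<lambda>a. \<phi> a + \<psi> a) = L \<phi> + L \<psi>) \<and>
         (\<forall>c. \<forall>\<phi>\<in>S. L (\<lambda>a. c * \<phi> a) = c * L \<phi>) \<and>
         (\<exists>C N. \<forall>\<phi>\<in>S. cmod (L \<phi>) \<le> C * (\<Sum>j\<le>N. p j \<phi>))}"


section \<open>Functions and distributions on the lattice\<close>

text \<open>
  The lattice of rank \<open>n = CARD('n)\<close> is \<open>int ^ 'n\<close>; functions on the \<open>n\<close>-torus are \<open>1\<close>-periodic
  functions on \<open>real ^ 'n\<close>.
\<close>

definition ivec :: "int ^ 'n \<Rightarrow> real ^ 'n" where
  "ivec k = (\<chi> i. of_int (k $ i))"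

definition schwartz_Z :: "(int ^ 'n \<Rightarrow> complex) set" where
  "schwartz_Z = {g. \<forall>M::nat. \<exists>C. \<forall>k. cmod (g k) \<le> C / (1 + norm (ivec k)) ^ M}"

definition seminorm_Z :: "nat \<Rightarrow> (int ^ 'n \<Rightarrow> complex) \<Rightarrow> real" where
  "seminorm_Z j g = (SUP k. (1 + norm (ivec k)) ^ j * cmod (g k))"

text \<open>
  Tempered distributions on the lattice are identified with their coefficient functions
  \<open>f k = L \<delta>\<^sub>k\<close>; the identification is justified by \<open>schwartz_Z_dual_representation\<close> below.
\<close>

definition tempered_Z :: "(int ^ 'n \<Rightarrow> complex) set" where
  "tempered_Z = {f. (\<forall>\<phi>\<in>schwartz_Z. (\<lambda>k. f k * \<phi> k) summable_on UNIV) \<and>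
                    (\<lambda>\<phi>. \<Sum>\<^sub>\<infinity>k. f k * \<phi> k) \<in> top_dual schwartz_Z seminorm_Z}"

lemma finite_lattice_ball: "finite {k :: int ^ 'n. norm (ivec k) \<le> R}"
proof (rule finite_subset)
  define S where "S = {- \<lceil>R\<rceil> .. \<lceil>R\<rceil>}"
  show "{k :: int ^ 'n. norm (ivec k) \<le> R} \<subseteq> vec_lambda ` (Pi\<^sub>E UNIV (\<lambda>_. S))"
  proof
    fix k :: "int ^ 'n" assume k: "k \<in> {k. norm (ivec k) \<le> R}"
    have "k $ i \<in> S" for i
    proof -
      have "\<bar>real_of_int (k $ i)\<bar> \<le> R"
        using k component_le_norm_cart[of "ivec k" i] by (simp add: ivec_def)
      then show ?thesis unfolding S_def by (simp; linarith)
    qed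
    then have "vec_nth k \<in> Pi\<^sub>E UNIV (\<lambda>_. S)" by auto
    then show "k \<in> vec_lambda ` (Pi\<^sub>E UNIV (\<lambda>_. S))"
      by (metis image_eqI vec_nth_inverse)
  qed
  show "finite (vec_lambda ` (Pi\<^sub>E (UNIV :: 'n set) (\<lambda>_. S)))"
    by (intro finite_imageI finite_PiE) (auto simp: S_def)
qed

lemma schwartz_Z_restrict:
  assumes "\<phi> \<in> schwartz_Z" shows "(\<lambda>k. if k \<in> A then \<phi> k else 0) \<in> schwartz_Z"
  unfolding schwartz_Z_def
proof safe
  fix M :: nat
  obtain C where C: "\<And>k. cmod (\<phi> k) \<le> C / (1 + norm (ivec k)) ^ M"
    using assms unfolding schwartz_Z_def by blast
  have "cmod (if k \<in> A then \<phi> k else 0) \<le> C / (1 + norm (ivec k)) ^ M" for k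
    using C[of k] order_trans[OF norm_ge_zero C[of k]] by auto
  then show "\<exists>C. \<forall>k. cmod (if k \<in> A then \<phi> k else 0) \<le> C / (1 + norm (ivec k)) ^ M" by blast
qed

lemma schwartz_Z_delta: "(\<lambda>k. if k = a then 1 else 0) \<in> schwartz_Z"
  unfolding schwartz_Z_def
proof safe
  fix M :: nat
  have "cmod (if k = a then 1 else 0) \<le> (1 + norm (ivec a)) ^ M / (1 + norm (ivec k)) ^ M" for k
    by (auto simp: add_nonneg_eq_0_iff)
  then show "\<exists>C. \<forall>k. cmod (if k = a then 1 else 0) \<le> C / (1 + norm (ivec k)) ^ M" by blast
qed

lemma schwartz_Z_dual_representation:
  fixes L :: "(int ^ 'n \<Rightarrow> complex) \<Rightarrow> complex"
  assumes L: "L \<in> top_dual schwartz_Z seminorm_Z"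
  shows "\<exists>f. \<forall>\<phi>\<in>schwartz_Z. ((\<lambda>k. f k * \<phi> k) has_sum L \<phi>) UNIV"
proof -
  define \<delta> where "\<delta> a = (\<lambda>k. if k = a then 1 else 0 :: complex)" for a :: "int ^ 'n"
  have \<delta>: "\<delta> a \<in> schwartz_Z" for a unfolding \<delta>_def by (rule schwartz_Z_delta)
  have add: "L (\<lambda>a. \<phi> a + \<psi> a) = L \<phi> + L \<psi>" if "\<phi> \<in> schwartz_Z" "\<psi> \<in> schwartz_Z" for \<phi> \<psi>
    using L that by (auto simp: top_dual_def)
  have scale: "L (\<lambda>a. c * \<phi> a) = c * L \<phi>" if "\<phi> \<in> schwartz_Z" for c \<phi>
    using L that by (auto simp: top_dual_def)
  obtain C N where CN: "\<And>\<phi>. \<phi> \<in> schwartz_Z \<Longrightarrow> cmod (L \<phi>) \<le> C * (\<Sum>j\<le>N. seminorm_Z j \<phi>)"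
    using L unfolding top_dual_def by blast
  have "((\<lambda>k. L (\<delta> k) * \<phi> k) has_sum L \<phi>) UNIV" if \<phi>: "\<phi> \<in> schwartz_Z" for \<phi>
    unfolding has_sum_def tendsto_iff eventually_finite_subsets_at_top
  proof (intro allI impI)
    fix e :: real assume e: "e > 0"
    obtain D where D: "\<And>k. cmod (\<phi> k) \<le> D / (1 + norm (ivec k)) ^ Suc N"
      using \<phi> unfolding schwartz_Z_def by blast
    have D0: "D \<ge> 0"
      using order_trans[OF norm_ge_zero D[of 0]] by (simp add: ivec_def zero_vec_def[symmetric])
    have fin: "L (\<lambda>k. if k \<in> F then \<phi> k else 0) = (\<Sum>k\<in>F. L (\<delta> k) * \<phi> k)" if "finite F" for F
      using that
    proof induction
      case empty
      show ?case using scale[OF \<phi>, of 0] by simp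
    next
      case (insert a F)
      have "(\<lambda>k. if k \<in> insert a F then \<phi> k else 0) =
            (\<lambda>k. \<phi> a * \<delta> a k + (if k \<in> F then \<phi> k else 0))"
        using insert.hyps by (auto simp: \<delta>_def fun_eq_iff)
      moreover have "(\<lambda>k. \<phi> a * \<delta> a k) = (\<lambda>k. if k \<in> {a} then \<phi> k else 0)"
        by (auto simp: \<delta>_def fun_eq_iff)
      then have "(\<lambda>k. \<phi> a * \<delta> a k) \<in> schwartz_Z"
        using schwartz_Z_restrict[OF \<phi>, of "{a}"] by simp
      ultimately show ?case
        using insert schwartz_Z_restrict[OF \<phi>, of F] scale[OF \<delta>]
        by (simp add: add mult.commute)
    qed
    define B where "B = \<bar>C\<bar> * (real (Suc N) * D)"
    have B: "B \<ge> 0" using D0 by (simp add: B_def)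
    define R where "R = B / e"
    define F0 where "F0 = {k :: int ^ 'n. norm (ivec k) \<le> R}"
    have "dist (\<Sum>k\<in>F. L (\<delta> k) * \<phi> k) (L \<phi>) < e" if F: "finite F" "F0 \<subseteq> F" for F
    proof -
      define \<psi> where "\<psi> = (\<lambda>k. if k \<in> - F then \<phi> k else 0)"
      have \<psi>: "\<psi> \<in> schwartz_Z" unfolding \<psi>_def by (rule schwartz_Z_restrict[OF \<phi>])
      have "L (\<lambda>k. \<psi> k + (if k \<in> F then \<phi> k else 0)) = L \<psi> + L (\<lambda>k. if k \<in> F then \<phi> k else 0)"
        by (intro add \<psi> schwartz_Z_restrict \<phi>)
      also have "(\<lambda>k. \<psi> k + (if k \<in> F then \<phi> k else 0)) = \<phi>" by (auto simp: \<psi>_def)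
      finally have L\<phi>: "L \<phi> = L \<psi> + (\<Sum>k\<in>F. L (\<delta> k) * \<phi> k)" using fin F by simp
      have R0: "R \<ge> 0" using B e by (simp add: R_def)
      have sn: "seminorm_Z j \<psi> \<le> D / (1 + R)" if "j \<le> N" for j
        unfolding seminorm_Z_def
      proof (rule cSUP_least)
        fix k
        show "(1 + norm (ivec k)) ^ j * cmod (\<psi> k) \<le> D / (1 + R)"
        proof (cases "k \<in> F")
          case True
          then show ?thesis using D0 R0 by (simp add: \<psi>_def)
        next
          case False
          then have k: "norm (ivec k) > R" using F unfolding F0_def by (metis (mono_tags) linorder_not_le mem_Collect_eq subsetD)
          define u where "u = 1 + norm (ivec k)"
          have u: "u \<ge> 1" "u > 1 + R" using k by (auto simp: u_def)
          have "u ^ j * cmod (\<psi> k) \<le> u ^ N * (D / u ^ Suc N)"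
            using D[of k] False u that
            by (intro mult_mono power_increasing) (auto simp: \<psi>_def u_def)
          also have "\<dots> = D / u" using u by simp
          also have "\<dots> \<le> D / (1 + R)" using u R0 D0 by (intro divide_left_mono) auto
          finally show ?thesis by (simp add: u_def)
        qed
      qed simp
      have sn0: "seminorm_Z j \<psi> \<ge> 0" if "j \<le> N" for j
      proof -
        have "bdd_above (range (\<lambda>k. (1 + norm (ivec k)) ^ j * cmod (\<psi> k)))"
        proof -
          obtain E where E: "\<And>k. cmod (\<psi> k) \<le> E / (1 + norm (ivec k)) ^ j"
            using \<psi> unfolding schwartz_Z_def by blast
          have "(1 + norm (ivec k)) ^ j * cmod (\<psi> k) \<le> E" for k
          proof -
            have "(1 + norm (ivec k)) ^ j > 0" by (simp add: add_pos_nonneg)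
            then show ?thesis using E[of k] by (simp add: pos_le_divide_eq mult.commute)
          qed
          then show ?thesis unfolding bdd_above_def by blast
        qed
        then have "(1 + norm (ivec (0 :: int ^ 'n))) ^ j * cmod (\<psi> 0) \<le> seminorm_Z j \<psi>"
          unfolding seminorm_Z_def by (rule cSUP_upper[OF UNIV_I])
        then show ?thesis by (meson order_trans mult_nonneg_nonneg norm_ge_zero zero_le_power
              add_nonneg_nonneg zero_le_one)
      qed
      have "dist (\<Sum>k\<in>F. L (\<delta> k) * \<phi> k) (L \<phi>) = cmod (L \<psi>)"
        by (simp add: L\<phi> dist_norm)
      also have "\<dots> \<le> C * (\<Sum>j\<le>N. seminorm_Z j \<psi>)" by (rule CN[OF \<psi>])
      also have "\<dots> \<le> \<bar>C\<bar> * (\<Sum>j\<le>N. seminorm_Z j \<psi>)"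
        using sn0 by (intro mult_right_mono sum_nonneg) auto
      also have "\<dots> \<le> \<bar>C\<bar> * (\<Sum>j\<le>N. D / (1 + R))"
        using sn by (intro mult_left_mono sum_mono) auto
      also have "\<dots> = B / (1 + R)" by (simp add: B_def)
      also have "\<dots> < e"
      proof -
        have "B < e * (1 + R)" using e by (simp add: R_def field_simps)
        then show ?thesis using R0 by (simp add: pos_divide_less_eq)
      qed
      finally show ?thesis .
    qed
    moreover have "finite F0" unfolding F0_def by (rule finite_lattice_ball)
    ultimately show "\<exists>X. finite X \<and> X \<subseteq> UNIV \<and>
        (\<forall>Y. finite Y \<and> X \<subseteq> Y \<and> Y \<subseteq> UNIV \<longrightarrow> dist (\<Sum>k\<in>Y. L (\<delta> k) * \<phi> k) (L \<phi>) < e)"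
      by blast
  qed
  then show ?thesis by (intro exI[of _ "\<lambda>k. L (\<delta> k)"]) blast
qed

definition translate :: "int ^ 'n \<Rightarrow> (int ^ 'n \<Rightarrow> complex) \<Rightarrow> (int ^ 'n \<Rightarrow> complex)" where
  "translate m f = (\<lambda>k. f (k - m))"

definition modulate :: "real ^ 'n \<Rightarrow> (int ^ 'n \<Rightarrow> complex) \<Rightarrow> (int ^ 'n \<Rightarrow> complex)" where
  "modulate w f = (\<lambda>k. cis (2 * pi * (w \<bullet> ivec k)) * f k)"

definition stft :: "(int ^ 'n \<Rightarrow> complex) \<Rightarrow> (int ^ 'n \<Rightarrow> complex) \<Rightarrow> int ^ 'n \<Rightarrow> real ^ 'n \<Rightarrow> complex" where
  "stft g f m w = (\<Sum>\<^sub>\<infinity>k. f k * cnj (modulate w (translate m g) k))"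


section \<open>Orlicz modulation spaces on the lattice\<close>

text \<open>Haar measure of the torus, carried by the unit cube (opposite faces overlap in a null set).\<close>

definition torus :: "(real ^ 'n) measure" where
  "torus = restrict_space lborel (cbox 0 1)"

definition ZT :: "((int ^ 'n) \<times> (real ^ 'n)) measure" where
  "ZT = count_space UNIV \<Otimes>\<^sub>M torus"

definition orlicz_norm :: "(ennreal \<Rightarrow> ennreal) \<Rightarrow> ((int ^ 'n) \<times> (real ^ 'n) \<Rightarrow> complex) \<Rightarrow> ennreal" where
  "orlicz_norm \<Phi> F = Inf {ennreal b | b. b > 0 \<and> (\<integral>\<^sup>+z. \<Phi> (ennreal (cmod (F z) / b)) \<partial>ZT) \<le> 1}"

definition orlicz_modulation_space ::
  "(int ^ 'n \<Rightarrow> complex) \<Rightarrow> (ennreal \<Rightarrow> ennreal) \<Rightarrow> (int ^ 'n \<Rightarrow> complex) set" where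
  "orlicz_modulation_space g \<Phi> = {f \<in> tempered_Z. orlicz_norm \<Phi> (\<lambda>(m, w). stft g f m w) < \<infinity>}"


section \<open>Distributions and modulation spaces on the product of lattice and torus\<close>

text \<open>\<open>iter_deriv [i\<^sub>1, \<dots>, i\<^sub>r] f\<close> is the iterated partial derivative of order \<open>r\<close>.\<close>

primrec iter_deriv :: "'n list \<Rightarrow> (real ^ 'n \<Rightarrow> complex) \<Rightarrow> (real ^ 'n \<Rightarrow> complex)" where
  "iter_deriv [] f = f"
| "iter_deriv (i # is) f = (\<lambda>y. frechet_derivative (iter_deriv is f) (at y) (axis i 1))"

definition schwartz_ZT :: "((int ^ 'n) \<times> (real ^ 'n) \<Rightarrow> complex) set" where
  "schwartz_ZT =
     {G. (\<forall>k y l. G (k, y + ivec l) = G (k, y)) \<and>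
         (\<forall>k is y. iter_deriv is (\<lambda>y. G (k, y)) differentiable (at y)) \<and>
         (\<forall>is (M::nat). \<exists>C. \<forall>k y. cmod (iter_deriv is (\<lambda>y. G (k, y)) y) \<le> C / (1 + norm (ivec k)) ^ M)}"

definition seminorm_ZT :: "nat \<Rightarrow> ((int ^ 'n) \<times> (real ^ 'n) \<Rightarrow> complex) \<Rightarrow> real" where
  "seminorm_ZT N G =
     (\<Sum>is\<in>{is. length is \<le> N}.
        SUP (k, y). (1 + norm (ivec k)) ^ N * cmod (iter_deriv is (\<lambda>y. G (k, y)) y))"

definition tempered_ZT :: "(((int ^ 'n) \<times> (real ^ 'n) \<Rightarrow> complex) \<Rightarrow> complex) set" where
  "tempered_ZT = top_dual schwartz_ZT seminorm_ZT"

text \<open>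
  For a distribution given by a function \<open>\<sigma>\<close>, \<open>stft_ZT G \<sigma> (m, w) (x, l)\<close> is the sum over \<open>k\<close> of the
  integrals of \<open>\<sigma>(k, y) cnj (G (k - m, y - w)) exp (- 2 \<pi> \<i> (x \<cdot> k + l \<cdot> y))\<close> in \<open>y\<close>; in general the
  distribution acts on the conjugate of the time-frequency shift of \<open>G\<close>.
\<close>

definition tf_shift_ZT ::
  "(int ^ 'n) \<times> (real ^ 'n) \<Rightarrow> (real ^ 'n) \<times> (int ^ 'n) \<Rightarrow>
   ((int ^ 'n) \<times> (real ^ 'n) \<Rightarrow> complex) \<Rightarrow> ((int ^ 'n) \<times> (real ^ 'n) \<Rightarrow> complex)" where
  "tf_shift_ZT = (\<lambda>(m, w) (x, l) G (k, y).
     cis (2 * pi * (x \<bullet> ivec k + ivec l \<bullet> y)) * G (k - m, y - w))"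

definition stft_ZT ::
  "((int ^ 'n) \<times> (real ^ 'n) \<Rightarrow> complex) \<Rightarrow> (((int ^ 'n) \<times> (real ^ 'n) \<Rightarrow> complex) \<Rightarrow> complex) \<Rightarrow>
   (int ^ 'n) \<times> (real ^ 'n) \<Rightarrow> (real ^ 'n) \<times> (int ^ 'n) \<Rightarrow> complex" where
  "stft_ZT G \<sigma> z \<zeta> = \<sigma> (\<lambda>a. cnj (tf_shift_ZT z \<zeta> G a))"

text \<open>The modulation space of exponent \<open>1 \<le> p < \<infinity>\<close>; the integral is the \<open>p\<close>-th power of the norm.\<close>

definition modulation_space_ZT ::
  "((int ^ 'n) \<times> (real ^ 'n) \<Rightarrow> complex) \<Rightarrow> real \<Rightarrow> (((int ^ 'n) \<times> (real ^ 'n) \<Rightarrow> complex) \<Rightarrow> complex) set" where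
  "modulation_space_ZT G p =
     {\<sigma> \<in> tempered_ZT.
        (\<integral>\<^sup>+(z, \<zeta>). ennreal (cmod (stft_ZT G \<sigma> z \<zeta>) powr p)
           \<partial>(ZT \<Otimes>\<^sub>M (torus \<Otimes>\<^sub>M count_space UNIV))) < \<infinity>}"

definition represents ::
  "((int ^ 'n) \<times> (real ^ 'n) \<Rightarrow> complex) \<Rightarrow> (((int ^ 'n) \<times> (real ^ 'n) \<Rightarrow> complex) \<Rightarrow> complex) \<Rightarrow> bool" where
  "represents s \<sigma> \<longleftrightarrow> s \<in> borel_measurable ZT \<and>
     (\<forall>\<phi>\<in>schwartz_ZT. integrable ZT (\<lambda>z. s z * \<phi> z) \<and> \<sigma> \<phi> = (LINT z|ZT. s z * \<phi> z))"


section \<open>Square-summable functions and localization operators\<close>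

definition ell2 :: "('a \<Rightarrow> complex) set" where
  "ell2 = {f. (\<lambda>k. (cmod (f k))\<^sup>2) summable_on UNIV}"

definition ell2_inner :: "('a \<Rightarrow> complex) \<Rightarrow> ('a \<Rightarrow> complex) \<Rightarrow> complex" where
  "ell2_inner f h = (\<Sum>\<^sub>\<infinity>k. f k * cnj (h k))"

definition ell2_dist :: "('a \<Rightarrow> complex) \<Rightarrow> ('a \<Rightarrow> complex) \<Rightarrow> real" where
  "ell2_dist f h = sqrt (\<Sum>\<^sub>\<infinity>k. (cmod (f k - h k))\<^sup>2)"

lemma ell2_add: assumes "f \<in> ell2" "h \<in> ell2" shows "(\<lambda>k. f k + h k) \<in> ell2"
proof -
  have "(\<lambda>k. 2 * (cmod (f k))\<^sup>2 + 2 * (cmod (h k))\<^sup>2) summable_on UNIV"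
    using assms by (intro summable_on_add summable_on_cmult_right) (auto simp: ell2_def)
  moreover have "(cmod (f k + h k))\<^sup>2 \<le> 2 * (cmod (f k))\<^sup>2 + 2 * (cmod (h k))\<^sup>2" for k
  proof -
    have "(cmod (f k + h k))\<^sup>2 \<le> (cmod (f k) + cmod (h k))\<^sup>2"
      by (intro power_mono norm_triangle_ineq) auto
    also have "\<dots> \<le> 2 * (cmod (f k))\<^sup>2 + 2 * (cmod (h k))\<^sup>2"
      using sum_squares_bound[of "cmod (f k)" "cmod (h k)"]
      by (simp add: power2_sum)
    finally show ?thesis .
  qed
  ultimately show ?thesis
    unfolding ell2_def by (auto intro: summable_on_comparison_test)
qed

lemma ell2_diff: assumes "f \<in> ell2" "h \<in> ell2" shows "(\<lambda>k. f k - h k) \<in> ell2"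
proof -
  have "(\<lambda>k. - h k) \<in> ell2" using assms(2) by (simp add: ell2_def)
  from ell2_add[OF assms(1) this] show ?thesis by simp
qed

interpretation ell2: Metric_space ell2 ell2_dist
proof
  fix f h u :: "'a \<Rightarrow> complex"
  show "0 \<le> ell2_dist f h" by (simp add: ell2_dist_def infsum_nonneg)
  show "ell2_dist f h = ell2_dist h f" by (simp add: ell2_dist_def norm_minus_commute)
  show "ell2_dist f h = 0 \<longleftrightarrow> f = h" if "f \<in> ell2" "h \<in> ell2"
  proof
    assume "ell2_dist f h = 0"
    then have 0: "(\<Sum>\<^sub>\<infinity>k. (cmod (f k - h k))\<^sup>2) = 0" by (simp add: ell2_dist_def)
    have "(\<lambda>k. (cmod (f k - h k))\<^sup>2) summable_on UNIV"
      using ell2_diff[OF that] by (simp add: ell2_def)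
    then have "(cmod (f k - h k))\<^sup>2 = 0" for k
      using 0 nonneg_infsum_le_0D[of "\<lambda>k. (cmod (f k - h k))\<^sup>2" UNIV k] by auto
    then show "f = h" by (auto simp: fun_eq_iff)
  qed (simp add: ell2_dist_def)
  show "ell2_dist f u \<le> ell2_dist f h + ell2_dist h u" if "f \<in> ell2" "h \<in> ell2" "u \<in> ell2"
  proof -
    have fin: "L2_set (\<lambda>k. cmod (v k - v' k)) F \<le> ell2_dist v v'"
      if "finite F" "v \<in> ell2" "v' \<in> ell2" for F v and v' :: "'a \<Rightarrow> complex"
      unfolding L2_set_def ell2_dist_def
      using ell2_diff[OF that(2,3)] that(1)
      by (intro real_sqrt_le_mono finite_sum_le_infsum) (auto simp: ell2_def)
    have nonneg: "0 \<le> ell2_dist v v'" for v v' :: "'a \<Rightarrow> complex"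
      by (simp add: ell2_dist_def infsum_nonneg)
    have "(\<Sum>\<^sub>\<infinity>k. (cmod (f k - u k))\<^sup>2) \<le> (ell2_dist f h + ell2_dist h u)\<^sup>2"
    proof (rule infsum_le_finite_sums)
      show "(\<lambda>k. (cmod (f k - u k))\<^sup>2) summable_on UNIV"
        using ell2_diff[OF that(1,3)] by (simp add: ell2_def)
      fix F :: "'a set" assume F: "finite F"
      have "L2_set (\<lambda>k. cmod (f k - u k)) F \<le> L2_set (\<lambda>k. cmod (f k - h k) + cmod (h k - u k)) F"
        by (intro L2_set_mono) (auto intro: norm_triangle_sub order_trans[OF _ norm_triangle_ineq])
      also have "\<dots> \<le> L2_set (\<lambda>k. cmod (f k - h k)) F + L2_set (\<lambda>k. cmod (h k - u k)) F"
        by (rule L2_set_triangle_ineq)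
      also have "\<dots> \<le> ell2_dist f h + ell2_dist h u"
        using fin[OF F] that by (intro add_mono) auto
      finally have "(L2_set (\<lambda>k. cmod (f k - u k)) F)\<^sup>2 \<le> (ell2_dist f h + ell2_dist h u)\<^sup>2"
        by (intro power_mono) auto
      then show "(\<Sum>k\<in>F. (cmod (f k - u k))\<^sup>2) \<le> (ell2_dist f h + ell2_dist h u)\<^sup>2"
        by (simp add: L2_set_def sum_nonneg)
    qed
    then show ?thesis
      using nonneg by (subst ell2_dist_def) (intro real_le_lsqrt add_nonneg_nonneg, auto)
  qed
qed

text \<open>Functions on \<open>ell2\<close> are represented by total functions; only their values on \<open>ell2\<close> matter.\<close>

definition compact_operator_ell2 :: "(('a \<Rightarrow> complex) \<Rightarrow> ('a \<Rightarrow> complex)) \<Rightarrow> bool" where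
  "compact_operator_ell2 T \<longleftrightarrow>
     (\<forall>f\<in>ell2. T f \<in> ell2) \<and>
     (\<forall>f\<in>ell2. \<forall>h\<in>ell2. T (\<lambda>k. f k + h k) = (\<lambda>k. T f k + T h k)) \<and>
     (\<forall>c. \<forall>f\<in>ell2. T (\<lambda>k. c * f k) = (\<lambda>k. c * T f k)) \<and>
     (\<forall>B. ell2.mbounded B \<longrightarrow> compactin ell2.mtopology (ell2.mtopology closure_of (T ` B)))"

text \<open>
  The weak definition of the localization operator evaluates the symbol pointwise, hence asks for a
  function representing the distribution \<open>\<sigma>\<close>.  Such a function is unique almost everywhere, and the
  weak identity determines \<open>T\<close> on \<open>ell2\<close>.
\<close>

definition is_localization_operator ::
  "(((int ^ 'n) \<times> (real ^ 'n) \<Rightarrow> complex) \<Rightarrow> complex) \<Rightarrow> (int ^ 'n \<Rightarrow> complex) \<Rightarrow> (int ^ 'n \<Rightarrow> complex) \<Rightarrow>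
   ((int ^ 'n \<Rightarrow> complex) \<Rightarrow> (int ^ 'n \<Rightarrow> complex)) \<Rightarrow> bool" where
  "is_localization_operator \<sigma> g1 g2 T \<longleftrightarrow>
     (\<exists>s. represents s \<sigma> \<and>
        (\<forall>f\<in>ell2. T f \<in> ell2 \<and>
           (\<forall>h\<in>ell2.
              integrable ZT (\<lambda>(m, w). s (m, w) * stft g1 f m w * cnj (stft g2 h m w)) \<and>
              ell2_inner (T f) h =
                (LINT (m, w)|ZT. s (m, w) * stft g1 f m w * cnj (stft g2 h m w)))))"

end

(* Everything is reduced to square-summability of Fourier coefficients on the torus.  For a Schwartz
   window, the short-time Fourier transform of a tempered sigma is, for fixed (m, l), an absolutely
   convergent series in orthonormal characters of (w, x), so each coefficient is bounded by the mean
   of its modulus.  Since t^p >= min(t^2, t) for 1 <= p <= 2, membership in M^p makes the squares of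
   these means summable; hence the Fourier coefficients c(m, q) of sigma lie in l^2 and, by
   Riesz-Fischer, sigma is represented by a square-integrable function.  The Young function also
   dominates a multiple of min(t^2, t), so in the same way M^Phi is contained in l^2.  The
   localization operator then has the matrix
     K(j, k) = sum_m c(m, j - k) cnj(g1(k - m)) g2(j - m),
   which is Hilbert-Schmidt by Cauchy-Schwarz, and a Hilbert-Schmidt operator maps bounded sets into
   Hilbert cubes, which are compact. *)

theory Submission
  imports Defs "HOL-Probability.Probability_Measure"
begin

section \<open>Square-summable families and Hilbert-Schmidt operators\<close>

text \<open>Both hypotheses are integrability conditions on a transform that control the same
  function \<open>min (t\<^sup>2) t\<close>. Near 0 this holds because \<open>p\<close> is at most 2
  and \<open>\<Phi>\<close> lies above a multiple of the square; for large values because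
  \<open>p\<close> is at least 1 and convexity forces \<open>\<Phi>\<close> to grow at least
  linearly. One argument therefore serves every exponent and both transforms. Once the lattice
  variables are fixed, the remaining ones range over a torus of measure 1, and the window being
  nonzero at a single index is enough: the coefficient at that index, followed over all lattice
  shifts, runs through the whole sequence to be estimated. The weak form evaluates the symbol
  pointwise, whereas \<open>\<sigma>\<close> is only a continuous functional, so a representing
  function has to be built first. Its Fourier coefficients are the values of \<open>\<sigma>\<close>
  on \<open>atom k q\<close>, and the Fourier analysis below (density, inversion, decay of
  coefficients) serves to expand every Schwartz function in these atoms with enough decay to pass
  \<open>\<sigma>\<close> through the series.\<close>

lemma cauchy_schwarz_infsum:
  fixes u v :: "'a \<Rightarrow> real"
  assumes u: "(\<lambda>x. (u x)\<^sup>2) summable_on A" and v: "(\<lambda>x. (v x)\<^sup>2) summable_on A"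
  shows "(\<lambda>x. u x * v x) summable_on A"
    and "(\<Sum>\<^sub>\<infinity>x\<in>A. u x * v x)\<^sup>2 \<le> (\<Sum>\<^sub>\<infinity>x\<in>A. (u x)\<^sup>2) * (\<Sum>\<^sub>\<infinity>x\<in>A. (v x)\<^sup>2)"
proof -
  have "(\<lambda>x. norm (u x * v x)) summable_on A"
  proof (rule Infinite_Sum.abs_summable_on_comparison_test')
    show "(\<lambda>x. (u x)\<^sup>2 + (v x)\<^sup>2) summable_on A" by (intro summable_on_add u v)
    show "norm (u x * v x) \<le> (u x)\<^sup>2 + (v x)\<^sup>2" for x
      using sum_squares_bound[of "\<bar>u x\<bar>" "\<bar>v x\<bar>"] mult_nonneg_nonneg[of "\<bar>u x\<bar>" "\<bar>v x\<bar>"]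
      unfolding real_norm_def abs_mult power2_abs by linarith
  qed
  then show s: "(\<lambda>x. u x * v x) summable_on A" by (rule abs_summable_summable)
  have lim: "((\<lambda>F. (\<Sum>x\<in>F. u x * v x)\<^sup>2) \<longlongrightarrow> (\<Sum>\<^sub>\<infinity>x\<in>A. u x * v x)\<^sup>2) (finite_subsets_at_top A)"
    by (intro tendsto_power infsum_tendsto s)
  show "(\<Sum>\<^sub>\<infinity>x\<in>A. u x * v x)\<^sup>2 \<le> (\<Sum>\<^sub>\<infinity>x\<in>A. (u x)\<^sup>2) * (\<Sum>\<^sub>\<infinity>x\<in>A. (v x)\<^sup>2)"
  proof (rule tendsto_upperbound[OF lim])
    show "\<forall>\<^sub>F F in finite_subsets_at_top A.
        (\<Sum>x\<in>F. u x * v x)\<^sup>2 \<le> (\<Sum>\<^sub>\<infinity>x\<in>A. (u x)\<^sup>2) * (\<Sum>\<^sub>\<infinity>x\<in>A. (v x)\<^sup>2)"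
    proof (intro eventually_finite_subsets_at_top_weakI)
      fix F assume F: "finite F" "F \<subseteq> A"
      have "(\<Sum>x\<in>F. u x * v x)\<^sup>2 \<le> (\<Sum>x\<in>F. (u x)\<^sup>2) * (\<Sum>x\<in>F. (v x)\<^sup>2)"
        by (rule Cauchy_Schwarz_ineq_sum)
      also have "\<dots> \<le> (\<Sum>\<^sub>\<infinity>x\<in>A. (u x)\<^sup>2) * (\<Sum>\<^sub>\<infinity>x\<in>A. (v x)\<^sup>2)"
        using F u v by (intro mult_mono finite_sum_le_infsum sum_nonneg infsum_nonneg) auto
      finally show "(\<Sum>x\<in>F. u x * v x)\<^sup>2 \<le> (\<Sum>\<^sub>\<infinity>x\<in>A. (u x)\<^sup>2) * (\<Sum>\<^sub>\<infinity>x\<in>A. (v x)\<^sup>2)" .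
    qed
  qed simp
qed

lemma ell2_mult_abs_summable:
  assumes "f \<in> ell2" "h \<in> ell2"
  shows "(\<lambda>k. cmod (f k) * cmod (h k)) summable_on UNIV"
  using cauchy_schwarz_infsum(1)[of "\<lambda>k. cmod (f k)" UNIV "\<lambda>k. cmod (h k)"] assms by (simp add: ell2_def)

lemma ell2_mult_abs_infsum_le:
  assumes "f \<in> ell2" "h \<in> ell2"
  shows "(\<Sum>\<^sub>\<infinity>k. cmod (f k) * cmod (h k)) \<le> ell2_dist f (\<lambda>_. 0) * ell2_dist h (\<lambda>_. 0)"
proof (rule power2_le_imp_le)
  show "(\<Sum>\<^sub>\<infinity>k. cmod (f k) * cmod (h k))\<^sup>2 \<le> (ell2_dist f (\<lambda>_. 0) * ell2_dist h (\<lambda>_. 0))\<^sup>2"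
    using cauchy_schwarz_infsum(2)[of "\<lambda>k. cmod (f k)" UNIV "\<lambda>k. cmod (h k)"] assms
    by (simp add: ell2_def ell2_dist_def power_mult_distrib infsum_nonneg)
qed (simp add: ell2_dist_def infsum_nonneg)

text \<open>On the cube the product topology, compact by Tychonoff, is finer than the topology of \<open>ell2\<close>.\<close>

lemma compactin_hilbert_cube:
  fixes \<kappa> :: "'a \<Rightarrow> real"
  assumes \<kappa>: "(\<lambda>j. (\<kappa> j)\<^sup>2) summable_on UNIV"
  shows "compactin ell2.mtopology {u. \<forall>j. cmod (u j) \<le> \<kappa> j}"
proof -
  define Q where "Q = {u. \<forall>j. cmod (u j) \<le> \<kappa> j}"
  define X where "X = product_topology (\<lambda>_::'a. euclidean :: complex topology) UNIV"
  have Q: "Q = Pi\<^sub>E UNIV (\<lambda>j. cball 0 (\<kappa> j))" by (auto simp: Q_def PiE_def)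
  have Qell2: "Q \<subseteq> ell2"
  proof
    fix u assume "u \<in> Q"
    then have "(cmod (u j))\<^sup>2 \<le> (\<kappa> j)\<^sup>2" for j by (intro power_mono) (auto simp: Q_def)
    then show "u \<in> ell2" unfolding ell2_def by (auto intro: summable_on_comparison_test[OF \<kappa>])
  qed
  have comp: "compactin X Q"
    unfolding Q X_def by (simp add: compactin_PiE)
  have "continuous_map (subtopology X Q) ell2.mtopology id"
    unfolding ell2.continuous_map_to_metric
  proof (intro ballI allI impI)
    fix u and e :: real assume u: "u \<in> topspace (subtopology X Q)" and e: "e > 0"
    then have uQ: "u \<in> Q" by simp
    \<comment> \<open>Outside \<open>F\<close> two points of the cube differ by at most twice
      \<open>\<kappa> j\<close>, so the tail enters with the factor 4, and e^2/8 leaves e^2/2 for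
      it.\<close>
    obtain F where F: "finite F" "(\<Sum>\<^sub>\<infinity>j\<in>-F. (\<kappa> j)\<^sup>2) < e\<^sup>2 / 8"
    proof -
      have "((\<lambda>F. \<Sum>j\<in>F. (\<kappa> j)\<^sup>2) \<longlongrightarrow> (\<Sum>\<^sub>\<infinity>j. (\<kappa> j)\<^sup>2)) (finite_subsets_at_top UNIV)"
        by (rule infsum_tendsto[OF \<kappa>])
      then have "\<forall>\<^sub>F F in finite_subsets_at_top UNIV. dist (\<Sum>j\<in>F. (\<kappa> j)\<^sup>2) (\<Sum>\<^sub>\<infinity>j. (\<kappa> j)\<^sup>2) < e\<^sup>2 / 8"
        using e unfolding tendsto_iff by (meson divide_pos_pos zero_less_numeral zero_less_power)
      then obtain F where F: "finite F" "dist (\<Sum>j\<in>F. (\<kappa> j)\<^sup>2) (\<Sum>\<^sub>\<infinity>j. (\<kappa> j)\<^sup>2) < e\<^sup>2 / 8"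
        unfolding eventually_finite_subsets_at_top by blast
      have "(\<Sum>\<^sub>\<infinity>j\<in>-F. (\<kappa> j)\<^sup>2) = (\<Sum>\<^sub>\<infinity>j. (\<kappa> j)\<^sup>2) - (\<Sum>j\<in>F. (\<kappa> j)\<^sup>2)"
        using infsum_Diff[OF \<kappa>, of F] F by (simp add: summable_on_finite Compl_eq_Diff_UNIV)
      with F that[of F] show ?thesis unfolding dist_real_def by linarith
    qed
    \<comment> \<open>The \<open>card F\<close> coordinates in \<open>F\<close> together contribute
      at most e^2/2; the added 1 keeps \<open>d\<close> meaningful for empty
      \<open>F\<close>.\<close>
    define d where "d = sqrt (e\<^sup>2 / (2 * (card F + 1)))"
    have d: "d > 0" "d\<^sup>2 = e\<^sup>2 / (2 * (card F + 1))" using e by (auto simp: d_def)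
    define U where "U = {v. \<forall>j\<in>F. dist (v j) (u j) < d}"
    have "openin X {v \<in> topspace X. v j \<in> ball (u j) d}" for j
      unfolding X_def by (rule openin_continuous_map_preimage[OF continuous_map_product_projection]) auto
    then have "openin X (\<Inter>j\<in>F. {v \<in> topspace X. v j \<in> ball (u j) d})" if "F \<noteq> {}"
      using F that by (intro openin_Inter) auto
    moreover have "(\<Inter>j\<in>F. {v \<in> topspace X. v j \<in> ball (u j) d}) = U" if "F \<noteq> {}"
      using that by (auto simp: U_def X_def dist_commute)
    \<comment> \<open>A finite intersection of open sets is taken over a nonempty family; for empty
      \<open>F\<close> the set \<open>U\<close> is the whole space.\<close>
    moreover have "openin X U" if "F = {}"
      using openin_topspace[of X] that by (simp add: U_def X_def)
    ultimately have "openin X U" by (cases "F = {}") simp_all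
    then have "openin (subtopology X Q) (U \<inter> Q)" by (rule openin_subtopology_Int)
    moreover have "u \<in> U \<inter> Q" using uQ d by (auto simp: U_def)
    moreover have "id v \<in> ell2.mball (id u) e" if v: "v \<in> U \<inter> Q" for v
    proof -
      have uv: "u \<in> ell2" "v \<in> ell2" using uQ v Qell2 by auto
      have s: "(\<lambda>j. (cmod (u j - v j))\<^sup>2) summable_on UNIV" using ell2_diff[OF uv] by (simp add: ell2_def)
      have s': "(\<lambda>j. (cmod (u j - v j))\<^sup>2) summable_on - F" by (rule summable_on_subset_banach[OF s]) simp
      have \<kappa>': "(\<lambda>j. (\<kappa> j)\<^sup>2) summable_on - F" by (rule summable_on_subset_banach[OF \<kappa>]) simp
      have "(\<Sum>\<^sub>\<infinity>j. (cmod (u j - v j))\<^sup>2) = (\<Sum>\<^sub>\<infinity>j\<in>F \<union> -F. (cmod (u j - v j))\<^sup>2)" by simp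
      also have "\<dots> = (\<Sum>j\<in>F. (cmod (u j - v j))\<^sup>2) + (\<Sum>\<^sub>\<infinity>j\<in>-F. (cmod (u j - v j))\<^sup>2)"
        using F s' by (subst infsum_Un_disjoint) (auto simp: summable_on_finite)
      also have "(\<Sum>j\<in>F. (cmod (u j - v j))\<^sup>2) \<le> (\<Sum>j\<in>F. d\<^sup>2)"
        using v by (intro sum_mono power_mono) (auto simp: U_def dist_norm norm_minus_commute less_imp_le)
      also have "(\<Sum>j\<in>F. d\<^sup>2) \<le> e\<^sup>2 / 2"
        using e by (simp add: d field_simps)
      also have "(\<Sum>\<^sub>\<infinity>j\<in>-F. (cmod (u j - v j))\<^sup>2) \<le> (\<Sum>\<^sub>\<infinity>j\<in>-F. 4 * (\<kappa> j)\<^sup>2)"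
      proof (intro infsum_mono s' summable_on_cmult_right \<kappa>')
        fix j
        have "cmod (u j - v j) \<le> \<kappa> j + \<kappa> j"
          using uQ v norm_triangle_ineq4[of "u j" "v j"] unfolding Q_def by (smt (verit) IntD2 mem_Collect_eq)
        then have "(cmod (u j - v j))\<^sup>2 \<le> (\<kappa> j + \<kappa> j)\<^sup>2" by (intro power_mono) auto
        then show "(cmod (u j - v j))\<^sup>2 \<le> 4 * (\<kappa> j)\<^sup>2" by (simp add: power2_eq_square)
      qed
      also have "\<dots> = 4 * (\<Sum>\<^sub>\<infinity>j\<in>-F. (\<kappa> j)\<^sup>2)" by (rule infsum_cmult_right) (simp add: \<kappa>')
      also have "\<dots> < e\<^sup>2 / 2" using F by simp
      finally have "(\<Sum>\<^sub>\<infinity>j. (cmod (u j - v j))\<^sup>2) < e\<^sup>2" by simp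
      then have "ell2_dist u v < e"
        using e unfolding ell2_dist_def by (simp add: real_less_lsqrt infsum_nonneg)
      then show ?thesis using uv by simp
    qed
    ultimately show "\<exists>U. openin (subtopology X Q) U \<and> u \<in> U \<and> (\<forall>v\<in>U. id v \<in> ell2.mball (id u) e)" by blast
  qed
  moreover have "compactin (subtopology X Q) Q" using comp by (simp add: compactin_subtopology)
  ultimately show ?thesis
    using image_compactin[of "subtopology X Q" Q ell2.mtopology id] by (simp add: Q_def)
qed

text \<open>Cauchy-Schwarz on row \<open>j\<close> bounds the modulus of \<open>T f j\<close> by the
  norm of \<open>f\<close> times the norm \<open>\<kappa> j\<close> of that row, and the row norms
  are square-summable. A set within distance R of the origin thus lands in the cube with half-widths
  \<open>R * \<kappa> j\<close>; a compact set in a Hausdorff space is closed, so the cube also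
  contains the closure of the image.\<close>

lemma hilbert_schmidt_compact:
  fixes K :: "'a \<Rightarrow> 'a \<Rightarrow> complex"
  assumes K: "(\<lambda>(j, k). (cmod (K j k))\<^sup>2) summable_on UNIV"
  shows "compact_operator_ell2 (\<lambda>f j. \<Sum>\<^sub>\<infinity>k. K j k * f k)"
proof -
  define T where "T = (\<lambda>f j. \<Sum>\<^sub>\<infinity>k. K j k * f k)"
  have K': "(\<lambda>(j, k). (cmod (K j k))\<^sup>2) summable_on (SIGMA j:UNIV. UNIV)" using K by simp
  have row: "K j \<in> ell2" for j
    using summable_on_SigmaD1[OF K', of j] by (simp add: ell2_def)
  define \<kappa> where "\<kappa> j = ell2_dist (K j) (\<lambda>_. 0)" for j
  have \<kappa>2: "(\<kappa> j)\<^sup>2 = (\<Sum>\<^sub>\<infinity>k. (cmod (K j k))\<^sup>2)" for j by (simp add: \<kappa>_def ell2_dist_def infsum_nonneg)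
  have \<kappa>: "(\<lambda>j. (\<kappa> j)\<^sup>2) summable_on UNIV"
    using summable_on_Sigma_banach[OF K'] by (simp add: \<kappa>2)
  have s: "(\<lambda>k. K j k * f k) summable_on UNIV" if "f \<in> ell2" for f j
    using ell2_mult_abs_summable[OF row that, of j] 
    by (rule_tac abs_summable_summable) (simp add: norm_mult)
  have bound: "cmod (T f j) \<le> ell2_dist f (\<lambda>_. 0) * \<kappa> j" if "f \<in> ell2" for f j
  proof -
    have "cmod (T f j) \<le> (\<Sum>\<^sub>\<infinity>k. cmod (K j k * f k))"
      unfolding T_def using ell2_mult_abs_summable[OF row that, of j]
      by (intro norm_infsum_bound) (simp add: norm_mult)
    also have "\<dots> \<le> \<kappa> j * ell2_dist f (\<lambda>_. 0)"
      using ell2_mult_abs_infsum_le[OF row that, of j] by (simp add: norm_mult \<kappa>_def)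
    finally show ?thesis by (simp add: mult.commute)
  qed
  have cube: "(\<lambda>j. (R * \<kappa> j)\<^sup>2) summable_on UNIV" for R
    using summable_on_cmult_right[OF \<kappa>, of "R\<^sup>2"] by (simp add: power_mult_distrib)
  have "compactin ell2.mtopology (ell2.mtopology closure_of (T ` B))" if B: "ell2.mbounded B" for B
  proof -
    obtain x C where xC: "B \<subseteq> ell2.mcball x C" using B unfolding ell2.mbounded_def by blast
    define R where "R = ell2_dist x (\<lambda>_. 0) + C"
    define Q where "Q = {u. \<forall>j. cmod (u j) \<le> R * \<kappa> j}"
    have z: "(\<lambda>_. 0) \<in> ell2" by (simp add: ell2_def)
    have "T f \<in> Q" if "f \<in> B" for f
      unfolding Q_def
    proof (intro CollectI allI)
      fix j
      have f: "f \<in> ell2" "x \<in> ell2" "ell2_dist x f \<le> C" using xC that by (auto simp: ell2.mcball_def)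
      have "ell2_dist f (\<lambda>_. 0) \<le> ell2_dist f x + ell2_dist x (\<lambda>_. 0)"
        by (rule ell2.triangle[OF f(1,2) z])
      also have "\<dots> \<le> R" using f(3) ell2.commute[of f x] by (simp add: R_def)
      finally show "cmod (T f j) \<le> R * \<kappa> j"
        using order_trans[OF bound[OF f(1), of j] mult_right_mono[of "ell2_dist f (\<lambda>_. 0)" R "\<kappa> j"]]
        by (simp add: \<kappa>_def ell2_dist_def infsum_nonneg)
    qed
    then have sub: "T ` B \<subseteq> Q" by blast
    have Q: "compactin ell2.mtopology Q" unfolding Q_def by (rule compactin_hilbert_cube[OF cube])
    then have "closedin ell2.mtopology Q"
      by (rule compactin_imp_closedin[OF ell2.Hausdorff_space_mtopology])
    then have "ell2.mtopology closure_of (T ` B) \<subseteq> Q" by (rule closure_of_minimal[OF sub])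
    then show ?thesis by (rule closed_compactin[OF Q _ closedin_closure_of])
  qed
  moreover have "T f \<in> ell2" if "f \<in> ell2" for f
    unfolding ell2_def
  proof (rule CollectI, rule summable_on_comparison_test[OF cube])
    show "(cmod (T f j))\<^sup>2 \<le> (ell2_dist f (\<lambda>_. 0) * \<kappa> j)\<^sup>2" for j
      using bound[OF that, of j] by (intro power_mono) auto
  qed auto
  moreover have "T (\<lambda>k. f k + h k) = (\<lambda>k. T f k + T h k)" if "f \<in> ell2" "h \<in> ell2" for f h
    using that s by (auto simp: T_def fun_eq_iff distrib_left intro!: infsum_add)
  moreover have "T (\<lambda>k. c * f k) = (\<lambda>k. c * T f k)" if "f \<in> ell2" for c f
  proof
    fix j
    have "(\<Sum>\<^sub>\<infinity>k. c * (K j k * f k)) = c * (\<Sum>\<^sub>\<infinity>k. K j k * f k)"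
      by (rule infsum_cmult_right) (simp add: s[OF that])
    then show "T (\<lambda>k. c * f k) j = c * T f j" by (simp add: T_def mult.left_commute)
  qed
  ultimately show ?thesis unfolding compact_operator_ell2_def T_def by blast
qed

section \<open>Unimodular orthonormal systems\<close>

lemma integrable_count_space_iff_summable_norm:
  fixes f :: "'a \<Rightarrow> complex"
  shows "integrable (count_space UNIV) f \<longleftrightarrow> (\<lambda>i. norm (f i)) summable_on UNIV"
  using abs_summable_equivalent[of f UNIV] by (simp add: Infinite_Set_Sum.abs_summable_on_def)

text \<open>For complex families unconditional and absolute summability coincide, so the two sides
  fail to exist together, and both are then 0 by convention.\<close>

lemma infsum_eq_integral_count_space:
  fixes f :: "'a \<Rightarrow> complex"
  shows "infsum f UNIV = integral\<^sup>L (count_space UNIV) f"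
proof (cases "(\<lambda>i. norm (f i)) summable_on UNIV")
  case True
  then have "integrable (count_space UNIV) f" by (simp only: integrable_count_space_iff_summable_norm)
  then show ?thesis
    using infsetsum_infsum[of f UNIV]
    by (simp add: Infinite_Set_Sum.abs_summable_on_def infsetsum_def)
next
  case False
  then have "\<not> f summable_on UNIV" by (simp add: summable_on_iff_abs_summable_on_complex)
  moreover have "\<not> integrable (count_space UNIV) f"
    using False by (simp only: integrable_count_space_iff_summable_norm) simp
  ultimately show ?thesis by (simp add: infsum_not_exists not_integrable_integral_eq)
qed

lemma summable_on_iff_nn_integral_count_space:
  fixes f :: "'a \<Rightarrow> real"
  assumes "\<And>i. f i \<ge> 0"
  shows "f summable_on UNIV \<longleftrightarrow> (\<integral>\<^sup>+i. ennreal (f i) \<partial>count_space UNIV) < \<infinity>"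
proof -
  have "f summable_on UNIV \<longleftrightarrow> integrable (count_space UNIV) f"
    using abs_summable_equivalent[of f UNIV] assms by (simp add: Infinite_Set_Sum.abs_summable_on_def)
  then show ?thesis using assms by (simp add: integrable_iff_bounded)
qed

text \<open>Fubini for the counting measure times \<open>M\<close>. Countability of the index type
  makes the counting measure sigma-finite and reduces joint measurability to that of each
  \<open>F i\<close>.\<close>

lemma (in sigma_finite_measure) integral_infsum:
  fixes F :: "'i :: countable \<Rightarrow> 'a \<Rightarrow> complex"
  assumes F: "\<And>i. integrable M (F i)"
    and sum: "(\<lambda>i. \<integral>x. norm (F i x) \<partial>M) summable_on UNIV"
  shows "AE x in M. (\<lambda>i. norm (F i x)) summable_on UNIV"
    and "integrable M (\<lambda>x. \<Sum>\<^sub>\<infinity>i. F i x)"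
    and "((\<lambda>i. \<integral>x. F i x \<partial>M) has_sum (\<integral>x. (\<Sum>\<^sub>\<infinity>i. F i x) \<partial>M)) UNIV"
proof -
  interpret C: sigma_finite_measure "count_space (UNIV :: 'i set)"
    by (rule sigma_finite_measure_count_space_countable) simp
  interpret P: pair_sigma_finite "count_space (UNIV :: 'i set)" M ..
  have m: "(\<lambda>(i, x). F i x) \<in> borel_measurable (count_space UNIV \<Otimes>\<^sub>M M)"
    by (rule measurable_pair_measure_countable1) (use F in auto)
  have I: "integrable (count_space UNIV \<Otimes>\<^sub>M M) (\<lambda>(i, x). F i x)"
  proof (rule P.Fubini_integrable[OF m])
    have "(\<lambda>i. norm (\<integral>x. norm (F i x) \<partial>M)) summable_on UNIV" using sum by simp
    then show "integrable (count_space UNIV) (\<lambda>i. \<integral>x. norm (case (i, x) of (i, x) \<Rightarrow> F i x) \<partial>M)"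
      using abs_summable_equivalent[of "\<lambda>i. \<integral>x. norm (F i x) \<partial>M" UNIV]
      by (simp add: Infinite_Set_Sum.abs_summable_on_def)
  qed (use F in auto)
  show "AE x in M. (\<lambda>i. norm (F i x)) summable_on UNIV"
    using P.AE_integrable_snd[OF I] by (simp only: integrable_count_space_iff_summable_norm)
  show "integrable M (\<lambda>x. \<Sum>\<^sub>\<infinity>i. F i x)"
    using P.integrable_snd[OF I] by (simp add: infsum_eq_integral_count_space)
  have "(\<lambda>i. norm (\<integral>x. F i x \<partial>M)) summable_on UNIV"
    using P.integrable_fst[OF I] by (simp only: integrable_count_space_iff_summable_norm)
  then have "(\<lambda>i. \<integral>x. F i x \<partial>M) summable_on UNIV" by (rule abs_summable_summable)
  moreover have "(\<Sum>\<^sub>\<infinity>i. \<integral>x. F i x \<partial>M) = (\<integral>x. (\<Sum>\<^sub>\<infinity>i. F i x) \<partial>M)"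
    using P.integral_fst[OF I] P.integral_snd[OF I] by (simp add: infsum_eq_integral_count_space)
  ultimately show "((\<lambda>i. \<integral>x. F i x \<partial>M) has_sum (\<integral>x. (\<Sum>\<^sub>\<infinity>i. F i x) \<partial>M)) UNIV"
    by (simp add: has_sum_iff)
qed

text \<open>The variance is nonnegative.\<close>

lemma (in prob_space) square_integral_le:
  fixes f :: "'a \<Rightarrow> real"
  assumes f: "f \<in> borel_measurable M" and sq: "integrable M (\<lambda>x. (f x)\<^sup>2)"
  shows "integrable M f" and "(\<integral>x. f x \<partial>M)\<^sup>2 \<le> (\<integral>x. (f x)\<^sup>2 \<partial>M)"
proof -
  show i: "integrable M f" by (rule square_integrable_imp_integrable[OF f sq])
  show "(\<integral>x. f x \<partial>M)\<^sup>2 \<le> (\<integral>x. (f x)\<^sup>2 \<partial>M)"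
    using variance_positive[of f] variance_eq[OF i sq] by simp
qed

text \<open>
  Split \<open>|V i|\<close> at height 1: the part below 1 contributes at most the root of the integral of
  \<open>min (|V i|\<^sup>2) |V i|\<close>, the part above 1 at most that integral itself.
\<close>

lemma (in prob_space) square_summable_mean:
  fixes V :: "'i \<Rightarrow> 'a \<Rightarrow> complex"
  assumes V: "\<And>i. integrable M (V i)"
    and fin: "(\<integral>\<^sup>+i. (\<integral>\<^sup>+x. ennreal (min ((cmod (V i x))\<^sup>2) (cmod (V i x))) \<partial>M) \<partial>count_space UNIV) < \<infinity>"
  shows "(\<lambda>i. (\<integral>x. cmod (V i x) \<partial>M)\<^sup>2) summable_on UNIV"
proof -
  have [measurable]: "V i \<in> borel_measurable M" for i using V by auto
  define \<epsilon> where "\<epsilon> i = (\<integral>x. min ((cmod (V i x))\<^sup>2) (cmod (V i x)) \<partial>M)" for i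
  have int: "integrable M (\<lambda>x. min ((cmod (V i x))\<^sup>2) (cmod (V i x)))" for i
    by (rule Bochner_Integration.integrable_bound[OF integrable_norm[OF V[of i]]]) auto
  have \<epsilon>0: "\<epsilon> i \<ge> 0" for i unfolding \<epsilon>_def by (rule integral_nonneg_AE) auto
  have "(\<integral>\<^sup>+i. ennreal (\<epsilon> i) \<partial>count_space UNIV) < \<infinity>"
    using fin nn_integral_eq_integral[OF int] by (simp add: \<epsilon>_def)
  then have \<epsilon>: "\<epsilon> summable_on UNIV" by (simp add: summable_on_iff_nn_integral_count_space \<epsilon>0)
  have bound: "(\<integral>x. cmod (V i x) \<partial>M)\<^sup>2 \<le> 2 * \<epsilon> i + 2 * (\<epsilon> i)\<^sup>2" for i
  proof -
    define A where "A = (\<integral>x. min (cmod (V i x)) 1 \<partial>M)"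
    have intA: "integrable M (\<lambda>x. min (cmod (V i x)) 1)" "integrable M (\<lambda>x. (min (cmod (V i x)) 1)\<^sup>2)"
      by (rule integrable_const_bound[of _ 1]; simp add: power_le_one)+
    have square_min_one_le: "min a 1 * min a 1 \<le> min (a * a) a" if "a \<ge> 0" for a :: real
      using that mult_left_le[of a a] mult_left_mono[of 1 a a] by (auto simp: min_def)
    have le_min_one_add: "a \<le> min a 1 + min (a * a) a" if "a \<ge> 0" for a :: real
      using that mult_left_mono[of 1 a a] by (auto simp: min_def)
    have "A\<^sup>2 \<le> (\<integral>x. (min (cmod (V i x)) 1)\<^sup>2 \<partial>M)"
      unfolding A_def by (rule square_integral_le[OF _ intA(2)]) auto
    also have "\<dots> \<le> \<epsilon> i"
      unfolding \<epsilon>_def by (intro integral_mono intA int) (simp only: power2_eq_square square_min_one_le norm_ge_zero)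
    finally have A: "A\<^sup>2 \<le> \<epsilon> i" .
    have "(\<integral>x. cmod (V i x) \<partial>M) \<le> (\<integral>x. min (cmod (V i x)) 1 + min ((cmod (V i x))\<^sup>2) (cmod (V i x)) \<partial>M)"
      by (intro integral_mono integrable_norm V Bochner_Integration.integrable_add intA int)
         (simp only: power2_eq_square le_min_one_add norm_ge_zero)
    also have "\<dots> = A + \<epsilon> i"
      unfolding A_def \<epsilon>_def by (rule Bochner_Integration.integral_add[OF intA(1) int])
    finally have "(\<integral>x. cmod (V i x) \<partial>M)\<^sup>2 \<le> (A + \<epsilon> i)\<^sup>2" by (intro power_mono) auto
    also have "\<dots> \<le> 2 * A\<^sup>2 + 2 * (\<epsilon> i)\<^sup>2"
      using sum_squares_bound[of A "\<epsilon> i"] by (simp add: power2_sum)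
    finally show ?thesis using A by simp
  qed
  \<comment> \<open>Each \<open>\<epsilon> i\<close> is at most the total sum, so its square is at
    most a constant times itself.\<close>
  have sq: "(\<lambda>i. (\<epsilon> i)\<^sup>2) summable_on UNIV"
  proof (rule summable_on_comparison_test[OF summable_on_cmult_right[OF \<epsilon>, of "infsum \<epsilon> UNIV"]])
    show "(\<epsilon> i)\<^sup>2 \<le> infsum \<epsilon> UNIV * \<epsilon> i" for i
      using finite_sum_le_infsum[OF \<epsilon>, of "{i}"] \<epsilon>0 by (auto simp: power2_eq_square intro!: mult_right_mono)
  qed auto
  show ?thesis
    by (rule summable_on_comparison_test[OF summable_on_add[OF summable_on_cmult_right[OF \<epsilon>] summable_on_cmult_right[OF sq]]])
      (use bound in auto)
qed

text \<open>Three systems are instances: the characters of the torus, the reflected ones that occur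
  in the lattice transform, and products of two characters on the square of the torus. Modulus 1
  makes a series with absolutely summable coefficients converge absolutely at every point, and lets
  a function be tested against \<open>\<psi> j\<close> without changing its L^1 norm.\<close>

locale unimodular_system = prob_space M for M :: "'a measure" +
  fixes \<psi> :: "'i :: countable \<Rightarrow> 'a \<Rightarrow> complex"
  assumes \<psi>_measurable [measurable]: "\<And>i. \<psi> i \<in> borel_measurable M"
    and \<psi>_norm [simp]: "\<And>i x. cmod (\<psi> i x) = 1"
    and \<psi>_orthonormal: "\<And>i j. (\<integral>x. \<psi> i x * cnj (\<psi> j x) \<partial>M) = (if i = j then 1 else 0)"
begin

lemma integrable_mult_\<psi>:
  assumes "integrable M s"
  shows "integrable M (\<lambda>x. s x * \<psi> i x)" and "integrable M (\<lambda>x. s x * cnj (\<psi> i x))"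
proof -
  have [measurable]: "s \<in> borel_measurable M" using assms by auto
  have [measurable]: "(\<lambda>x. cnj (\<psi> i x)) \<in> borel_measurable M"
    by (rule borel_measurable_continuous_on[where f = cnj, OF _ \<psi>_measurable]) (intro continuous_intros)
  show "integrable M (\<lambda>x. s x * \<psi> i x)" "integrable M (\<lambda>x. s x * cnj (\<psi> i x))"
    by (rule Bochner_Integration.integrable_bound[OF assms]; simp add: norm_mult)+
qed

text \<open>The i-th term has L^1 norm \<open>cmod (b i)\<close> times that of \<open>s\<close>, so
  termwise integration is legitimate. A conjugate member of the system as \<open>s\<close> yields
  the coefficients of the series, the conjugate of the series itself yields Parseval.\<close>

lemma integral_mult_series:
  fixes b :: "'i \<Rightarrow> complex"
  assumes b: "(\<lambda>i. cmod (b i)) summable_on UNIV" and s: "integrable M s"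
  shows "((\<lambda>i. b i * (\<integral>x. s x * \<psi> i x \<partial>M)) has_sum (\<integral>x. s x * (\<Sum>\<^sub>\<infinity>i. b i * \<psi> i x) \<partial>M)) UNIV"
    and "integrable M (\<lambda>x. s x * (\<Sum>\<^sub>\<infinity>i. b i * \<psi> i x))"
proof -
  define F where "F i x = s x * (b i * \<psi> i x)" for i x
  have F: "F i = (\<lambda>x. b i * (s x * \<psi> i x))" for i by (simp add: F_def fun_eq_iff)
  have int: "integrable M (F i)" for i
    unfolding F by (intro integrable_mult_right integrable_mult_\<psi> s)
  have "(\<lambda>i. \<integral>x. norm (F i x) \<partial>M) = (\<lambda>i. cmod (b i) * (\<integral>x. cmod (s x) \<partial>M))"
    by (simp add: F norm_mult)
  then have sum: "(\<lambda>i. \<integral>x. norm (F i x) \<partial>M) summable_on UNIV"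
    using b by (simp add: summable_on_cmult_left)
  have eq: "(\<lambda>x. \<Sum>\<^sub>\<infinity>i. F i x) = (\<lambda>x. s x * (\<Sum>\<^sub>\<infinity>i. b i * \<psi> i x))"
    unfolding F_def by (intro ext infsum_cmult_right')
  show "integrable M (\<lambda>x. s x * (\<Sum>\<^sub>\<infinity>i. b i * \<psi> i x))"
    using integral_infsum(2)[OF int sum] by (simp only: eq)
  show "((\<lambda>i. b i * (\<integral>x. s x * \<psi> i x \<partial>M)) has_sum (\<integral>x. s x * (\<Sum>\<^sub>\<infinity>i. b i * \<psi> i x) \<partial>M)) UNIV"
    using integral_infsum(3)[OF int sum] unfolding eq by (simp add: F)
qed

lemma integrable_series:
  fixes b :: "'i \<Rightarrow> complex"
  assumes "(\<lambda>i. cmod (b i)) summable_on UNIV"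
  shows "integrable M (\<lambda>x. \<Sum>\<^sub>\<infinity>i. b i * \<psi> i x)"
  using integral_mult_series(2)[OF assms, of "\<lambda>_. 1"] by simp

lemma series_norm_le:
  fixes b :: "'i \<Rightarrow> complex"
  assumes "(\<lambda>i. cmod (b i)) summable_on UNIV"
  shows "cmod (\<Sum>\<^sub>\<infinity>i. b i * \<psi> i x) \<le> (\<Sum>\<^sub>\<infinity>i. cmod (b i))"
  using norm_infsum_bound[of "\<lambda>i. b i * \<psi> i x" UNIV] assms by (simp add: norm_mult)

lemma integral_series_coeff:
  fixes b :: "'i \<Rightarrow> complex"
  assumes "(\<lambda>i. cmod (b i)) summable_on UNIV"
  shows "(\<integral>x. (\<Sum>\<^sub>\<infinity>i. b i * \<psi> i x) * cnj (\<psi> j x) \<partial>M) = b j"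
proof -
  have "integrable M (\<lambda>x. cnj (\<psi> j x))" using integrable_mult_\<psi>(2)[of "\<lambda>_. 1" j] by simp
  from integral_mult_series(1)[OF assms this]
  have "((\<lambda>i. b i * (if i = j then 1 else 0)) has_sum (\<integral>x. (\<Sum>\<^sub>\<infinity>i. b i * \<psi> i x) * cnj (\<psi> j x) \<partial>M)) UNIV"
    by (simp add: mult.commute \<psi>_orthonormal[symmetric])
  moreover have "((\<lambda>i. b i * (if i = j then 1 else 0)) has_sum b j) UNIV"
    by (rule has_sum_finite_neutralI[where B = "{j}"]) auto
  ultimately show ?thesis by (rule has_sum_unique)
qed

text \<open>The coefficient is the integral of the series against a function of modulus 1. This is
  how an L^1 estimate of a transform reaches its individual coefficients.\<close>

lemma coeff_norm_le:
  fixes b :: "'i \<Rightarrow> complex"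
  assumes "(\<lambda>i. cmod (b i)) summable_on UNIV"
  shows "cmod (b j) \<le> (\<integral>x. cmod (\<Sum>\<^sub>\<infinity>i. b i * \<psi> i x) \<partial>M)"
proof -
  have "cmod (b j) \<le> (\<integral>x. cmod ((\<Sum>\<^sub>\<infinity>i. b i * \<psi> i x) * cnj (\<psi> j x)) \<partial>M)"
    by (subst integral_series_coeff[OF assms, of j, symmetric]) (rule integral_norm_bound)
  then show ?thesis by (simp add: norm_mult)
qed

text \<open>This is \<open>integral_mult_series\<close> with the conjugate of \<open>V\<close> as
  \<open>s\<close>, whose integrals against \<open>\<psi> i\<close> are the conjugates of
  \<open>b i\<close>.\<close>

lemma parseval_series:
  fixes b :: "'i \<Rightarrow> complex"
  assumes b: "(\<lambda>i. cmod (b i)) summable_on UNIV"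
  defines "V \<equiv> \<lambda>x. \<Sum>\<^sub>\<infinity>i. b i * \<psi> i x"
  shows "integrable M (\<lambda>x. (cmod (V x))\<^sup>2)" and "((\<lambda>i. (cmod (b i))\<^sup>2) has_sum (\<integral>x. (cmod (V x))\<^sup>2 \<partial>M)) UNIV"
proof -
  have V: "integrable M V" unfolding V_def by (rule integrable_series[OF b])
  then have [measurable]: "V \<in> borel_measurable M" by auto
  have cV: "integrable M (\<lambda>x. cnj (V x))" using V by simp
  have sq: "cnj (V x) * V x = complex_of_real ((cmod (V x))\<^sup>2)" for x
    by (simp only: complex_norm_square mult.commute)
  have coeff: "(\<integral>x. cnj (V x) * \<psi> i x \<partial>M) = cnj (b i)" for i
  proof -
    have "(\<integral>x. cnj (V x) * \<psi> i x \<partial>M) = (\<integral>x. cnj (V x * cnj (\<psi> i x)) \<partial>M)" by simp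
    also have "\<dots> = cnj (\<integral>x. V x * cnj (\<psi> i x) \<partial>M)" by (rule Bochner_Integration.integral_cnj)
    also have "\<dots> = cnj (b i)" unfolding V_def by (simp add: integral_series_coeff[OF b])
    finally show ?thesis .
  qed
  have ser: "((\<lambda>i. b i * (\<integral>x. cnj (V x) * \<psi> i x \<partial>M)) has_sum (\<integral>x. cnj (V x) * V x \<partial>M)) UNIV"
      "integrable M (\<lambda>x. cnj (V x) * V x)"
    using integral_mult_series[OF b cV] unfolding V_def by blast+
  show int: "integrable M (\<lambda>x. (cmod (V x))\<^sup>2)"
    using ser(2) unfolding sq by (rule iffD1[OF complex_of_real_integrable_eq])
  have "((\<lambda>i. complex_of_real ((cmod (b i))\<^sup>2)) has_sum complex_of_real (\<integral>x. (cmod (V x))\<^sup>2 \<partial>M)) UNIV"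
    using ser(1) unfolding sq coeff complex_norm_square integral_complex_of_real[symmetric] by simp
  then show "((\<lambda>i. (cmod (b i))\<^sup>2) has_sum (\<integral>x. (cmod (V x))\<^sup>2 \<partial>M)) UNIV"
    by (simp only: has_sum_of_real_iff)
qed

lemma integral_finite_combination_square:
  assumes F: "finite F"
  shows "integrable M (\<lambda>x. (cmod (\<Sum>i\<in>F. c i * \<psi> i x))\<^sup>2)"
    and "(\<integral>x. (cmod (\<Sum>i\<in>F. c i * \<psi> i x))\<^sup>2 \<partial>M) = (\<Sum>i\<in>F. (cmod (c i))\<^sup>2)"
proof -
  define b where "b i = (if i \<in> F then c i else 0)" for i
  have b: "(\<lambda>i. cmod (b i)) summable_on UNIV"
    by (rule has_sum_imp_summable, rule has_sum_finite_neutralI[where B = F]) (auto simp: b_def F)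
  have V: "(\<Sum>\<^sub>\<infinity>i. b i * \<psi> i x) = (\<Sum>i\<in>F. c i * \<psi> i x)" for x
    by (rule infsumI, rule has_sum_finite_neutralI[where B = F]) (auto simp: b_def F)
  have "((\<lambda>i. (cmod (b i))\<^sup>2) has_sum (\<Sum>i\<in>F. (cmod (c i))\<^sup>2)) UNIV"
    by (rule has_sum_finite_neutralI[where B = F]) (auto simp: b_def F)
  then show "(\<integral>x. (cmod (\<Sum>i\<in>F. c i * \<psi> i x))\<^sup>2 \<partial>M) = (\<Sum>i\<in>F. (cmod (c i))\<^sup>2)"
    using has_sum_unique[OF parseval_series(2)[OF b]] by (simp add: V)
  show "integrable M (\<lambda>x. (cmod (\<Sum>i\<in>F. c i * \<psi> i x))\<^sup>2)"
    using parseval_series(1)[OF b] by (simp add: V)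
qed

text \<open>The rate 1/4 for squares becomes 1/2 for norms, so the blocks between consecutive
  \<open>F n\<close> get geometrically decreasing norms.\<close>

lemma square_summable_tail_sets:
  fixes c :: "'i \<Rightarrow> complex"
  assumes c: "(\<lambda>i. (cmod (c i))\<^sup>2) summable_on UNIV"
  obtains F :: "nat \<Rightarrow> 'i set" where "\<And>n. finite (F n)" "incseq F"
    "\<And>n G. finite G \<Longrightarrow> G \<inter> F n = {} \<Longrightarrow> (\<Sum>i\<in>G. (cmod (c i))\<^sup>2) \<le> (1/4) ^ n"
proof -
  have "\<exists>H. finite H \<and> (\<forall>G. finite G \<longrightarrow> G \<inter> H = {} \<longrightarrow> (\<Sum>i\<in>G. (cmod (c i))\<^sup>2) \<le> (1/4) ^ n)" for n :: nat
  proof -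
    have "\<forall>\<^sub>F H in finite_subsets_at_top UNIV. dist (\<Sum>i\<in>H. (cmod (c i))\<^sup>2) (\<Sum>\<^sub>\<infinity>i. (cmod (c i))\<^sup>2) < (1/4) ^ n"
      using infsum_tendsto[OF c] unfolding tendsto_iff by auto
    then obtain H where H: "finite H" "dist (\<Sum>i\<in>H. (cmod (c i))\<^sup>2) (\<Sum>\<^sub>\<infinity>i. (cmod (c i))\<^sup>2) < (1/4) ^ n"
      unfolding eventually_finite_subsets_at_top by blast
    have "(\<Sum>i\<in>G. (cmod (c i))\<^sup>2) \<le> (1/4) ^ n" if "finite G" "G \<inter> H = {}" for G
    proof -
      have "(\<Sum>i\<in>G. (cmod (c i))\<^sup>2) + (\<Sum>i\<in>H. (cmod (c i))\<^sup>2) = (\<Sum>i\<in>G \<union> H. (cmod (c i))\<^sup>2)"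
        using that H by (subst sum.union_disjoint) auto
      also have "\<dots> \<le> (\<Sum>\<^sub>\<infinity>i. (cmod (c i))\<^sup>2)"
        using that H by (intro finite_sum_le_infsum c) auto
      finally show ?thesis using H by (auto simp: dist_real_def)
    qed
    with H show ?thesis by blast
  qed
  then obtain H where H: "\<And>n. finite (H n)"
      "\<And>n G. finite G \<Longrightarrow> G \<inter> H n = {} \<Longrightarrow> (\<Sum>i\<in>G. (cmod (c i))\<^sup>2) \<le> (1/4) ^ n"
    by metis
  show thesis
  proof (rule that[of "\<lambda>n. \<Union>m\<le>n. H m"])
    show "incseq (\<lambda>n. \<Union>m\<le>n. H m)" by (intro monoI UN_mono) auto
  qed (use H in \<open>auto intro!: H(2)\<close>)
qed

text \<open>The series is summed in blocks. Their L^1 norms decrease geometrically by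
  \<open>square_integral_le\<close>, so \<open>integral_infsum\<close> gives convergence almost
  everywhere and termwise integration. The L^2 bound is Fatou's lemma for the partial sums over
  \<open>F N\<close>.\<close>

lemma riesz_fischer:
  fixes c :: "'i \<Rightarrow> complex"
  assumes c: "(\<lambda>i. (cmod (c i))\<^sup>2) summable_on UNIV"
  obtains s where "integrable M s" "integrable M (\<lambda>x. (cmod (s x))\<^sup>2)"
    "(\<integral>x. (cmod (s x))\<^sup>2 \<partial>M) \<le> (\<Sum>\<^sub>\<infinity>i. (cmod (c i))\<^sup>2)"
    "\<And>i. (\<integral>x. s x * cnj (\<psi> i x) \<partial>M) = c i"
proof -
  obtain F :: "nat \<Rightarrow> 'i set" where F: "\<And>n. finite (F n)" "incseq F"
    and tail: "\<And>n G. finite G \<Longrightarrow> G \<inter> F n = {} \<Longrightarrow> (\<Sum>i\<in>G. (cmod (c i))\<^sup>2) \<le> (1/4) ^ n"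
    using square_summable_tail_sets[OF c] by blast
  define D where "D n = (case n of 0 \<Rightarrow> F 0 | Suc m \<Rightarrow> F (Suc m) - F m)" for n
  define A where "A n x = (\<Sum>i\<in>D n. c i * \<psi> i x)" for n x
  define s where "s x = (\<Sum>\<^sub>\<infinity>n. A n x)" for x
  have D: "finite (D n)" for n using F by (auto simp: D_def split: nat.split)
  have partial: "(\<Sum>n<Suc N. f n) = (\<Sum>i\<in>F N. g i)"
    if "\<And>n. f n = (\<Sum>i\<in>D n. g i)" for f :: "nat \<Rightarrow> complex" and g N
  proof (induction N)
    case (Suc N)
    have "F N \<subseteq> F (Suc N)" using F(2) by (rule incseq_SucD)
    then have "(\<Sum>i\<in>F (Suc N). g i) = (\<Sum>i\<in>F (Suc N) - F N. g i) + (\<Sum>i\<in>F N. g i)"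
      using F(1) by (intro sum.subset_diff) auto
    then show ?case using Suc that[of "Suc N"] by (simp add: D_def)
  qed (simp add: that D_def)
  have \<psi>_int: "integrable M (\<psi> i)" for i using integrable_mult_\<psi>(1)[of "\<lambda>_. 1" i] by simp
  have A_int: "integrable M (A n)" for n
    unfolding A_def[abs_def] by (intro Bochner_Integration.integrable_sum integrable_mult_right \<psi>_int)
  \<comment> \<open>No tail bound covers \<open>A 0\<close>, so its own mean is put in as a factor
    and the case of index 0 becomes trivial; for \<open>n = Suc m\<close> the second summand is
    (1/2)^m.\<close>
  have A_norm: "(\<integral>x. cmod (A n x) \<partial>M) \<le> (\<integral>x. cmod (A 0 x) \<partial>M) * (1/2) ^ n + 2 * (1/2) ^ n" for n
  proof (cases n)
    case 0
    then show ?thesis by simp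
  next
    case (Suc m)
    have "(\<integral>x. cmod (A n x) \<partial>M)\<^sup>2 \<le> (\<integral>x. (cmod (A n x))\<^sup>2 \<partial>M)"
    proof (rule square_integral_le(2))
      show "(\<lambda>x. cmod (A n x)) \<in> borel_measurable M" using A_int[of n] by auto
      show "integrable M (\<lambda>x. (cmod (A n x))\<^sup>2)"
        unfolding A_def by (rule integral_finite_combination_square[OF D])
    qed
    also have "\<dots> = (\<Sum>i\<in>D n. (cmod (c i))\<^sup>2)"
      unfolding A_def by (rule integral_finite_combination_square[OF D])
    also have "\<dots> \<le> (1/4) ^ m" using Suc by (intro tail D) (auto simp: D_def)
    also have "\<dots> = ((1/2) ^ m)\<^sup>2" by (simp add: power2_eq_square power_mult_distrib[symmetric])
    finally have "(\<integral>x. cmod (A n x) \<partial>M) \<le> (1/2) ^ m" by (rule power2_le_imp_le) simp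
    then show ?thesis using Suc by (simp add: add_increasing)
  qed
  have A_sum: "(\<lambda>n. \<integral>x. cmod (A n x) \<partial>M) summable_on UNIV"
  proof (rule summable_on_comparison_test)
    have "summable (\<lambda>n. (1/2 :: real) ^ n)" by (rule summable_geometric) simp
    then have "(\<lambda>n. (1/2 :: real) ^ n) summable_on UNIV" by (intro norm_summable_imp_summable_on) simp
    then show "(\<lambda>n. (\<integral>x. cmod (A 0 x) \<partial>M) * (1/2) ^ n + 2 * (1/2) ^ n) summable_on UNIV"
      by (intro summable_on_add summable_on_cmult_right)
  qed (use A_norm in auto)
  have s_int: "integrable M s" unfolding s_def by (rule integral_infsum(2)[OF A_int A_sum])
  then have [measurable]: "s \<in> borel_measurable M" by auto
  have lim: "AE x in M. (\<lambda>N. \<Sum>i\<in>F N. c i * \<psi> i x) \<longlonglongrightarrow> s x"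
    using integral_infsum(1)[OF A_int A_sum]
  proof eventually_elim
    case (elim x)
    then have "((\<lambda>n. A n x) has_sum s x) UNIV"
      unfolding s_def by (rule has_sum_infsum[OF abs_summable_summable])
    then have "(\<lambda>N. \<Sum>n<N. A n x) \<longlonglongrightarrow> s x" using has_sum_imp_sums unfolding sums_def by blast
    then have "(\<lambda>N. \<Sum>n<Suc N. A n x) \<longlonglongrightarrow> s x" by (rule LIMSEQ_Suc)
    then show ?case using partial[of "\<lambda>n. A n x" "\<lambda>i. c i * \<psi> i x"] by (simp add: A_def)
  qed
  have nn: "(\<integral>\<^sup>+x. ennreal ((cmod (s x))\<^sup>2) \<partial>M) \<le> ennreal (\<Sum>\<^sub>\<infinity>i. (cmod (c i))\<^sup>2)"
  proof -
    have "(\<integral>\<^sup>+x. ennreal ((cmod (s x))\<^sup>2) \<partial>M)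
        = (\<integral>\<^sup>+x. liminf (\<lambda>N. ennreal ((cmod (\<Sum>i\<in>F N. c i * \<psi> i x))\<^sup>2)) \<partial>M)"
    proof (rule nn_integral_cong_AE, use lim in eventually_elim)
      case (elim x)
      then have "(\<lambda>N. ennreal ((cmod (\<Sum>i\<in>F N. c i * \<psi> i x))\<^sup>2)) \<longlonglongrightarrow> ennreal ((cmod (s x))\<^sup>2)"
        by (intro tendsto_ennrealI tendsto_power tendsto_norm)
      then show ?case by (rule lim_imp_Liminf[symmetric, rotated]) simp
    qed
    also have "\<dots> \<le> liminf (\<lambda>N. \<integral>\<^sup>+x. ennreal ((cmod (\<Sum>i\<in>F N. c i * \<psi> i x))\<^sup>2) \<partial>M)"
      by (rule nn_integral_liminf) simp
    also have "\<dots> \<le> ennreal (\<Sum>\<^sub>\<infinity>i. (cmod (c i))\<^sup>2)"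
    proof (rule Liminf_le)
      have "(\<integral>\<^sup>+x. ennreal ((cmod (\<Sum>i\<in>F N. c i * \<psi> i x))\<^sup>2) \<partial>M) \<le> ennreal (\<Sum>\<^sub>\<infinity>i. (cmod (c i))\<^sup>2)" for N
      proof -
        have "(\<integral>\<^sup>+x. ennreal ((cmod (\<Sum>i\<in>F N. c i * \<psi> i x))\<^sup>2) \<partial>M) = ennreal (\<Sum>i\<in>F N. (cmod (c i))\<^sup>2)"
          using integral_finite_combination_square[OF F(1)] by (simp add: nn_integral_eq_integral)
        also have "\<dots> \<le> ennreal (\<Sum>\<^sub>\<infinity>i. (cmod (c i))\<^sup>2)"
          using F by (intro ennreal_leI finite_sum_le_infsum c) auto
        finally show ?thesis .
      qed
      then show "\<forall>\<^sub>F N in sequentially. (\<integral>\<^sup>+x. ennreal ((cmod (\<Sum>i\<in>F N. c i * \<psi> i x))\<^sup>2) \<partial>M)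
          \<le> ennreal (\<Sum>\<^sub>\<infinity>i. (cmod (c i))\<^sup>2)" by simp
    qed simp
    finally show ?thesis .
  qed
  have sq: "integrable M (\<lambda>x. (cmod (s x))\<^sup>2)"
    using nn by (intro integrableI_bounded) (auto simp: le_less_trans[OF _ ennreal_less_top])
  have le: "(\<integral>x. (cmod (s x))\<^sup>2 \<partial>M) \<le> (\<Sum>\<^sub>\<infinity>i. (cmod (c i))\<^sup>2)"
    using nn nn_integral_eq_integral[OF sq] by (simp add: infsum_nonneg)
  have coeff: "(\<integral>x. s x * cnj (\<psi> i x) \<partial>M) = c i" for i
  proof -
    define B where "B n x = A n x * cnj (\<psi> i x)" for n x
    have B_int: "integrable M (B n)" for n
      unfolding B_def by (rule integrable_mult_\<psi>(2)[OF A_int])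
    have B_eq: "(\<integral>x. B n x \<partial>M) = (\<Sum>j\<in>D n. if j = i then c j else 0)" for n
    proof -
      have "(\<integral>x. B n x \<partial>M) = (\<integral>x. (\<Sum>j\<in>D n. c j * (\<psi> j x * cnj (\<psi> i x))) \<partial>M)"
        by (simp add: B_def A_def sum_distrib_right mult.assoc)
      also have "\<dots> = (\<Sum>j\<in>D n. c j * (\<integral>x. \<psi> j x * cnj (\<psi> i x) \<partial>M))"
        by (subst Bochner_Integration.integral_sum) (auto intro!: integrable_mult_right integrable_mult_\<psi>(2) \<psi>_int)
      also have "\<dots> = (\<Sum>j\<in>D n. if j = i then c j else 0)" by (intro sum.cong) (auto simp: \<psi>_orthonormal)
      finally show ?thesis .
    qed
    have "(\<lambda>n. \<integral>x. norm (B n x) \<partial>M) summable_on UNIV"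
      using A_sum by (simp add: B_def norm_mult)
    from integral_infsum(3)[OF B_int this]
    have "((\<lambda>n. \<integral>x. B n x \<partial>M) has_sum (\<integral>x. s x * cnj (\<psi> i x) \<partial>M)) UNIV"
      by (simp add: B_def s_def infsum_cmult_left')
    then have "(\<lambda>N. \<Sum>n<N. \<integral>x. B n x \<partial>M) \<longlonglongrightarrow> (\<integral>x. s x * cnj (\<psi> i x) \<partial>M)"
      using has_sum_imp_sums unfolding sums_def by blast
    then have "(\<lambda>N. \<Sum>n<Suc N. \<integral>x. B n x \<partial>M) \<longlonglongrightarrow> (\<integral>x. s x * cnj (\<psi> i x) \<partial>M)" by (rule LIMSEQ_Suc)
    also have "(\<lambda>N. \<Sum>n<Suc N. \<integral>x. B n x \<partial>M) = (\<lambda>N. if i \<in> F N then c i else 0)"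
      using partial[of "\<lambda>n. \<integral>x. B n x \<partial>M", OF B_eq] F(1) by (simp add: fun_eq_iff)
    finally have 1: "(\<lambda>N. if i \<in> F N then c i else 0) \<longlonglongrightarrow> (\<integral>x. s x * cnj (\<psi> i x) \<partial>M)" .
    \<comment> \<open>If \<open>c i\<close> is nonzero, then \<open>i\<close> is in
      \<open>F N\<close> for all large \<open>N\<close>: otherwise \<open>tail\<close> for the
      singleton of \<open>i\<close> would bound the square of its modulus by (1/4)^N. If it is 0,
      both branches agree.\<close>
    have "(\<lambda>N. if i \<in> F N then c i else 0) \<longlonglongrightarrow> c i"
    proof (cases "c i = 0")
      case False
      have "(\<lambda>N. (1/4 :: real) ^ N) \<longlonglongrightarrow> 0" by (rule LIMSEQ_power_zero) simp
      then have "\<forall>\<^sub>F N in sequentially. (1/4 :: real) ^ N < (cmod (c i))\<^sup>2"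
        by (rule order_tendstoD) (use False in simp)
      then have "\<forall>\<^sub>F N in sequentially. (if i \<in> F N then c i else 0) = c i"
      proof eventually_elim
        case (elim N)
        then show ?case using tail[of "{i}" N] by auto
      qed
      then show ?thesis by (rule tendsto_eventually)
    qed (auto intro!: tendsto_eventually)
    with 1 show ?thesis by (rule LIMSEQ_unique)
  qed
  show thesis by (rule that[OF s_int sq le coeff])
qed

end

section \<open>Fourier series on the torus\<close>

lemma ivec_simps [simp]:
  "ivec 0 = 0" "ivec (k + l) = ivec k + ivec l" "ivec (k - l) = ivec k - ivec l" "ivec (- k) = - ivec k"
  by (simp_all add: ivec_def vec_eq_iff)

lemma ivec_axis: "ivec (axis i 1) = axis i 1"
  by (simp add: ivec_def vec_eq_iff axis_def)

definition character :: "int ^ 'n \<Rightarrow> real ^ 'n \<Rightarrow> complex" where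
  "character q y = cis (2 * pi * (ivec q \<bullet> y))"

lemma norm_character [simp]: "cmod (character q y) = 1"
  by (simp add: character_def)

lemma character_0 [simp]: "character 0 y = 1"
  by (simp add: character_def)

lemma character_add: "character (p + q) y = character p y * character q y"
  by (simp add: character_def inner_add_left distrib_left cis_mult)

lemma cnj_character: "cnj (character q y) = character (- q) y"
  by (simp add: character_def cis_cnj)

lemma character_translate: "character q (y + z) = character q y * character q z"
  by (simp add: character_def inner_add_right distrib_left cis_mult)

lemma continuous_on_character [continuous_intros]:
  "continuous_on A f \<Longrightarrow> continuous_on A (\<lambda>x. character q (f x))"
  unfolding character_def by (intro continuous_intros)

definition periodic :: "(real ^ 'n \<Rightarrow> 'a) \<Rightarrow> bool" where
  "periodic f \<longleftrightarrow> (\<forall>y l. f (y + ivec l) = f y)"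

lemma character_ivec [simp]: "character q (ivec l) = 1"
proof -
  have "ivec q \<bullet> ivec l = of_int (\<Sum>i\<in>UNIV. q $ i * l $ i)"
    by (simp add: inner_vec_def ivec_def)
  then have "ivec q \<bullet> ivec l \<in> \<int>" by (metis Ints_of_int)
  then show ?thesis unfolding character_def by (rule cis_multiple_2pi)
qed

lemma periodic_character: "periodic (character q)"
  by (simp add: periodic_def character_translate)

lemma prob_space_torus: "prob_space (torus :: (real ^ 'n) measure)"
proof
  have "emeasure (torus :: (real ^ 'n) measure) (space torus) = emeasure lborel (cbox 0 1 :: (real ^ 'n) set)"
    by (simp add: torus_def space_restrict_space emeasure_restrict_space)
  also have "\<dots> = 1"
    by (subst emeasure_lborel_cbox) (auto simp: Basis_vec_def inner_axis prod.neutral)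
  finally show "emeasure torus (space torus :: (real ^ 'n) set) = 1" .
qed

interpretation torus: prob_space torus by (rule prob_space_torus)

lemma space_torus: "space torus = cbox 0 1"
  by (simp add: torus_def space_restrict_space)

lemma borel_measurable_torus [measurable_dest]: "f \<in> borel_measurable borel \<Longrightarrow> f \<in> borel_measurable torus"
  unfolding torus_def by (intro measurable_restrict_space1) simp

lemma integrable_torus_continuous:
  fixes f :: "real ^ 'n \<Rightarrow> 'b :: euclidean_space"
  assumes "continuous_on UNIV f"
  shows "integrable torus f" and "(\<integral>y. f y \<partial>torus) = integral (cbox 0 1) f"
proof -
  have i: "set_integrable lborel (cbox 0 1) f"
    unfolding set_integrable_def
    by (intro borel_integrable_compact continuous_on_subset[OF assms]) auto
  then show "integrable torus f"
    unfolding torus_def set_integrable_def by (subst integrable_restrict_space) auto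
  show "(\<integral>y. f y \<partial>torus) = integral (cbox 0 1) f"
    using set_borel_integral_eq_integral(2)[OF i]
    unfolding torus_def set_lebesgue_integral_def by (subst integral_restrict_space) auto
qed

text \<open>Cutting the unit cube at height \<open>t\<close> and moving the lower slab up by one period gives the shifted cube.\<close>

lemma integral_torus_shift:
  fixes f :: "real ^ 'n \<Rightarrow> complex"
  assumes f: "continuous_on UNIV f" "periodic f" and t: "0 \<le> t" "t \<le> 1"
  shows "(\<integral>y. f (y + t *\<^sub>R axis i 1) \<partial>torus) = (\<integral>y. f y \<partial>torus)"
proof -
  define b :: "real ^ 'n" where "b = axis i 1"
  have bB: "b \<in> Basis" by (simp add: b_def)
  have io: "f integrable_on cbox u v" for u v
    by (intro integrable_continuous continuous_on_subset[OF f(1)]) auto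
  define slab where "slab u v = cbox (\<chi> j. if j = i then u else 0) (\<chi> j. if j = i then v else (1 :: real))" for u v
  have mem: "x \<in> slab u v \<longleftrightarrow> u \<le> x \<bullet> b \<and> x \<bullet> b \<le> v \<and> (\<forall>j. j \<noteq> i \<longrightarrow> 0 \<le> x $ j \<and> x $ j \<le> 1)" for x u v
    unfolding slab_def mem_box_cart b_def by (auto simp: inner_axis)
  have split: "integral (slab u w) f = integral (slab u v) f + integral (slab v w) f" if "u \<le> v" "v \<le> w" for u v w
  proof -
    have "slab u w \<inter> {x. x \<bullet> b \<le> v} = slab u v" "slab u w \<inter> {x. x \<bullet> b \<ge> v} = slab v w"
      using that by (auto simp: mem)
    then show ?thesis using integral_split[OF io bB, where c = v] unfolding slab_def by metis
  qed
  have shift: "integral (slab u v) (\<lambda>y. f (y + d *\<^sub>R b)) = integral (slab (u + d) (v + d)) f" for u v d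
  proof -
    have "(\<chi> j. if j = i then u + d else 0) - d *\<^sub>R b = (\<chi> j. if j = i then u else 0)"
      "(\<chi> j. if j = i then v + d else 1) - d *\<^sub>R b = (\<chi> j. if j = i then v else 1)"
      by (simp_all add: vec_eq_iff b_def axis_def)
    then show ?thesis
      using integral_shift_cbox[of "\<chi> j. if j = i then u + d else 0" "d *\<^sub>R b" "\<chi> j. if j = i then v + d else 1" f]
      unfolding slab_def by simp
  qed
  have cube: "cbox 0 1 = slab 0 1"
    unfolding slab_def by (rule arg_cong2[where f = cbox]) (simp_all add: vec_eq_iff)
  have "(\<integral>y. f (y + t *\<^sub>R b) \<partial>torus) = integral (slab 0 1) (\<lambda>y. f (y + t *\<^sub>R b))"
    unfolding cube[symmetric]
    by (intro integrable_torus_continuous continuous_on_compose2[OF f(1)] continuous_intros) auto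
  also have "\<dots> = integral (slab t (1 + t)) f" using shift[of 0 1 t] by simp
  also have "\<dots> = integral (slab t 1) f + integral (slab (0 + 1) (t + 1)) f"
    using split[of t 1 "1 + t"] t by (simp add: add.commute)
  also have "integral (slab (0 + 1) (t + 1)) f = integral (slab 0 t) (\<lambda>y. f (y + 1 *\<^sub>R b))"
    by (rule shift[symmetric])
  also have "(\<lambda>y. f (y + 1 *\<^sub>R b)) = f"
    using f(2)[unfolded periodic_def, rule_format, of _ "axis i 1"] by (simp add: b_def ivec_axis)
  also have "integral (slab t 1) f + integral (slab 0 t) f = integral (slab 0 1) f"
    using split[of 0 t 1] t by simp
  also have "\<dots> = integral (cbox 0 1) f" by (simp only: cube)
  also have "\<dots> = (\<integral>y. f y \<partial>torus)" by (rule integrable_torus_continuous(2)[OF f(1), symmetric])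
  finally show ?thesis by (simp add: b_def)
qed

lemma integral_character: "(\<integral>y. character q y \<partial>torus) = (if q = 0 then 1 else 0)"
proof (cases "q = 0")
  case False
  then obtain i where i: "q $ i \<noteq> 0" by (auto simp: vec_eq_iff)
  \<comment> \<open>A shift by half a wavelength in a coordinate where \<open>q\<close> is nonzero
    changes the sign of the character, so translation invariance makes the integral its own
    negative.\<close>
  define t :: real where "t = 1 / (2 * \<bar>of_int (q $ i)\<bar>)"
  have t: "0 \<le> t" "t \<le> 1" using i by (auto simp: t_def divide_simps)
  have "(\<integral>y. character q y \<partial>torus) = (\<integral>y. character q (y + t *\<^sub>R axis i 1) \<partial>torus)"
    by (rule integral_torus_shift[symmetric]) (intro continuous_intros periodic_character t)+
  also have "\<dots> = (\<integral>y. character q y \<partial>torus) * character q (t *\<^sub>R axis i 1)"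
    by (simp add: character_translate)
  also have "character q (t *\<^sub>R axis i 1) = -1"
  proof -
    have "ivec q \<bullet> (t *\<^sub>R axis i 1) = (if q $ i > 0 then 1/2 else - 1/2)"
      using i by (auto simp: inner_axis ivec_def t_def)
    then show ?thesis by (auto simp: character_def cis.ctr complex_eq_iff)
  qed
  finally show ?thesis using False by simp
qed (simp add: torus.prob_space)

interpretation characters: unimodular_system torus character
proof (unfold_locales)
  show "character i \<in> borel_measurable torus" for i :: "int ^ 'a"
    by (intro borel_measurable_torus borel_measurable_continuous_onI continuous_intros)
  show "(\<integral>x. character i x * cnj (character j x) \<partial>torus) = (if i = j then 1 else 0)" for i j :: "int ^ 'a"
    by (simp add: cnj_character character_add[symmetric] integral_character)
qed simp

section \<open>Density of trigonometric polynomials and uniqueness of Fourier coefficients\<close>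

inductive trig_polynomial :: "(real ^ 'n \<Rightarrow> complex) \<Rightarrow> bool" where
  monomial: "trig_polynomial (\<lambda>y. c * character q y)"
| add: "trig_polynomial f \<Longrightarrow> trig_polynomial g \<Longrightarrow> trig_polynomial (\<lambda>y. f y + g y)"

lemma trig_polynomial_mult:
  assumes "trig_polynomial f" "trig_polynomial g"
  shows "trig_polynomial (\<lambda>y. f y * g y)"
  using assms(1)
proof induction
  case (monomial c q)
  show ?case
    using assms(2)
  proof induction
    case (monomial d r)
    have "(\<lambda>y. (c * character q y) * (d * character r y)) = (\<lambda>y. (c * d) * character (q + r) y)"
      by (simp add: character_add fun_eq_iff)
    then show ?case using trig_polynomial.monomial by simp
  next
    case (add f g)
    then show ?case using trig_polynomial.add by (simp add: distrib_left)
  qed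
next
  case (add f g)
  then show ?case using trig_polynomial.add by (simp add: distrib_right)
qed

lemma trig_polynomial_const: "trig_polynomial (\<lambda>y. c)"
  using trig_polynomial.monomial[of c 0] by simp

lemma trig_polynomial_sum:
  "(\<And>i. i \<in> I \<Longrightarrow> trig_polynomial (f i)) \<Longrightarrow> trig_polynomial (\<lambda>y. \<Sum>i\<in>I. f i y)"
  by (induction I rule: infinite_finite_induct) (auto intro: trig_polynomial.add trig_polynomial_const)

definition torus_embedding :: "real ^ 'n \<Rightarrow> complex ^ 'n" where
  "torus_embedding y = (\<chi> i. character (axis i 1) y)"

text \<open>Sine and cosine of 2 pi times a coordinate determine it up to an integer. This is what
  makes a periodic function well defined on the image of the torus.\<close>

lemma torus_embedding_eq_imp:
  assumes "torus_embedding y = torus_embedding z"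
  obtains l where "y = z + ivec l"
proof -
  have "\<exists>n::int. y $ i = z $ i + of_int n" for i
  proof -
    have "character (axis i 1) y = character (axis i 1) z"
      using assms by (simp add: torus_embedding_def vec_eq_iff)
    then have "sin (2 * pi * y $ i) = sin (2 * pi * z $ i) \<and> cos (2 * pi * y $ i) = cos (2 * pi * z $ i)"
      by (simp add: character_def ivec_axis inner_axis' complex_eq_iff)
    then obtain n :: int where "2 * pi * y $ i = 2 * pi * z $ i + 2 * pi * of_int n"
      unfolding sin_cos_eq_iff by blast
    then have "2 * pi * (y $ i) = 2 * pi * (z $ i + of_int n)" by (simp add: distrib_left)
    then show ?thesis by (intro exI[of _ n]) simp
  qed
  then obtain n :: "'a \<Rightarrow> int" where "\<And>i. y $ i = z $ i + of_int (n i)" by metis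
  then have "y = z + ivec (\<chi> i. n i)" by (simp add: vec_eq_iff ivec_def)
  then show ?thesis by (rule that)
qed

text \<open>The real coordinates of the embedding are real and imaginary parts of characters, hence
  combinations of a character and its conjugate, and the class is closed under sums and
  products.\<close>

lemma trig_polynomial_real_polynomial_function:
  assumes "real_polynomial_function g"
  shows "trig_polynomial (\<lambda>y :: real ^ 'n. complex_of_real (g (torus_embedding y)))"
  using assms
proof induction
  case (linear g)
  have b: "trig_polynomial (\<lambda>y :: real ^ 'n. complex_of_real (torus_embedding y \<bullet> b))" if "b \<in> Basis" for b :: "complex ^ 'n"
  proof -
    have re: "trig_polynomial (\<lambda>y :: real ^ 'n. complex_of_real (Re (character q y)))" for q
    proof -
      have "(\<lambda>y :: real ^ 'n. complex_of_real (Re (character q y))) = (\<lambda>y. 1/2 * character q y + 1/2 * character (- q) y)"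
        by (simp add: cnj_character[symmetric] complex_eq_iff fun_eq_iff)
      then show ?thesis by (simp only: trig_polynomial.intros)
    qed
    have im: "trig_polynomial (\<lambda>y :: real ^ 'n. complex_of_real (Im (character q y)))" for q
    proof -
      have "(\<lambda>y :: real ^ 'n. complex_of_real (Im (character q y))) = (\<lambda>y. (- \<i>/2) * character q y + (\<i>/2) * character (- q) y)"
        by (simp add: cnj_character[symmetric] complex_eq_iff fun_eq_iff)
      then show ?thesis by (simp only: trig_polynomial.intros)
    qed
    from that show ?thesis
      by (auto simp: Basis_vec_def Basis_complex_def torus_embedding_def inner_axis re im)
  qed
  have "g v = (\<Sum>b\<in>Basis. (v \<bullet> b) * g b)" for v
  proof -
    have "g v = g (\<Sum>b\<in>Basis. (v \<bullet> b) *\<^sub>R b)" by (simp add: euclidean_representation)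
    also have "\<dots> = (\<Sum>b\<in>Basis. (v \<bullet> b) * g b)"
      using linear by (simp add: linear_sum bounded_linear.linear linear_cmul)
    finally show ?thesis .
  qed
  then have "(\<lambda>y :: real ^ 'n. complex_of_real (g (torus_embedding y)))
      = (\<lambda>y. \<Sum>b\<in>Basis. complex_of_real (torus_embedding y \<bullet> b) * complex_of_real (g b))"
    by (metis (no_types, lifting) of_real_mult of_real_sum sum.cong)
  then show ?case by (simp add: trig_polynomial_sum trig_polynomial_mult trig_polynomial_const b)
qed (auto intro: trig_polynomial.add trig_polynomial_mult trig_polynomial_const)

text \<open>
  A periodic function factors continuously through the embedding of the torus in \<open>complex ^ 'n\<close>, where
  the Stone-Weierstrass theorem for polynomials applies.
\<close>

lemma trig_polynomial_dense:
  fixes u :: "real ^ 'n \<Rightarrow> real"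
  assumes u: "continuous_on UNIV u" "periodic u" and e: "e > 0"
  obtains g where "trig_polynomial (\<lambda>y. complex_of_real (g y))" "\<And>y. y \<in> cbox 0 1 \<Longrightarrow> \<bar>u y - g y\<bar> < e"
proof -
  define C :: "(real ^ 'n) set" where "C = cbox 0 1"
  have C: "compact C" by (simp add: C_def)
  define S where "S = torus_embedding ` C"
  have ct: "continuous_on A torus_embedding" for A :: "(real ^ 'n) set"
    unfolding torus_embedding_def by (intro continuous_intros)
  have S: "compact S" unfolding S_def by (intro compact_continuous_image ct C)
  \<comment> \<open>The preimage is chosen arbitrarily: two choices differ by a lattice vector,
    which \<open>u\<close> does not see.\<close>
  define F where "F z = u (SOME y. y \<in> C \<and> torus_embedding y = z)" for z
  have F: "F (torus_embedding y) = u y" if "y \<in> C" for y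
  proof -
    let ?x = "SOME x. x \<in> C \<and> torus_embedding x = torus_embedding y"
    have "?x \<in> C \<and> torus_embedding ?x = torus_embedding y"
      by (rule someI[of _ y]) (use that in simp)
    then have "torus_embedding ?x = torus_embedding y" by simp
    then obtain l where "?x = y + ivec l" by (rule torus_embedding_eq_imp)
    then show ?thesis using u(2) by (simp add: F_def periodic_def)
  qed
  \<comment> \<open>Preimages of closed sets under \<open>F\<close> are images of compact sets under
    the embedding, hence closed.\<close>
  have "continuous_on S F"
    unfolding continuous_on_closed_vimage[OF compact_imp_closed[OF S]]
  proof (intro allI impI)
    fix B :: "real set" assume B: "closed B"
    have "F -` B \<inter> S = torus_embedding ` (C \<inter> u -` B)"
      using F by (auto simp: S_def)
    moreover have "closed (u -` B)" using B u(1) by (simp add: continuous_on_closed_vimage)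
    ultimately show "closed (F -` B \<inter> S)"
      by (metis compact_imp_closed compact_continuous_image compact_Int_closed C ct)
  qed
  from Stone_Weierstrass_real_polynomial_function[OF S this e]
  obtain g where g: "real_polynomial_function g" "\<And>x. x \<in> S \<Longrightarrow> \<bar>F x - g x\<bar> < e" by blast
  show thesis
  proof (rule that[of "\<lambda>y. g (torus_embedding y)"])
    show "trig_polynomial (\<lambda>y :: real ^ 'n. complex_of_real (g (torus_embedding y)))"
      by (rule trig_polynomial_real_polynomial_function[OF g(1)])
    show "\<bar>u y - g (torus_embedding y)\<bar> < e" if "y \<in> cbox 0 1" for y
      using g(2)[of "torus_embedding y"] that F[of y] by (simp add: S_def C_def)
  qed
qed

lemma integral_trig_polynomial_mult_eq_0:
  fixes f :: "real ^ 'n \<Rightarrow> complex"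
  assumes f: "integrable torus f" and zero: "\<And>q. (\<integral>y. f y * character q y \<partial>torus) = 0"
    and g: "trig_polynomial g"
  shows "integrable torus (\<lambda>y. f y * g y) \<and> (\<integral>y. f y * g y \<partial>torus) = 0"
  using g
proof induction
  case (monomial c q)
  have "(\<lambda>y. f y * (c * character q y)) = (\<lambda>y. c * (f y * character q y))" by (simp add: fun_eq_iff)
  then show ?case using characters.integrable_mult_\<psi>(1)[OF f] zero by simp
next
  case (add g h)
  then show ?case by (simp add: distrib_left)
qed

text \<open>Since \<open>u\<close> is orthogonal to every trigonometric polynomial g, the integral
  of u^2 equals that of u (u - g), which is at most e times the mean of the modulus of
  \<open>u\<close> when g is within e of it. A continuous nonnegative function with integral 0
  vanishes on the cube, and periodicity carries this to every point.\<close>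

lemma real_fourier_uniqueness:
  fixes u :: "real ^ 'n \<Rightarrow> real"
  assumes u: "continuous_on UNIV u" "periodic u"
    and zero: "\<And>q. (\<integral>y. u y * character q y \<partial>torus) = 0"
  shows "u y = 0"
proof -
  have int: "integrable torus u" "integrable torus (\<lambda>y. \<bar>u y\<bar>)" "integrable torus (\<lambda>y. (u y)\<^sup>2)"
    by (intro integrable_torus_continuous(1) continuous_intros u)+
  have sq: "(\<integral>y. (u y)\<^sup>2 \<partial>torus) \<le> e * (\<integral>y. \<bar>u y\<bar> \<partial>torus)" if e: "e > 0" for e
  proof -
    obtain g where g: "trig_polynomial (\<lambda>y. complex_of_real (g y))" "\<And>y. y \<in> cbox 0 1 \<Longrightarrow> \<bar>u y - g y\<bar> < e"
      using trig_polynomial_dense[OF u e] by blast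
    have "integrable torus (\<lambda>y. complex_of_real (u y) * complex_of_real (g y)) \<and>
        (\<integral>y. complex_of_real (u y) * complex_of_real (g y) \<partial>torus) = 0"
      by (rule integral_trig_polynomial_mult_eq_0[OF _ zero g(1)]) (simp add: int)
    then have "integrable torus (\<lambda>y. complex_of_real (u y * g y))" "(\<integral>y. complex_of_real (u y * g y) \<partial>torus) = 0" by simp_all
    then have ug: "integrable torus (\<lambda>y. u y * g y)" "(\<integral>y. u y * g y \<partial>torus) = 0"
      by (simp_all only: complex_of_real_integrable_eq integral_complex_of_real of_real_eq_0_iff)
    have "(\<integral>y. (u y)\<^sup>2 \<partial>torus) = (\<integral>y. (u y)\<^sup>2 - u y * g y \<partial>torus)"
      by (subst Bochner_Integration.integral_diff[OF int(3) ug(1)]) (simp add: ug)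
    also have "\<dots> \<le> (\<integral>y. e * \<bar>u y\<bar> \<partial>torus)"
    proof (rule integral_mono)
      fix y assume "y \<in> space (torus :: (real ^ 'n) measure)"
      then have "\<bar>u y - g y\<bar> \<le> e" using g(2)[of y] by (simp add: space_torus less_imp_le)
      then have "\<bar>u y - g y\<bar> * \<bar>u y\<bar> \<le> e * \<bar>u y\<bar>" by (rule mult_right_mono) simp
      moreover have "(u y)\<^sup>2 - u y * g y \<le> \<bar>u y - g y\<bar> * \<bar>u y\<bar>"
        unfolding abs_mult[symmetric] by (rule order_trans[OF _ abs_ge_self]) (simp add: power2_eq_square algebra_simps)
      ultimately show "(u y)\<^sup>2 - u y * g y \<le> e * \<bar>u y\<bar>" by linarith
    qed (use int ug in auto)
    finally show ?thesis by simp
  qed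
  have "(\<integral>y. (u y)\<^sup>2 \<partial>torus) \<le> 0"
  proof (rule field_le_epsilon)
    fix e :: real assume e: "e > 0"
    define A where "A = (\<integral>y. \<bar>u y\<bar> \<partial>torus)"
    have A: "A \<ge> 0" unfolding A_def by (rule Bochner_Integration.integral_nonneg) simp
    \<comment> \<open>The added 1 keeps the denominator positive when \<open>A\<close> is 0.\<close>
    have "e / (A + 1) > 0" using e A by simp
    then have "(\<integral>y. (u y)\<^sup>2 \<partial>torus) \<le> e / (A + 1) * A" unfolding A_def by (rule sq)
    also have "\<dots> \<le> e" using e A by (simp add: divide_simps)
    finally show "(\<integral>y. (u y)\<^sup>2 \<partial>torus) \<le> 0 + e" by simp
  qed
  moreover have "(\<integral>y. (u y)\<^sup>2 \<partial>torus) = integral (cbox 0 1) (\<lambda>y. (u y)\<^sup>2)"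
    by (intro integrable_torus_continuous continuous_intros u)
  moreover have "(\<integral>y. (u y)\<^sup>2 \<partial>torus) \<ge> 0" by (rule Bochner_Integration.integral_nonneg) simp
  ultimately have I: "integral (cbox 0 1) (\<lambda>y. (u y)\<^sup>2) = 0" by simp
  have c: "continuous_on (cbox 0 1) (\<lambda>y. (u y)\<^sup>2)"
    by (intro continuous_intros continuous_on_subset[OF u(1)]) simp
  then have "((\<lambda>y. (u y)\<^sup>2) has_integral 0) (cbox 0 1)"
    using I integrable_integral[OF integrable_continuous[OF c]] by simp
  then have cube: "u y = 0" if "y \<in> cbox 0 1" for y
    using has_integral_0_cbox_imp_0[OF c _ _ _ that] box_ne_empty(2)[of "0 :: real ^ 'n" 1]
    by (auto simp: Basis_vec_def inner_axis)
  define l where "l = (\<chi> i. \<lfloor>y $ i\<rfloor>)"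
  have "y - ivec l \<in> cbox 0 1"
    by (simp add: mem_box_cart l_def ivec_def algebra_simps) (metis add.commute real_of_int_floor_add_one_ge)
  then have "u (y - ivec l) = 0" by (rule cube)
  then show ?thesis using u(2)[unfolded periodic_def, rule_format, of "y - ivec l" l] by simp
qed

text \<open>The conjugate of \<open>f\<close> has vanishing coefficients as well, namely those of
  \<open>f\<close> conjugated and reflected, so the real case applies to the real and the imaginary
  part.\<close>

lemma fourier_uniqueness:
  fixes f :: "real ^ 'n \<Rightarrow> complex"
  assumes f: "continuous_on UNIV f" "periodic f"
    and zero: "\<And>q. (\<integral>y. f y * character q y \<partial>torus) = 0"
  shows "f y = 0"
proof -
  have int: "integrable torus f" by (rule integrable_torus_continuous(1)[OF f(1)])
  have zero': "(\<integral>y. cnj (f y) * character q y \<partial>torus) = 0" for q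
  proof -
    have "(\<integral>y. cnj (f y) * character q y \<partial>torus) = (\<integral>y. cnj (f y * character (- q) y) \<partial>torus)"
      by (simp add: cnj_character)
    also have "\<dots> = 0" by (simp only: Bochner_Integration.integral_cnj zero complex_cnj_zero)
    finally show ?thesis .
  qed
  have i: "integrable torus (\<lambda>y. f y * character q y)" "integrable torus (\<lambda>y. cnj (f y) * character q y)" for q
    using int by (auto intro!: characters.integrable_mult_\<psi>(1))
  have "Re (f y) = 0"
  proof (rule real_fourier_uniqueness)
    fix q
    have "(\<integral>y. complex_of_real (Re (f y)) * character q y \<partial>torus)
        = (\<integral>y. 1/2 * (f y * character q y) + 1/2 * (cnj (f y) * character q y) \<partial>torus)"
      by (rule Bochner_Integration.integral_cong) (auto simp: complex_eq_iff field_simps)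
    also have "\<dots> = 0" using zero zero' i by simp
    finally show "(\<integral>y. complex_of_real (Re (f y)) * character q y \<partial>torus) = 0" .
  qed (use f in \<open>auto intro!: continuous_intros simp: periodic_def\<close>)
  moreover have "Im (f y) = 0"
  proof (rule real_fourier_uniqueness)
    fix q
    have "(\<integral>y. complex_of_real (Im (f y)) * character q y \<partial>torus)
        = (\<integral>y. (-\<i>/2) * (f y * character q y) + (\<i>/2) * (cnj (f y) * character q y) \<partial>torus)"
      by (rule Bochner_Integration.integral_cong) (auto simp: complex_eq_iff field_simps)
    also have "\<dots> = 0" using zero zero' i by simp
    finally show "(\<integral>y. complex_of_real (Im (f y)) * character q y \<partial>torus) = 0" .
  qed (use f in \<open>auto intro!: continuous_intros simp: periodic_def\<close>)
  ultimately show ?thesis by (simp add: complex_eq_iff)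
qed

section \<open>Fourier series and inversion\<close>

definition fourier_series :: "(int ^ 'n \<Rightarrow> complex) \<Rightarrow> real ^ 'n \<Rightarrow> complex" where
  "fourier_series a y = (\<Sum>\<^sub>\<infinity>q. a q * character q y)"

lemma periodic_fourier_series: "periodic (fourier_series a)"
  by (simp add: periodic_def fourier_series_def character_translate)

lemma continuous_fourier_series:
  assumes "(\<lambda>q. cmod (a q)) summable_on UNIV"
  shows "continuous_on UNIV (fourier_series a)"
proof (rule uniform_limit_theorem)
  show "uniform_limit UNIV (\<lambda>F y. \<Sum>q\<in>F. a q * character q y) (fourier_series a) (finite_subsets_at_top UNIV)"
    unfolding fourier_series_def[abs_def]
    by (rule Weierstrass_m_test_general[OF _ assms]) (simp add: norm_mult)
  show "\<forall>\<^sub>F F in finite_subsets_at_top UNIV. continuous_on UNIV (\<lambda>y. \<Sum>q\<in>F. a q * character q y)"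
    by (intro always_eventually allI continuous_intros)
qed simp

definition fourier_coeff :: "(real ^ 'n \<Rightarrow> complex) \<Rightarrow> int ^ 'n \<Rightarrow> complex" where
  "fourier_coeff f q = (\<integral>y. f y * cnj (character q y) \<partial>torus)"

text \<open>With summable coefficients the series is continuous and periodic, and by orthonormality
  it has the coefficients of \<open>f\<close>; uniqueness then applies to the difference.\<close>

lemma fourier_inversion:
  fixes f :: "real ^ 'n \<Rightarrow> complex"
  assumes f: "continuous_on UNIV f" "periodic f"
    and s: "(\<lambda>q. cmod (fourier_coeff f q)) summable_on UNIV"
  shows "f = fourier_series (fourier_coeff f)"
proof
  fix y
  let ?g = "fourier_series (fourier_coeff f)"
  have g: "continuous_on UNIV ?g" by (rule continuous_fourier_series[OF s])
  have i: "integrable torus f" "integrable torus ?g" by (intro integrable_torus_continuous(1) f g)+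
  have "(\<integral>y. ?g y * cnj (character q y) \<partial>torus) = fourier_coeff f q" for q
    unfolding fourier_series_def by (rule characters.integral_series_coeff[OF s])
  then have "(\<integral>y. (f y - ?g y) * cnj (character q y) \<partial>torus) = 0" for q
    using characters.integrable_mult_\<psi>(2)[OF i(1), of q] characters.integrable_mult_\<psi>(2)[OF i(2), of q]
    by (simp add: left_diff_distrib fourier_coeff_def)
  then have "(\<integral>y. (f y - ?g y) * character q y \<partial>torus) = 0" for q
    by (metis (no_types, lifting) Bochner_Integration.integral_cong cnj_character minus_minus)
  moreover have "periodic (\<lambda>y. f y - ?g y)"
    using f(2) periodic_fourier_series[of "fourier_coeff f"] by (simp add: periodic_def)
  ultimately have "f y - ?g y = 0"
    by (intro fourier_uniqueness[where f = "\<lambda>y. f y - ?g y"] continuous_intros f g)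
  then show "f y = ?g y" by simp
qed

section \<open>Fourier coefficients of a partial derivative\<close>

lemma has_vector_derivative_imp_LIMSEQ:
  fixes g :: "real \<Rightarrow> complex"
  assumes "(g has_vector_derivative g') (at 0)"
  shows "(\<lambda>m. (g (inverse (real (Suc m))) - g 0) * of_nat (Suc m)) \<longlonglongrightarrow> g'"
proof -
  have "(\<lambda>h. norm (g (0 + h) - g 0 - h *\<^sub>R g') / norm h) \<midarrow>0\<rightarrow> 0"
    using assms unfolding has_vector_derivative_def has_derivative_at by blast
  moreover have "filterlim (\<lambda>m. inverse (real (Suc m))) (at 0) sequentially"
    by (rule filterlim_atI[OF LIMSEQ_inverse_real_of_nat]) simp
  ultimately have "(\<lambda>m. norm (g (0 + inverse (real (Suc m))) - g 0 - inverse (real (Suc m)) *\<^sub>R g') / norm (inverse (real (Suc m)))) \<longlonglongrightarrow> 0"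
    by (rule filterlim_compose)
  also have "(\<lambda>m. norm (g (0 + inverse (real (Suc m))) - g 0 - inverse (real (Suc m)) *\<^sub>R g') / norm (inverse (real (Suc m))))
      = (\<lambda>m. norm ((g (inverse (real (Suc m))) - g 0) * of_nat (Suc m) - g'))"
  proof
    fix m
    define N where "N = real (Suc m)"
    have N: "N > 0" by (simp add: N_def)
    have "(g (inverse N) - g 0) * of_real N - g' = of_real N * (g (inverse N) - g 0 - inverse N *\<^sub>R g')"
      using N by (simp add: algebra_simps scaleR_conv_of_real)
    then have "norm ((g (inverse N) - g 0) * of_real N - g') = N * norm (g (inverse N) - g 0 - inverse N *\<^sub>R g')"
      using N by (simp add: norm_mult)
    then show "norm (g (0 + inverse (real (Suc m))) - g 0 - inverse (real (Suc m)) *\<^sub>R g') / norm (inverse (real (Suc m)))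
        = norm ((g (inverse (real (Suc m))) - g 0) * of_nat (Suc m) - g')"
      using N unfolding N_def[symmetric] by (simp add: divide_inverse mult.commute N_def)
  qed
  finally have "(\<lambda>m. (g (inverse (real (Suc m))) - g 0) * of_nat (Suc m) - g') \<longlonglongrightarrow> 0" by (rule tendsto_norm_zero_cancel)
  then show ?thesis by (simp add: LIM_zero_iff)
qed

text \<open>Integration by parts is carried out on difference quotients with steps
  \<open>h m\<close>. Translation invariance turns the shift of \<open>f\<close> into a factor
  \<open>character q (h m *\<^sub>R b)\<close>, and the resulting quotient tends to the stated
  multiplier. The derivative is assumed bounded, not continuous: the mean value inequality makes
  \<open>B\<close> a dominating constant, and the derivative is measurable as a pointwise
  limit.\<close>

lemma fourier_coeff_partial_derivative:
  fixes f :: "real ^ 'n \<Rightarrow> complex"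
  assumes f: "\<And>y. f differentiable (at y)" "periodic f"
    and B: "\<And>y. cmod (frechet_derivative f (at y) (axis i 1)) \<le> B"
  shows "fourier_coeff (\<lambda>y. frechet_derivative f (at y) (axis i 1)) q = 2 * pi * \<i> * of_int (q $ i) * fourier_coeff f q"
proof -
  define b :: "real ^ 'n" where "b = axis i 1"
  define f' where "f' y = frechet_derivative f (at y) b" for y
  define a where "a = fourier_coeff f q"
  have D: "(f has_derivative frechet_derivative f (at y)) (at y)" for y
    using f(1) by (simp add: frechet_derivative_works)
  have line: "((\<lambda>t. f (y + t *\<^sub>R b)) has_derivative (\<lambda>x. x *\<^sub>R f' (y + t *\<^sub>R b))) (at t within S)" for y t S
  proof -
    have "((\<lambda>t. f (y + t *\<^sub>R b)) has_derivative (\<lambda>x. frechet_derivative f (at (y + t *\<^sub>R b)) (x *\<^sub>R b))) (at t within S)"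
      by (rule has_derivative_compose[OF _ D]) (auto intro!: derivative_eq_intros)
    then show ?thesis
      unfolding f'_def
      by (simp add: linear_cmul[OF bounded_linear.linear[OF has_derivative_bounded_linear[OF D]]])
  qed
  define h where "h m = inverse (real (Suc m))" for m
  have h: "0 \<le> h m" "h m \<le> 1" "h m * real (Suc m) = 1" for m by (auto simp: h_def divide_simps)
  define d where "d m y = (f (y + h m *\<^sub>R b) - f y) * of_nat (Suc m)" for m y
  have cont: "continuous_on UNIV f"
    by (intro continuous_at_imp_continuous_on ballI differentiable_imp_continuous_within f(1))
  have cont_shift: "continuous_on UNIV (\<lambda>y. f (y + h m *\<^sub>R b))" for m
    by (intro continuous_on_compose2[OF cont] continuous_intros) auto
  have lim: "(\<lambda>m. d m y) \<longlonglongrightarrow> f' y" for y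
    using has_vector_derivative_imp_LIMSEQ[of "\<lambda>t. f (y + t *\<^sub>R b)" "f' y"] line[of y 0 UNIV]
    by (simp add: has_vector_derivative_def d_def h_def)
  have bound: "cmod (d m y) \<le> B" for m y
  proof -
    have "cmod (f (y + h m *\<^sub>R b) - f (y + 0 *\<^sub>R b)) \<le> B * norm (h m - 0)"
    proof (rule differentiable_bound[OF convex_UNIV])
      show "onorm (\<lambda>x. x *\<^sub>R f' (y + t *\<^sub>R b)) \<le> B" for t
      proof (rule onorm_le)
        fix x :: real
        show "norm (x *\<^sub>R f' (y + t *\<^sub>R b)) \<le> B * norm x"
          using mult_left_mono[OF B[of "y + t *\<^sub>R b"], of "\<bar>x\<bar>"] by (simp add: f'_def b_def mult.commute)
      qed
    qed (use line in auto)
    then have "cmod (f (y + h m *\<^sub>R b) - f y) * real (Suc m) \<le> B * h m * real (Suc m)"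
      using h by (intro mult_right_mono) auto
    then show ?thesis using h(3)[of m] by (simp add: d_def norm_mult mult.assoc del: of_nat_Suc)
  qed
  have coeff_d: "fourier_coeff (d m) q = (character q (h m *\<^sub>R b) - 1) * of_nat (Suc m) * a" for m
  proof -
    let ?g = "\<lambda>y. f y * cnj (character q y)"
    have per: "periodic ?g" using f(2) periodic_character[of q] by (simp add: periodic_def)
    have "(\<integral>y. f (y + h m *\<^sub>R b) * cnj (character q y) \<partial>torus) = (\<integral>y. character q (h m *\<^sub>R b) * ?g (y + h m *\<^sub>R b) \<partial>torus)"
      by (rule Bochner_Integration.integral_cong)
         (auto simp: character_translate complex_norm_square[symmetric] mult_ac(3) mult.assoc)
    also have "\<dots> = character q (h m *\<^sub>R b) * (\<integral>y. ?g (y + h m *\<^sub>R b) \<partial>torus)"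
      by simp
    also have "(\<integral>y. ?g (y + h m *\<^sub>R b) \<partial>torus) = a"
      unfolding b_def a_def fourier_coeff_def
      by (intro integral_torus_shift per h continuous_intros cont)
    finally have shift: "(\<integral>y. f (y + h m *\<^sub>R b) * cnj (character q y) \<partial>torus) = character q (h m *\<^sub>R b) * a" .
    have "fourier_coeff (d m) q = (\<integral>y. of_nat (Suc m) * (f (y + h m *\<^sub>R b) * cnj (character q y) - ?g y) \<partial>torus)"
      unfolding fourier_coeff_def d_def by (rule Bochner_Integration.integral_cong) (auto simp: algebra_simps)
    also have "\<dots> = of_nat (Suc m) * ((\<integral>y. f (y + h m *\<^sub>R b) * cnj (character q y) \<partial>torus) - a)"
      unfolding a_def fourier_coeff_def
      by (subst integral_mult_right_zero, subst Bochner_Integration.integral_diff)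
         (auto intro!: integrable_torus_continuous(1) continuous_intros cont cont_shift)
    finally show ?thesis unfolding shift by (simp add: algebra_simps)
  qed
  have "(\<lambda>m. fourier_coeff (d m) q) \<longlonglongrightarrow> fourier_coeff f' q"
    unfolding fourier_coeff_def
  proof (rule integral_dominated_convergence[where w = "\<lambda>_. B"])
    have d: "d m \<in> borel_measurable borel" for m
      unfolding d_def by (intro borel_measurable_continuous_onI continuous_intros cont cont_shift)
    have e: "(\<lambda>y. cnj (character q y)) \<in> borel_measurable borel"
      by (intro borel_measurable_continuous_onI continuous_intros)
    show "(\<lambda>y. d m y * cnj (character q y)) \<in> borel_measurable torus" for m
      by (intro borel_measurable_torus borel_measurable_times d e)
    have "f' \<in> borel_measurable borel" by (rule borel_measurable_LIMSEQ_metric[OF d lim])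
    then show "(\<lambda>y. f' y * cnj (character q y)) \<in> borel_measurable torus"
      by (intro borel_measurable_torus borel_measurable_times e)
    show "AE y in torus. (\<lambda>m. d m y * cnj (character q y)) \<longlonglongrightarrow> f' y * cnj (character q y)"
      by (intro AE_I2 tendsto_intros lim)
  qed (use bound in \<open>auto simp: norm_mult\<close>)
  moreover have "(\<lambda>m. fourier_coeff (d m) q) \<longlonglongrightarrow> 2 * pi * \<i> * of_int (q $ i) * a"
  proof -
    define \<theta> where "\<theta> = 2 * pi * real_of_int (q $ i)"
    have "((\<lambda>z. exp (\<i> * \<theta> * z)) has_field_derivative \<i> * \<theta>) (at (of_real 0))"
      by (auto intro!: derivative_eq_intros)
    then have "((\<lambda>t. exp (\<i> * \<theta> * of_real t)) has_vector_derivative \<i> * \<theta>) (at 0)"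
      by (rule has_vector_derivative_real_field)
    then have "(\<lambda>m. (exp (\<i> * \<theta> * of_real (h m)) - 1) * of_nat (Suc m)) \<longlonglongrightarrow> \<i> * \<theta>"
      using has_vector_derivative_imp_LIMSEQ by (force simp: h_def)
    then have "(\<lambda>m. (exp (\<i> * \<theta> * of_real (h m)) - 1) * of_nat (Suc m) * a) \<longlonglongrightarrow> \<i> * \<theta> * a"
      by (rule tendsto_mult_right)
    moreover have "exp (\<i> * \<theta> * of_real (h m)) = character q (h m *\<^sub>R b)" for m
      by (simp add: character_def cis_conv_exp b_def inner_axis ivec_def \<theta>_def mult_ac)
    ultimately show ?thesis by (simp add: coeff_d \<theta>_def mult_ac)
  qed
  ultimately have "fourier_coeff f' q = 2 * pi * \<i> * of_int (q $ i) * a" by (rule LIMSEQ_unique)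
  then show ?thesis by (simp add: f'_def[abs_def] a_def b_def)
qed

section \<open>Schwartz functions and tempered distributions in terms of Fourier coefficients\<close>

definition weight :: "int ^ 'n \<Rightarrow> real" where
  "weight k = 1 + norm (ivec k)"

lemma weight_ge_1: "1 \<le> weight k" and weight_pos [simp]: "0 < weight k"
  by (simp_all add: weight_def add_pos_nonneg)

lemma abs_component_le_weight: "\<bar>of_int (k $ i)\<bar> \<le> weight k"
  using component_le_norm_cart[of "ivec k" i] by (simp add: weight_def ivec_def)

lemma schwartz_Z_weight: "g \<in> schwartz_Z \<longleftrightarrow> (\<forall>M::nat. \<exists>C. \<forall>k. cmod (g k) \<le> C / weight k ^ M)"
  by (simp add: schwartz_Z_def weight_def)

lemma summable_on_int_inverse_square: "(\<lambda>j::int. 1 / (1 + \<bar>real_of_int j\<bar>)\<^sup>2) summable_on UNIV"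
proof -
  let ?f = "\<lambda>j::int. 1 / (1 + \<bar>real_of_int j\<bar>)\<^sup>2"
  have "summable (\<lambda>n. inverse ((of_nat n :: real) ^ 2))" by (rule inverse_power_summable) simp
  then have s: "summable (\<lambda>n. inverse (real (Suc n) ^ 2))" by (subst summable_Suc_iff)
  have "(\<lambda>n. ?f (int n)) summable_on UNIV"
    using s by (intro norm_summable_imp_summable_on) (simp add: inverse_eq_divide add.commute)
  then have 1: "?f summable_on range int"
    by (subst summable_on_reindex) (auto simp: comp_def)
  have "summable (\<lambda>n. inverse (real (Suc (Suc n)) ^ 2))" using s by (subst summable_Suc_iff)
  then have "(\<lambda>n. ?f (- int (Suc n))) summable_on UNIV"
    by (intro norm_summable_imp_summable_on) (simp add: inverse_eq_divide add.commute)
  then have 2: "?f summable_on range (\<lambda>n. - int (Suc n))"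
    by (subst summable_on_reindex) (auto simp: comp_def inj_on_def)
  have "range int \<union> range (\<lambda>n. - int (Suc n)) = UNIV"
  proof (intro set_eqI iffI UNIV_I)
    fix j :: int
    show "j \<in> range int \<union> range (\<lambda>n. - int (Suc n))"
      by (cases j rule: int_cases) (auto simp: image_iff)
  qed
  moreover have "range int \<inter> range (\<lambda>n. - int (Suc n)) = {}" by auto
  ultimately show ?thesis using summable_on_Un_disjoint[OF 1 2] by simp
qed

text \<open>The weight is at least 1 plus the modulus of each of the n components, so its power 2n
  dominates the product of their squares, and sums of the reciprocal products factorize into
  one-dimensional sums.\<close>

lemma summable_on_weight: "(\<lambda>k :: int ^ 'n. 1 / weight k ^ (2 * CARD('n))) summable_on UNIV"
proof (rule nonneg_bdd_above_summable_on)
  let ?f = "\<lambda>j::int. 1 / (1 + \<bar>real_of_int j\<bar>)\<^sup>2"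
  define S where "S = (\<Sum>\<^sub>\<infinity>j. ?f j)"
  show "bdd_above (sum (\<lambda>k :: int ^ 'n. 1 / weight k ^ (2 * CARD('n))) ` {F. F \<subseteq> UNIV \<and> finite F})"
  proof (rule bdd_aboveI2)
    fix F :: "(int ^ 'n) set" assume "F \<in> {F. F \<subseteq> UNIV \<and> finite F}"
    then have F: "finite F" by simp
    \<comment> \<open>All components of points of \<open>F\<close> lie in \<open>J\<close>, so
      \<open>F\<close> sits in a finite box over which the sum of products is a product of
      sums.\<close>
    define J where "J = (\<Union>i. (\<lambda>k. k $ i) ` F)"
    have J: "finite J" using F by (simp add: J_def)
    have "1 / weight k ^ (2 * CARD('n)) \<le> (\<Prod>i\<in>UNIV. ?f (k $ i))" for k :: "int ^ 'n"
    proof -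
      have "(\<Prod>i\<in>UNIV. (1 + \<bar>real_of_int (k $ i)\<bar>)\<^sup>2) \<le> (\<Prod>i\<in>(UNIV :: 'n set). (weight k)\<^sup>2)"
        using component_le_norm_cart[of "ivec k"] by (intro prod_mono power_mono conjI) (auto simp: weight_def ivec_def)
      also have "\<dots> = weight k ^ (2 * CARD('n))" by (simp add: power_mult)
      finally have "1 / weight k ^ (2 * CARD('n)) \<le> 1 / (\<Prod>i\<in>UNIV. (1 + \<bar>real_of_int (k $ i)\<bar>)\<^sup>2)"
        by (intro divide_left_mono mult_pos_pos prod_pos) (auto simp: add_pos_nonneg)
      then show ?thesis by (simp add: prod_dividef)
    qed
    then have "(\<Sum>k\<in>F. 1 / weight k ^ (2 * CARD('n))) \<le> (\<Sum>k\<in>F. \<Prod>i\<in>UNIV. ?f (k $ i))"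
      by (intro sum_mono) auto
    also have "\<dots> = (\<Sum>g\<in>vec_nth ` F. \<Prod>i\<in>UNIV. ?f (g i))"
      by (subst sum.reindex) (auto simp: inj_on_def vec_nth_inject)
    also have "\<dots> \<le> (\<Sum>g\<in>Pi\<^sub>E (UNIV :: 'n set) (\<lambda>_. J). \<Prod>i\<in>UNIV. ?f (g i))"
    proof (rule sum_mono2)
      show "vec_nth ` F \<subseteq> Pi\<^sub>E (UNIV :: 'n set) (\<lambda>_. J)" by (auto simp: J_def)
    qed (auto intro!: prod_nonneg finite_PiE J)
    also have "\<dots> = (\<Prod>i\<in>(UNIV :: 'n set). \<Sum>j\<in>J. ?f j)"
      by (rule prod_sum_PiE[symmetric]) (auto simp: J)
    also have "\<dots> \<le> (\<Prod>i\<in>(UNIV :: 'n set). S)"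
      unfolding S_def using J
      by (intro prod_mono conjI sum_nonneg finite_sum_le_infsum summable_on_int_inverse_square) auto
    finally show "(\<Sum>k\<in>F. 1 / weight k ^ (2 * CARD('n))) \<le> S ^ CARD('n)" by simp
  qed
qed (simp add: less_imp_le)

lemma schwartz_Z_summable:
  fixes a :: "int ^ 'n \<Rightarrow> complex"
  assumes "a \<in> schwartz_Z"
  shows "(\<lambda>q. cmod (a q)) summable_on UNIV"
proof -
  obtain C where C: "\<And>q. cmod (a q) \<le> C / weight q ^ (2 * CARD('n))"
    using assms unfolding schwartz_Z_weight by blast
  have "(\<lambda>q :: int ^ 'n. C * (1 / weight q ^ (2 * CARD('n)))) summable_on UNIV"
    by (intro summable_on_cmult_right summable_on_weight)
  then show ?thesis by (rule summable_on_comparison_test) (use C in auto)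
qed

lemma schwartz_Z_mult_component:
  assumes "a \<in> schwartz_Z"
  shows "(\<lambda>q. c * of_int (q $ i) * a q) \<in> schwartz_Z"
  unfolding schwartz_Z_weight
proof
  fix M
  obtain C where C: "\<And>q. cmod (a q) \<le> C / weight q ^ Suc M"
    using assms unfolding schwartz_Z_weight by blast
  have "cmod (c * of_int (q $ i) * a q) \<le> (cmod c * C) / weight q ^ M" for q
  proof -
    have "cmod (c * of_int (q $ i) * a q) = cmod c * (\<bar>of_int (q $ i)\<bar> * cmod (a q))"
      by (simp add: norm_mult)
    also have "\<dots> \<le> cmod c * (weight q * (C / weight q ^ Suc M))"
      by (intro mult_left_mono mult_mono abs_component_le_weight C) (auto simp: less_imp_le)
    also have "\<dots> = (cmod c * C) / weight q ^ M" using less_imp_neq[OF weight_pos[of q]] by (simp add: field_simps)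
    finally show ?thesis .
  qed
  then show "\<exists>C. \<forall>q. cmod (c * of_int (q $ i) * a q) \<le> C / weight q ^ M" by blast
qed

lemma has_sum_finite_sum:
  fixes f :: "'i \<Rightarrow> 'a \<Rightarrow> complex"
  assumes "\<And>i. i \<in> I \<Longrightarrow> (f i has_sum s i) A"
  shows "((\<lambda>x. \<Sum>i\<in>I. f i x) has_sum (\<Sum>i\<in>I. s i)) A"
  using assms by (induction I rule: infinite_finite_induct) (auto intro: has_sum_add)

lemma has_sum_minus:
  fixes f g :: "'a \<Rightarrow> complex"
  assumes "(f has_sum s) A" "(g has_sum t) A"
  shows "((\<lambda>x. f x - g x) has_sum (s - t)) A"
  using has_sum_add[OF assms(1), of "\<lambda>x. - g x" "- t"] assms(2) by (simp add: has_sum_uminus)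

lemma cmod_cis_remainder: "cmod (cis t - 1 - \<i> * t) \<le> t\<^sup>2"
  using Taylor_exp[of "\<i> * complex_of_real t" 1] by (simp add: cis_conv_exp norm_mult diff_diff_eq power2_eq_square)

lemma fourier_series_has_sum:
  assumes "a \<in> schwartz_Z"
  shows "((\<lambda>q. a q * character q y) has_sum fourier_series a y) UNIV"
proof -
  have "(\<lambda>q. norm (a q * character q y)) summable_on UNIV"
    using schwartz_Z_summable[OF assms] by (simp add: norm_mult)
  then show ?thesis unfolding fourier_series_def by (rule has_sum_infsum[OF abs_summable_summable])
qed

text \<open>
  The remainder is bounded term by term by \<open>|a q| (2 \<pi> q \<bullet> h)\<^sup>2\<close>, so no theorem on termwise
  differentiation is needed.
\<close>

lemma has_derivative_fourier_series:
  fixes a :: "int ^ 'n \<Rightarrow> complex"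
  assumes a: "a \<in> schwartz_Z"
  shows "(fourier_series a has_derivative
    (\<lambda>h. \<Sum>i\<in>UNIV. h $ i *\<^sub>R fourier_series (\<lambda>q. 2 * pi * \<i> * of_int (q $ i) * a q) y)) (at y)"
proof -
  define L where "L h = (\<Sum>i\<in>UNIV. h $ i *\<^sub>R fourier_series (\<lambda>q. 2 * pi * \<i> * of_int (q $ i) * a q) y)" for h
  \<comment> \<open>Two powers of the weight pay for the square of the inner product of
    \<open>ivec q\<close> with the increment; the other 2n make the bound summable.\<close>
  obtain C where C: "\<And>q. cmod (a q) \<le> C / weight q ^ (2 + 2 * CARD('n))"
    using a unfolding schwartz_Z_weight by blast
  define b where "b q = (2 * pi)\<^sup>2 * C * (1 / weight q ^ (2 * CARD('n)))" for q :: "int ^ 'n"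
  have b: "b summable_on UNIV"
    unfolding b_def[abs_def] by (intro summable_on_cmult_right summable_on_weight)
  have rem: "cmod (fourier_series a z - fourier_series a y - L (z - y)) \<le> infsum b UNIV * (norm (z - y))\<^sup>2" for z
  proof -
    define h where "h = z - y"
    have z: "z = y + h" by (simp add: h_def)
    define R where "R q = a q * character q z - a q * character q y
        - (\<Sum>i\<in>UNIV. of_real (h $ i) * (2 * pi * \<i> * of_int (q $ i) * a q * character q y))" for q
    have "(R has_sum (fourier_series a z - fourier_series a y - L h)) UNIV"
      unfolding R_def[abs_def] L_def scaleR_conv_of_real
      by (intro has_sum_minus has_sum_finite_sum has_sum_cmult_right fourier_series_has_sum a schwartz_Z_mult_component)
    then have eq: "fourier_series a z - fourier_series a y - L h = infsum R UNIV" by (rule infsumI[symmetric])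
    have R: "cmod (R q) \<le> b q * (norm h)\<^sup>2" for q
    proof -
      define t where "t = 2 * pi * (ivec q \<bullet> h)"
      have "(\<Sum>i\<in>UNIV. of_real (h $ i) * (2 * pi * \<i> * of_int (q $ i) * a q * character q y))
          = a q * character q y * (\<i> * t)"
        by (simp add: t_def inner_vec_def ivec_def sum_distrib_left sum_distrib_right mult_ac)
      then have "R q = a q * character q y * (cis t - 1 - \<i> * t)"
        by (simp add: R_def z character_translate algebra_simps) (simp add: character_def t_def)
      then have "cmod (R q) \<le> cmod (a q) * t\<^sup>2"
        by (simp add: norm_mult mult_left_mono cmod_cis_remainder)
      also have "\<dots> \<le> C / weight q ^ (2 + 2 * CARD('n)) * (2 * pi * (weight q * norm h))\<^sup>2"
      proof (intro mult_mono C)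
        have "\<bar>ivec q \<bullet> h\<bar> \<le> norm (ivec q) * norm h" by (rule Cauchy_Schwarz_ineq2)
        also have "\<dots> \<le> weight q * norm h" by (intro mult_right_mono) (auto simp: weight_def)
        finally have "\<bar>t\<bar> \<le> 2 * pi * (weight q * norm h)" by (simp add: t_def abs_mult)
        then show "t\<^sup>2 \<le> (2 * pi * (weight q * norm h))\<^sup>2" by (metis abs_ge_zero power2_abs power_mono)
        show "0 \<le> C / weight q ^ (2 + 2 * CARD('n))" by (rule order_trans[OF norm_ge_zero C])
      qed simp
      also have "\<dots> = b q * (norm h)\<^sup>2"
        using less_imp_neq[OF weight_pos[of q]] by (simp add: b_def power_mult_distrib power_add power2_eq_square field_simps)
      finally show ?thesis .
    qed
    have sb: "(\<lambda>q. b q * (norm h)\<^sup>2) summable_on UNIV" by (intro summable_on_cmult_left b)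
    have s: "(\<lambda>q. cmod (R q)) summable_on UNIV" by (rule summable_on_comparison_test[OF sb]) (use R in auto)
    have "cmod (infsum R UNIV) \<le> (\<Sum>\<^sub>\<infinity>q. b q * (norm h)\<^sup>2)"
      by (rule order_trans[OF norm_infsum_bound[OF s] infsum_mono[OF s sb R]])
    also have "\<dots> = infsum b UNIV * (norm h)\<^sup>2" by (rule infsum_cmult_left')
    finally show ?thesis using eq by (simp only: h_def)
  qed
  have "(fourier_series a has_derivative L) (at y)"
  proof (rule has_derivativeI_sandwich[of 1])
    show "bounded_linear L"
      unfolding L_def[abs_def]
      by (intro bounded_linear_sum bounded_linear_scaleR_const bounded_linear_vec_nth)
    show "norm (fourier_series a z - fourier_series a y - L (z - y)) / norm (z - y) \<le> infsum b UNIV * norm (z - y)"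
      if "z \<noteq> y" for z
      using rem[of z] that by (simp add: divide_le_eq power2_eq_square mult.assoc)
    have "((\<lambda>z. infsum b UNIV * norm (z - y)) \<longlongrightarrow> infsum b UNIV * norm (y - y)) (at y)"
      by (intro tendsto_intros)
    then show "((\<lambda>z. infsum b UNIV * norm (z - y)) \<longlongrightarrow> 0) (at y)" by simp
  qed simp
  then show ?thesis unfolding L_def[abs_def] .
qed

definition multiplier :: "'n list \<Rightarrow> int ^ 'n \<Rightarrow> complex" where
  "multiplier is q = (\<Prod>i\<leftarrow>is. 2 * pi * \<i> * of_int (q $ i))"

lemma multiplier_simps [simp]:
  "multiplier [] q = 1" "multiplier (i # is) q = 2 * pi * \<i> * of_int (q $ i) * multiplier is q"
  by (simp_all add: multiplier_def)

lemma norm_multiplier_le: "cmod (multiplier is q) \<le> (2 * pi * weight q) ^ length is"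
proof (induction "is")
  case (Cons i "is")
  have "cmod (multiplier (i # is) q) = 2 * pi * \<bar>of_int (q $ i)\<bar> * cmod (multiplier is q)"
    by (simp add: norm_mult)
  also have "\<dots> \<le> 2 * pi * weight q * (2 * pi * weight q) ^ length is"
    by (intro mult_mono Cons.IH abs_component_le_weight) (auto simp: less_imp_le)
  finally show ?case by simp
qed simp

lemma iter_deriv_fourier_series:
  assumes "a \<in> schwartz_Z"
  shows "iter_deriv is (fourier_series a) = fourier_series (\<lambda>q. multiplier is q * a q)"
    and "(\<lambda>q. multiplier is q * a q) \<in> schwartz_Z"
    and "iter_deriv is (fourier_series a) differentiable (at y)"
proof -
  have *: "iter_deriv is (fourier_series a) = fourier_series (\<lambda>q. multiplier is q * a q) \<and>
      (\<lambda>q. multiplier is q * a q) \<in> schwartz_Z"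
  proof (induction "is")
    case (Cons i "is")
    define b where "b q = multiplier is q * a q" for q
    have b: "b \<in> schwartz_Z" "iter_deriv is (fourier_series a) = fourier_series b"
      using Cons by (simp_all add: b_def[abs_def])
    have "frechet_derivative (fourier_series b) (at y) (axis i 1) = fourier_series (\<lambda>q. 2 * pi * \<i> * of_int (q $ i) * b q) y" for y
    proof -
      have "frechet_derivative (fourier_series b) (at y) (axis i 1)
          = (\<Sum>j\<in>UNIV. (axis i 1 :: real ^ 'a) $ j *\<^sub>R fourier_series (\<lambda>q. 2 * pi * \<i> * of_int (q $ j) * b q) y)"
        by (subst frechet_derivative_at[OF has_derivative_fourier_series[OF b(1)], symmetric]) simp
      also have "\<dots> = fourier_series (\<lambda>q. 2 * pi * \<i> * of_int (q $ i) * b q) y"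
        by (simp add: axis_def if_distrib[of "\<lambda>x. x *\<^sub>R _"] cong: if_cong)
      finally show ?thesis .
    qed
    then show ?case using schwartz_Z_mult_component[OF b(1), of "2 * pi * \<i>" i]
      unfolding iter_deriv.simps b(2) by (simp add: b_def[abs_def] mult.assoc)
  qed (simp add: assms)
  then show "iter_deriv is (fourier_series a) = fourier_series (\<lambda>q. multiplier is q * a q)"
    "(\<lambda>q. multiplier is q * a q) \<in> schwartz_Z" by auto
  show "iter_deriv is (fourier_series a) differentiable (at y)"
    unfolding conjunct1[OF *] differentiable_def
    using has_derivative_fourier_series[OF conjunct2[OF *]] by blast
qed

section \<open>Schwartz functions built from coefficient arrays\<close>

definition rapidly_decreasing :: "(int ^ 'n \<Rightarrow> int ^ 'n \<Rightarrow> complex) \<Rightarrow> bool" where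
  "rapidly_decreasing a \<longleftrightarrow> (\<forall>M::nat. \<exists>C. \<forall>k q. cmod (a k q) \<le> C / (weight k * weight q) ^ M)"

definition synthesis :: "(int ^ 'n \<Rightarrow> int ^ 'n \<Rightarrow> complex) \<Rightarrow> (int ^ 'n) \<times> (real ^ 'n) \<Rightarrow> complex" where
  "synthesis a = (\<lambda>(k, y). fourier_series (a k) y)"

lemma rapidly_decreasing_row:
  assumes "rapidly_decreasing a" shows "a k \<in> schwartz_Z"
  unfolding schwartz_Z_weight
proof
  fix M
  obtain C where C: "\<And>k q. cmod (a k q) \<le> C / (weight k * weight q) ^ M"
    using assms unfolding rapidly_decreasing_def by blast
  have "cmod (a k q) \<le> (C / weight k ^ M) / weight q ^ M" for q
    using C[of k q] by (simp add: power_mult_distrib)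
  then show "\<exists>C. \<forall>q. cmod (a k q) \<le> C / weight q ^ M" by blast
qed

lemma rapidly_decreasing_restrict:
  assumes "rapidly_decreasing a" shows "rapidly_decreasing (\<lambda>k q. if (k, q) \<in> A then a k q else 0)"
  unfolding rapidly_decreasing_def
proof
  fix M :: nat
  obtain C where C: "\<And>k q. cmod (a k q) \<le> C / (weight k * weight q) ^ M"
    using assms unfolding rapidly_decreasing_def by blast
  have "cmod (if (k, q) \<in> A then a k q else 0) \<le> C / (weight k * weight q) ^ M" for k q
    using C[of k q] order_trans[OF norm_ge_zero C[of k q]] by auto
  then show "\<exists>C. \<forall>k q. cmod (if (k, q) \<in> A then a k q else 0) \<le> C / (weight k * weight q) ^ M" by blast
qed

lemma rapidly_decreasing_single:
  "rapidly_decreasing (\<lambda>k q. if k = k0 \<and> q = q0 then c else 0)"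
  unfolding rapidly_decreasing_def
proof
  fix M :: nat
  have "cmod (if k = k0 \<and> q = q0 then c else 0) \<le> cmod c * (weight k0 * weight q0) ^ M / (weight k * weight q) ^ M" for k q
    using less_imp_neq[OF weight_pos[of k0]] less_imp_neq[OF weight_pos[of q0]]
    by (auto simp: less_imp_le)
  then show "\<exists>C. \<forall>k q. cmod (if k = k0 \<and> q = q0 then c else 0) \<le> C / (weight k * weight q) ^ M" by blast
qed

lemma synthesis_add:
  assumes "rapidly_decreasing a" "rapidly_decreasing b"
  shows "synthesis (\<lambda>k q. a k q + b k q) = (\<lambda>z. synthesis a z + synthesis b z)"
proof
  fix z :: "(int ^ 'a) \<times> (real ^ 'a)"
  obtain k y where z: "z = (k, y)" by fastforce
  have "((\<lambda>q. a k q * character q y + b k q * character q y) has_sum (synthesis a z + synthesis b z)) UNIV"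
    unfolding z synthesis_def prod.case
    by (intro has_sum_add fourier_series_has_sum rapidly_decreasing_row assms)
  then show "synthesis (\<lambda>k q. a k q + b k q) z = synthesis a z + synthesis b z"
    by (simp add: z synthesis_def fourier_series_def distrib_right infsumI)
qed

lemma synthesis_cmult: "synthesis (\<lambda>k q. c * a k q) = (\<lambda>z. c * synthesis a z)"
  by (auto simp: fun_eq_iff synthesis_def fourier_series_def mult.assoc infsum_cmult_right')

text \<open>Of the exponent N + 2n, the first N powers pay for \<open>weight k ^ N\<close> and for
  up to N derivatives, each of which costs 2 pi times \<open>weight q\<close>; the other 2n make the
  sum over the frequencies converge. The bound is linear in \<open>S\<close>, which later makes
  tails small.\<close>

lemma synthesis_iter_deriv_bound:
  fixes b :: "int ^ 'n \<Rightarrow> int ^ 'n \<Rightarrow> complex"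
  assumes b: "\<And>k. b k \<in> schwartz_Z"
    and S: "\<And>k q. cmod (b k q) \<le> S / (weight k * weight q) ^ (N + 2 * CARD('n))"
    and len: "length is \<le> N"
  shows "weight k ^ N * cmod (iter_deriv is (\<lambda>y. synthesis b (k, y)) y)
    \<le> (2 * pi) ^ N * S * (\<Sum>\<^sub>\<infinity>q :: int ^ 'n. 1 / weight q ^ (2 * CARD('n)))"
proof -
  let ?m = "2 * CARD('n)"
  have S0: "S \<ge> 0" using order_trans[OF norm_ge_zero S[of 0 0]] by (simp add: weight_def)
  have summand: "weight k ^ N * cmod (multiplier is q * b k q) \<le> (2 * pi) ^ N * S * (1 / weight q ^ ?m)" for q
  proof -
    have "cmod (multiplier is q) \<le> (2 * pi * weight q) ^ N"
    proof (rule order_trans[OF norm_multiplier_le power_increasing[OF len]])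
      show "1 \<le> 2 * pi * weight q"
        using mult_mono[of 1 "2 * pi" 1 "weight q"] weight_ge_1[of q] pi_gt3 by simp
    qed
    then have "weight k ^ N * cmod (multiplier is q * b k q)
        \<le> weight k ^ N * ((2 * pi * weight q) ^ N * (S / (weight k * weight q) ^ (N + ?m)))"
      unfolding norm_mult using S by (intro mult_left_mono mult_mono) (auto simp: less_imp_le)
    also have "\<dots> = (2 * pi) ^ N * S * (1 / (weight k * weight q) ^ ?m)"
      using less_imp_neq[OF weight_pos[of q]] less_imp_neq[OF weight_pos[of k]]
      by (simp add: power_mult_distrib power_add field_simps)
    also have "\<dots> \<le> (2 * pi) ^ N * S * (1 / weight q ^ ?m)"
    proof (intro mult_left_mono divide_left_mono power_mono)
      show "weight q \<le> weight k * weight q"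
        using mult_right_mono[OF weight_ge_1[of k], of "weight q"] by (simp add: less_imp_le)
    qed (use S0 in \<open>auto simp: less_imp_le\<close>)
    finally show ?thesis .
  qed
  have "(\<lambda>q. cmod (multiplier is q * b k q)) summable_on UNIV"
    by (intro schwartz_Z_summable iter_deriv_fourier_series(2) b)
  then have s: "(\<lambda>q. cmod (multiplier is q * b k q * character q y)) summable_on UNIV" by (simp add: norm_mult)
  have eq: "iter_deriv is (\<lambda>y. synthesis b (k, y)) = fourier_series (\<lambda>q. multiplier is q * b k q)"
    using iter_deriv_fourier_series(1)[OF b[of k]] by (simp add: synthesis_def)
  have "weight k ^ N * cmod (iter_deriv is (\<lambda>y. synthesis b (k, y)) y)
      \<le> weight k ^ N * (\<Sum>\<^sub>\<infinity>q. cmod (multiplier is q * b k q * character q y))"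
    unfolding eq fourier_series_def
    by (intro mult_left_mono norm_infsum_bound s) (auto simp: less_imp_le)
  also have "\<dots> = (\<Sum>\<^sub>\<infinity>q. weight k ^ N * cmod (multiplier is q * b k q * character q y))"
    by (rule infsum_cmult_right'[symmetric])
  also have "\<dots> \<le> (\<Sum>\<^sub>\<infinity>q :: int ^ 'n. (2 * pi) ^ N * S * (1 / weight q ^ ?m))"
    using summand by (intro infsum_mono summable_on_cmult_right s summable_on_weight) (simp add: norm_mult)
  also have "\<dots> = (2 * pi) ^ N * S * (\<Sum>\<^sub>\<infinity>q :: int ^ 'n. 1 / weight q ^ ?m)"
    by (rule infsum_cmult_right')
  finally show ?thesis .
qed

lemma synthesis_in_schwartz_ZT:
  fixes a :: "int ^ 'n \<Rightarrow> int ^ 'n \<Rightarrow> complex"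
  assumes a: "rapidly_decreasing a"
  shows "synthesis a \<in> schwartz_ZT"
  unfolding schwartz_ZT_def
proof (intro CollectI conjI allI)
  fix k :: "int ^ 'n" and y :: "real ^ 'n" and l :: "int ^ 'n"
  show "synthesis a (k, y + ivec l) = synthesis a (k, y)"
    using periodic_fourier_series[of "a k"] by (simp add: synthesis_def periodic_def)
next
  fix k :: "int ^ 'n" and "is" and y :: "real ^ 'n"
  show "iter_deriv is (\<lambda>y. synthesis a (k, y)) differentiable (at y)"
    using iter_deriv_fourier_series(3)[OF rapidly_decreasing_row[OF a]] by (simp add: synthesis_def)
next
  fix "is" :: "'n list" and M :: nat
  define N where "N = max M (length is)"
  obtain C where C: "\<And>k q. cmod (a k q) \<le> C / (weight k * weight q) ^ (N + 2 * CARD('n))"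
    using a unfolding rapidly_decreasing_def by blast
  define D where "D = (2 * pi) ^ N * C * (\<Sum>\<^sub>\<infinity>q :: int ^ 'n. 1 / weight q ^ (2 * CARD('n)))"
  have "cmod (iter_deriv is (\<lambda>y. synthesis a (k, y)) y) \<le> D / weight k ^ M" for k y
  proof -
    have "weight k ^ M * cmod (iter_deriv is (\<lambda>y. synthesis a (k, y)) y)
        \<le> weight k ^ N * cmod (iter_deriv is (\<lambda>y. synthesis a (k, y)) y)"
      by (intro mult_right_mono power_increasing weight_ge_1) (auto simp: N_def)
    also have "\<dots> \<le> D"
      unfolding D_def by (rule synthesis_iter_deriv_bound[OF rapidly_decreasing_row[OF a] C]) (simp add: N_def)
    finally show ?thesis by (simp add: pos_le_divide_eq mult.commute)
  qed
  then show "\<exists>C. \<forall>k y. cmod (iter_deriv is (\<lambda>y. synthesis a (k, y)) y) \<le> C / (1 + norm (ivec k)) ^ M"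
    unfolding weight_def by blast
qed

text \<open>The suprema are taken in the reals, so boundedness has to be established before the
  value at one point bounds them from below.\<close>

lemma seminorm_ZT_nonneg:
  assumes "\<phi> \<in> schwartz_ZT"
  shows "seminorm_ZT N \<phi> \<ge> 0"
  unfolding seminorm_ZT_def
proof (rule sum_nonneg)
  fix "is"
  obtain C where C: "\<And>k y. cmod (iter_deriv is (\<lambda>y. \<phi> (k, y)) y) \<le> C / (1 + norm (ivec k)) ^ N"
    using assms unfolding schwartz_ZT_def by blast
  have "bdd_above (range (\<lambda>(k, y). (1 + norm (ivec k)) ^ N * cmod (iter_deriv is (\<lambda>y. \<phi> (k, y)) y)))"
  proof (rule bdd_aboveI2)
    fix z :: "(int ^ 'a) \<times> (real ^ 'a)"
    obtain k y where z: "z = (k, y)" by fastforce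
    have "(1 + norm (ivec k)) ^ N > 0" by (simp add: add_pos_nonneg)
    then show "(case z of (k, y) \<Rightarrow> (1 + norm (ivec k)) ^ N * cmod (iter_deriv is (\<lambda>y. \<phi> (k, y)) y)) \<le> C"
      using C[of k y] by (simp add: z pos_le_divide_eq mult.commute)
  qed
  then show "0 \<le> (SUP (k, y). (1 + norm (ivec k)) ^ N * cmod (iter_deriv is (\<lambda>y. \<phi> (k, y)) y))"
    by (intro cSUP_upper2[of _ _ "(0, 0)"]) auto
qed

lemma seminorm_ZT_synthesis_le:
  fixes b :: "int ^ 'n \<Rightarrow> int ^ 'n \<Rightarrow> complex"
  assumes b: "\<And>k. b k \<in> schwartz_Z"
    and S: "\<And>k q. cmod (b k q) \<le> S / (weight k * weight q) ^ (N + 2 * CARD('n))"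
    and j: "j \<le> N"
  shows "seminorm_ZT j (synthesis b)
    \<le> card {is :: 'n list. length is \<le> j} * ((2 * pi) ^ N * S * (\<Sum>\<^sub>\<infinity>q :: int ^ 'n. 1 / weight q ^ (2 * CARD('n))))"
  unfolding seminorm_ZT_def
proof (rule sum_bounded_above)
  fix "is" :: "'n list" assume "is \<in> {is. length is \<le> j}"
  then have len: "length is \<le> N" using j by simp
  show "(SUP (k, y). (1 + norm (ivec k)) ^ j * cmod (iter_deriv is (\<lambda>y. synthesis b (k, y)) y))
      \<le> (2 * pi) ^ N * S * (\<Sum>\<^sub>\<infinity>q :: int ^ 'n. 1 / weight q ^ (2 * CARD('n)))"
  proof (rule cSUP_least)
    fix z :: "(int ^ 'n) \<times> (real ^ 'n)"
    obtain k y where z: "z = (k, y)" by fastforce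
    have "weight k ^ j * cmod (iter_deriv is (\<lambda>y. synthesis b (k, y)) y)
        \<le> weight k ^ N * cmod (iter_deriv is (\<lambda>y. synthesis b (k, y)) y)"
      by (intro mult_right_mono power_increasing weight_ge_1 j) auto
    also note synthesis_iter_deriv_bound[OF b S len]
    finally show "(case z of (k, y) \<Rightarrow> (1 + norm (ivec k)) ^ j * cmod (iter_deriv is (\<lambda>y. synthesis b (k, y)) y))
      \<le> (2 * pi) ^ N * S * (\<Sum>\<^sub>\<infinity>q :: int ^ 'n. 1 / weight q ^ (2 * CARD('n)))"
      by (simp add: z weight_def)
  qed simp
qed

text \<open>The function that is \<open>character q\<close> on the row \<open>k\<close> and 0 on the
  other rows. The pairing is bilinear, so the value of a distribution on it is the Fourier
  coefficient of its row \<open>k\<close> at the frequency \<open>- q\<close>.\<close>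

definition atom :: "int ^ 'n \<Rightarrow> int ^ 'n \<Rightarrow> (int ^ 'n) \<times> (real ^ 'n) \<Rightarrow> complex" where
  "atom k q = synthesis (\<lambda>k' q'. if k' = k \<and> q' = q then 1 else 0)"

text \<open>Linearity settles coefficients restricted to a finite set; continuity has to make the
  rest small. Outside the box of radius R in both indices one of the two weights exceeds 1 + R, so
  giving up one power of the rapid decay bounds every seminorm involved by a multiple of 1/(1 +
  R).\<close>

lemma tempered_ZT_synthesis_has_sum:
  fixes a :: "int ^ 'n \<Rightarrow> int ^ 'n \<Rightarrow> complex"
  assumes \<sigma>: "\<sigma> \<in> tempered_ZT" and a: "rapidly_decreasing a"
  shows "((\<lambda>(k, q). a k q * \<sigma> (atom k q)) has_sum \<sigma> (synthesis a)) UNIV"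
  unfolding has_sum_def tendsto_iff eventually_finite_subsets_at_top
proof (intro allI impI)
  fix e :: real assume e: "e > 0"
  have add: "\<sigma> (\<lambda>z. \<phi> z + \<psi> z) = \<sigma> \<phi> + \<sigma> \<psi>" if "\<phi> \<in> schwartz_ZT" "\<psi> \<in> schwartz_ZT" for \<phi> \<psi>
    using \<sigma> that by (auto simp: tempered_ZT_def top_dual_def)
  have scale: "\<sigma> (\<lambda>z. c * \<phi> z) = c * \<sigma> \<phi>" if "\<phi> \<in> schwartz_ZT" for c \<phi>
    using \<sigma> that by (auto simp: tempered_ZT_def top_dual_def)
  obtain C N where CN: "\<And>\<phi>. \<phi> \<in> schwartz_ZT \<Longrightarrow> cmod (\<sigma> \<phi>) \<le> C * (\<Sum>j\<le>N. seminorm_ZT j \<phi>)"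
    using \<sigma> unfolding tempered_ZT_def top_dual_def by blast
  define r where "r A = (\<lambda>k q. if (k, q) \<in> A then a k q else 0)" for A
  have r: "rapidly_decreasing (r A)" for A unfolding r_def by (rule rapidly_decreasing_restrict[OF a])
  have \<sigma>_add: "\<sigma> (synthesis (\<lambda>k q. b k q + b' k q)) = \<sigma> (synthesis b) + \<sigma> (synthesis b')"
    if "rapidly_decreasing b" "rapidly_decreasing b'" for b b'
    unfolding synthesis_add[OF that] by (intro add synthesis_in_schwartz_ZT that)
  have fin: "\<sigma> (synthesis (r F)) = (\<Sum>(k, q)\<in>F. a k q * \<sigma> (atom k q))" if "finite F" for F
    using that
  proof induction
    case empty
    have "synthesis (r {}) = (\<lambda>z. 0 * synthesis a z)"
      unfolding synthesis_cmult[symmetric] by (simp add: r_def)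
    then show ?case using scale[OF synthesis_in_schwartz_ZT[OF a], of 0] by simp
  next
    case (insert x F)
    obtain k q where x: "x = (k, q)" by fastforce
    define d where "d = (\<lambda>k' q'. if k' = k \<and> q' = q then 1 else 0 :: complex)"
    have d: "rapidly_decreasing d" unfolding d_def by (rule rapidly_decreasing_single)
    have ad: "rapidly_decreasing (\<lambda>k' q'. a k q * d k' q')"
      using rapidly_decreasing_single[of k q "a k q"] by (simp add: d_def if_distrib cong: if_cong)
    have "r (insert x F) = (\<lambda>k' q'. a k q * d k' q' + r F k' q')"
      using insert.hyps by (auto simp: r_def d_def x fun_eq_iff)
    then have "\<sigma> (synthesis (r (insert x F))) = \<sigma> (synthesis (\<lambda>k' q'. a k q * d k' q')) + \<sigma> (synthesis (r F))"
      using \<sigma>_add[OF ad r] by simp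
    also have "\<sigma> (synthesis (\<lambda>k' q'. a k q * d k' q')) = a k q * \<sigma> (atom k q)"
      unfolding synthesis_cmult scale[OF synthesis_in_schwartz_ZT[OF d]] by (simp add: atom_def d_def)
    finally show ?case using insert by (simp add: x)
  qed
  let ?m = "2 * CARD('n)"
  define Z where "Z = (\<Sum>\<^sub>\<infinity>q :: int ^ 'n. 1 / weight q ^ ?m)"
  have Z: "Z \<ge> 0" unfolding Z_def by (intro infsum_nonneg) (simp add: less_imp_le)
  obtain D where D: "\<And>k q. cmod (a k q) \<le> D / (weight k * weight q) ^ Suc (N + ?m)"
    using a unfolding rapidly_decreasing_def by blast
  have D0: "D \<ge> 0"
    using order_trans[OF norm_ge_zero D[of 0 0]] by (simp add: weight_def)
  \<comment> \<open>\<open>\<sigma>\<close> of the rest will be at most \<open>B / (1 + R)\<close>,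
    and \<open>R = B / e\<close> makes this less than \<open>e\<close> even when \<open>B\<close> is
    0. The modulus is taken because nothing is known about the sign of \<open>C\<close>.\<close>
  define B where "B = \<bar>C\<bar> * (\<Sum>j\<le>N. card {is :: 'n list. length is \<le> j} * ((2 * pi) ^ N * (D * Z)))"
  have B: "B \<ge> 0" using D0 Z by (auto simp: B_def intro!: mult_nonneg_nonneg sum_nonneg)
  define R where "R = B / e"
  have R: "R \<ge> 0" using B e by (simp add: R_def)
  define F0 where "F0 = {k :: int ^ 'n. norm (ivec k) \<le> R} \<times> {k :: int ^ 'n. norm (ivec k) \<le> R}"
  have "dist (\<Sum>(k, q)\<in>F. a k q * \<sigma> (atom k q)) (\<sigma> (synthesis a)) < e" if F: "finite F" "F0 \<subseteq> F" for F
  proof -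
    have "a = (\<lambda>k q. r (- F) k q + r F k q)" by (auto simp: r_def fun_eq_iff)
    then have "\<sigma> (synthesis a) = \<sigma> (synthesis (r (- F))) + \<sigma> (synthesis (r F))"
      using \<sigma>_add[OF r r, of "- F" F] by simp
    then have dist: "dist (\<Sum>(k, q)\<in>F. a k q * \<sigma> (atom k q)) (\<sigma> (synthesis a)) = cmod (\<sigma> (synthesis (r (- F))))"
      using fin[OF F(1)] by (simp add: dist_norm)
    have small: "cmod (r (- F) k q) \<le> (D / (1 + R)) / (weight k * weight q) ^ (N + ?m)" for k q
    proof (cases "(k, q) \<in> F")
      case True
      then show ?thesis using D0 R by (simp add: r_def less_imp_le)
    next
      case False
      then have "(k, q) \<notin> F0" using F by blast
      then have "1 + R \<le> weight k \<or> 1 + R \<le> weight q" by (auto simp: F0_def weight_def)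
      then have w: "1 + R \<le> weight k * weight q"
        using mult_mono[of 1 "weight k" "1 + R" "weight q"] mult_mono[of "1 + R" "weight k" 1 "weight q"]
          weight_ge_1[of k] weight_ge_1[of q] R by auto
      define p where "p = weight k * weight q"
      have p: "p > 0" "1 + R \<le> p" using w by (simp_all add: p_def)
      have "cmod (r (- F) k q) \<le> D / p / p ^ (N + ?m)"
        using D[of k q] False by (simp add: r_def p_def)
      also have "\<dots> \<le> (D / (1 + R)) / p ^ (N + ?m)"
        using p D0 R by (intro divide_right_mono divide_left_mono mult_pos_pos) auto
      finally show ?thesis by (simp add: p_def)
    qed
    have "cmod (\<sigma> (synthesis (r (- F)))) \<le> C * (\<Sum>j\<le>N. seminorm_ZT j (synthesis (r (- F))))"
      by (intro CN synthesis_in_schwartz_ZT r)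
    also have "\<dots> \<le> \<bar>C\<bar> * \<bar>\<Sum>j\<le>N. seminorm_ZT j (synthesis (r (- F)))\<bar>"
      by (metis abs_ge_self abs_mult)
    also have "\<dots> \<le> \<bar>C\<bar> * (\<Sum>j\<le>N. card {is :: 'n list. length is \<le> j} * ((2 * pi) ^ N * (D / (1 + R)) * Z))"
    proof (intro mult_left_mono)
      have "(\<Sum>j\<le>N. seminorm_ZT j (synthesis (r (- F)))) \<ge> 0"
        by (intro sum_nonneg seminorm_ZT_nonneg synthesis_in_schwartz_ZT r)
      then show "\<bar>\<Sum>j\<le>N. seminorm_ZT j (synthesis (r (- F)))\<bar> \<le> (\<Sum>j\<le>N. card {is :: 'n list. length is \<le> j} * ((2 * pi) ^ N * (D / (1 + R)) * Z))"
        using sum_mono[of "{..N}", OF seminorm_ZT_synthesis_le[OF rapidly_decreasing_row[OF r] small, folded Z_def]] by simp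
    qed simp
    also have "\<dots> = B / (1 + R)"
      by (simp add: B_def sum_distrib_left sum_divide_distrib mult_ac)
    also have "\<dots> < e"
    proof -
      have "B < e * (1 + R)" using e by (simp add: R_def field_simps)
      then show ?thesis using R by (simp add: pos_divide_less_eq)
    qed
    finally show ?thesis unfolding dist .
  qed
  moreover have "finite F0" unfolding F0_def by (intro finite_cartesian_product finite_lattice_ball)
  ultimately show "\<exists>X. finite X \<and> X \<subseteq> UNIV \<and>
      (\<forall>Y. finite Y \<and> X \<subseteq> Y \<and> Y \<subseteq> UNIV \<longrightarrow> dist (\<Sum>(k, q)\<in>Y. a k q * \<sigma> (atom k q)) (\<sigma> (synthesis a)) < e)"
    by blast
qed

section \<open>Decay of the coefficients of Schwartz functions\<close>

lemma periodic_partial_derivative: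
  fixes f :: "real ^ 'n \<Rightarrow> complex"
  assumes "\<And>y. f differentiable (at y)" "periodic f"
  shows "periodic (\<lambda>y. frechet_derivative f (at y) v)"
  unfolding periodic_def
proof (intro allI)
  fix y :: "real ^ 'n" and l
  have "(f has_derivative frechet_derivative f (at (y + ivec l))) (at (y + ivec l))"
    using assms(1) by (simp add: frechet_derivative_works)
  then have "((\<lambda>x. f (x + ivec l)) has_derivative frechet_derivative f (at (y + ivec l))) (at y)"
    by (rule has_derivative_compose[rotated, where f = "\<lambda>x. x + ivec l"]) (auto intro!: derivative_eq_intros)
  also have "(\<lambda>x. f (x + ivec l)) = f" using assms(2) by (auto simp: periodic_def)
  finally show "frechet_derivative f (at (y + ivec l)) v = frechet_derivative f (at y) v"
    by (rule fun_cong[OF frechet_derivative_at])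
qed

text \<open>Let m be the largest modulus of a component. The norm is at most n m, and m \<ge> 1
  absorbs the 1 in the weight. Derivatives in one direction give decay in one component; this
  converts it into decay in the weight.\<close>

lemma weight_le_some_component:
  fixes q :: "int ^ 'n"
  obtains "weight q = 1" | i where "weight q \<le> (1 + real CARD('n)) * \<bar>real_of_int (q $ i)\<bar>"
proof (cases "q = 0")
  case True
  then show ?thesis using that(1) by (simp add: weight_def)
next
  case False
  define m where "m = Max (range (\<lambda>i. \<bar>q $ i\<bar>))"
  have "m \<in> range (\<lambda>i. \<bar>q $ i\<bar>)" unfolding m_def by (rule Max_in) auto
  then obtain i where i: "m = \<bar>q $ i\<bar>" by auto
  have le: "\<bar>q $ j\<bar> \<le> m" for j unfolding m_def by (rule Max_ge) auto
  obtain j where "q $ j \<noteq> 0" using False by (auto simp: vec_eq_iff)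
  then have m: "m \<ge> 1" using le[of j] by linarith
  have "norm (ivec q) \<le> (\<Sum>j\<in>UNIV. \<bar>ivec q $ j\<bar>)" by (rule norm_le_l1_cart)
  also have "\<dots> \<le> (\<Sum>j\<in>(UNIV :: 'n set). real_of_int m)"
    using le by (intro sum_mono) (simp add: ivec_def flip: of_int_abs)
  finally have "weight q \<le> 1 + CARD('n) * real_of_int m" by (simp add: weight_def)
  also have "\<dots> \<le> (1 + real CARD('n)) * real_of_int m" using m by (simp add: distrib_right)
  finally show ?thesis using that(2)[of i] by (simp add: i)
qed

text \<open>\<open>M\<close> derivatives in one direction multiply the coefficient at
  \<open>q\<close> by the \<open>M\<close>-th power of 2 pi times the corresponding component, up to
  a unimodular factor, and are still bounded with the same decay in \<open>k\<close>. Choosing for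
  each \<open>q\<close> its largest component yields decay in both weights, after which inversion
  applies row by row.\<close>

lemma schwartz_ZT_coeff:
  fixes G :: "(int ^ 'n) \<times> (real ^ 'n) \<Rightarrow> complex"
  assumes G: "G \<in> schwartz_ZT"
  defines "\<gamma> \<equiv> \<lambda>k. fourier_coeff (\<lambda>y. G (k, y))"
  shows "rapidly_decreasing \<gamma>" and "G = synthesis \<gamma>"
proof -
  have G1: "G (k, y + ivec l) = G (k, y)" for k y l using G by (auto simp: schwartz_ZT_def)
  have G2: "iter_deriv is (\<lambda>y. G (k, y)) differentiable (at y)" for k "is" y
    using G by (auto simp: schwartz_ZT_def)
  have G3: "\<exists>C. \<forall>k y. cmod (iter_deriv is (\<lambda>y. G (k, y)) y) \<le> C / weight k ^ M" for "is" M
    using G by (auto simp: schwartz_ZT_def weight_def)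
  have per: "periodic (iter_deriv is (\<lambda>y. G (k, y)))" for k "is"
  proof (induction "is")
    case (Cons i "is")
    show ?case by (simp add: periodic_partial_derivative[OF G2 Cons.IH])
  qed (simp add: periodic_def G1)
  have coeff_bound: "cmod (fourier_coeff f q) \<le> B" if "\<And>y. cmod (f y) \<le> B" "continuous_on UNIV f" for f :: "real ^ 'n \<Rightarrow> complex" and q B
  proof -
    have "cmod (fourier_coeff f q) \<le> (\<integral>y. cmod (f y * cnj (character q y)) \<partial>torus)"
      unfolding fourier_coeff_def by (rule integral_norm_bound)
    also have "\<dots> \<le> (\<integral>y. B \<partial>(torus :: (real ^ 'n) measure))"
      using that(1) integrable_norm[OF integrable_torus_continuous(1)[OF that(2)]]
      by (intro integral_mono) (auto simp: norm_mult)
    finally show ?thesis by (simp add: torus.prob_space)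
  qed
  have cont: "continuous_on UNIV (iter_deriv is (\<lambda>y. G (k, y)))" for k "is"
    by (intro continuous_at_imp_continuous_on ballI differentiable_imp_continuous_within G2)
  have coeff_deriv: "fourier_coeff (iter_deriv (replicate N i) (\<lambda>y. G (k, y))) q = (2 * pi * \<i> * of_int (q $ i)) ^ N * \<gamma> k q" for N i k q
  proof (induction N)
    case (Suc N)
    obtain B where B: "\<And>y. cmod (iter_deriv (i # replicate N i) (\<lambda>y. G (k, y)) y) \<le> B"
      using G3[of "i # replicate N i" 0] by auto
    have "fourier_coeff (iter_deriv (replicate (Suc N) i) (\<lambda>y. G (k, y))) q
        = 2 * pi * \<i> * of_int (q $ i) * fourier_coeff (iter_deriv (replicate N i) (\<lambda>y. G (k, y))) q"
      using fourier_coeff_partial_derivative[OF G2 per, of "replicate N i" k i B q] B by simp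
    then show ?case by (simp add: Suc)
  qed (simp add: \<gamma>_def)
  show rapid: "rapidly_decreasing \<gamma>"
    unfolding rapidly_decreasing_def
  proof
    fix M :: nat
    have "\<forall>i. \<exists>C. \<forall>k y. cmod (iter_deriv (replicate M i) (\<lambda>y. G (k, y)) y) \<le> C / weight k ^ M"
      using G3 by blast
    then obtain C where C: "\<And>i k y. cmod (iter_deriv (replicate M i) (\<lambda>y. G (k, y)) y) \<le> C i / weight k ^ M"
      by metis
    obtain C0 where C0: "\<And>k y. cmod (G (k, y)) \<le> C0 / weight k ^ M" using G3[of "[]" M] by auto
    have C_nonneg: "0 \<le> C i" for i using order_trans[OF norm_ge_zero C[of i 0]] by (simp add: weight_def)
    have C0_nonneg: "0 \<le> C0" using order_trans[OF norm_ge_zero C0[of 0]] by (simp add: weight_def)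
    \<comment> \<open>One constant for both cases below: \<open>C0\<close> serves
      \<open>q = 0\<close>, where no component helps, and \<open>C i\<close> the frequencies
      controlled by component \<open>i\<close>.\<close>
    define D where "D = (1 + real CARD('n)) ^ M * (C0 + (\<Sum>i\<in>UNIV. C i))"
    have "cmod (\<gamma> k q) \<le> D / (weight k * weight q) ^ M" for k q
    proof -
      have 0: "cmod (\<gamma> k q) \<le> C0 / weight k ^ M"
        unfolding \<gamma>_def using cont[of "[]" k] by (intro coeff_bound C0) simp
      have 1: "\<bar>real_of_int (q $ i)\<bar> ^ M * cmod (\<gamma> k q) \<le> C i / weight k ^ M" for i
      proof -
        have "\<bar>real_of_int (q $ i)\<bar> ^ M \<le> (2 * pi * \<bar>real_of_int (q $ i)\<bar>) ^ M"
          using pi_gt3 mult_right_mono[of 1 "2 * pi" "\<bar>real_of_int (q $ i)\<bar>"] by (intro power_mono) auto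
        then have "\<bar>real_of_int (q $ i)\<bar> ^ M * cmod (\<gamma> k q) \<le> (2 * pi * \<bar>real_of_int (q $ i)\<bar>) ^ M * cmod (\<gamma> k q)"
          by (rule mult_right_mono) simp
        also have "\<dots> = cmod (fourier_coeff (iter_deriv (replicate M i) (\<lambda>y. G (k, y))) q)"
          by (simp add: coeff_deriv norm_mult norm_power)
        also have "\<dots> \<le> C i / weight k ^ M" by (intro coeff_bound C cont)
        finally show ?thesis .
      qed
      have "weight q ^ M * cmod (\<gamma> k q) \<le> D / weight k ^ M"
      proof (cases rule: weight_le_some_component[of q])
        case 1
        have "C0 \<le> D"
          using C0_nonneg mult_mono[of 1 "(1 + real CARD('n)) ^ M" C0 "C0 + (\<Sum>i\<in>UNIV. C i)"] C_nonneg
          by (simp add: D_def sum_nonneg)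
        then have "C0 / weight k ^ M \<le> D / weight k ^ M" by (intro divide_right_mono) (auto simp: less_imp_le)
        with 0 1 show ?thesis by simp
      next
        case (2 i)
        have "weight q ^ M * cmod (\<gamma> k q) \<le> ((1 + real CARD('n)) * \<bar>real_of_int (q $ i)\<bar>) ^ M * cmod (\<gamma> k q)"
          by (rule mult_right_mono[OF power_mono[OF 2]]) (auto simp: less_imp_le)
        also have "\<dots> = (1 + real CARD('n)) ^ M * (\<bar>real_of_int (q $ i)\<bar> ^ M * cmod (\<gamma> k q))"
          by (simp add: power_mult_distrib)
        also have "\<dots> \<le> (1 + real CARD('n)) ^ M * (C i / weight k ^ M)" by (intro mult_left_mono 1) auto
        also have "\<dots> \<le> D / weight k ^ M"
        proof -
          have "C i \<le> (\<Sum>i\<in>UNIV. C i)" by (intro member_le_sum C_nonneg) auto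
          then have "C i \<le> C0 + (\<Sum>i\<in>UNIV. C i)" using C0_nonneg by simp
          then have "(1 + real CARD('n)) ^ M * C i \<le> D" unfolding D_def by (intro mult_left_mono) auto
          then show ?thesis by (simp add: divide_right_mono less_imp_le)
        qed
        finally show ?thesis .
      qed
      then show ?thesis by (simp add: pos_le_divide_eq power_mult_distrib mult_ac)
    qed
    then show "\<exists>C. \<forall>k q. cmod (\<gamma> k q) \<le> C / (weight k * weight q) ^ M" by blast
  qed
  show "G = synthesis \<gamma>"
  proof
    fix z :: "(int ^ 'n) \<times> (real ^ 'n)"
    obtain k y where z: "z = (k, y)" by fastforce
    have "(\<lambda>y. G (k, y)) = fourier_series (fourier_coeff (\<lambda>y. G (k, y)))"
      using cont[of "[]" k] per[of "[]" k] schwartz_Z_summable[OF rapidly_decreasing_row[OF rapid, of k]]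
      by (intro fourier_inversion) (simp_all add: \<gamma>_def)
    then have "G (k, y) = fourier_series (\<gamma> k) y" unfolding \<gamma>_def by (rule fun_cong)
    then show "G z = synthesis \<gamma> z" by (simp add: z synthesis_def)
  qed
qed

section \<open>Representation by square-integrable functions\<close>

lemma ZT_integral_rows:
  fixes F :: "(int ^ 'n) \<times> (real ^ 'n) \<Rightarrow> complex"
  assumes F: "\<And>k. integrable torus (\<lambda>w. F (k, w))"
    and sum: "(\<lambda>k. \<integral>w. cmod (F (k, w)) \<partial>torus) summable_on UNIV"
  shows "integrable ZT F" and "((\<lambda>k. \<integral>w. F (k, w) \<partial>torus) has_sum (\<integral>z. F z \<partial>ZT)) UNIV"
proof -
  interpret C: sigma_finite_measure "count_space (UNIV :: (int ^ 'n) set)"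
    by (rule sigma_finite_measure_count_space_countable) simp
  interpret P: pair_sigma_finite "count_space (UNIV :: (int ^ 'n) set)" "torus :: (real ^ 'n) measure" ..
  have m: "F \<in> borel_measurable ZT"
    unfolding ZT_def by (rule measurable_pair_measure_countable1) (use F in auto)
  have I: "integrable (count_space UNIV \<Otimes>\<^sub>M torus) F"
  proof (rule P.Fubini_integrable)
    show "F \<in> borel_measurable (count_space UNIV \<Otimes>\<^sub>M torus)" using m by (simp add: ZT_def)
    show "integrable (count_space UNIV) (\<lambda>k. \<integral>w. norm (F (k, w)) \<partial>torus)"
      using sum abs_summable_equivalent[of "\<lambda>k. \<integral>w. norm (F (k, w)) \<partial>torus" UNIV]
      by (simp add: Infinite_Set_Sum.abs_summable_on_def)
  qed (use F in auto)
  show "integrable ZT F" using I by (simp add: ZT_def)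
  have "(\<lambda>k. norm (\<integral>w. F (k, w) \<partial>torus)) summable_on UNIV"
    using P.integrable_fst'[OF I] by (simp only: integrable_count_space_iff_summable_norm)
  then have "(\<lambda>k. \<integral>w. F (k, w) \<partial>torus) summable_on UNIV" by (rule abs_summable_summable)
  moreover have "(\<Sum>\<^sub>\<infinity>k. \<integral>w. F (k, w) \<partial>torus) = (\<integral>z. F z \<partial>ZT)"
    using P.integral_fst'[OF I] by (simp add: infsum_eq_integral_count_space ZT_def)
  ultimately show "((\<lambda>k. \<integral>w. F (k, w) \<partial>torus) has_sum (\<integral>z. F z \<partial>ZT)) UNIV"
    by (simp add: has_sum_iff)
qed

text \<open>Riesz-Fischer is applied in each row. Against a Schwartz function with coefficients
  \<open>a\<close>, the integral and the value of \<open>\<sigma>\<close> are both the double series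
  of \<open>a k q * c k q\<close>: the former row by row, the latter by
  \<open>tempered_ZT_synthesis_has_sum\<close>.\<close>

lemma represents_of_coefficients:
  fixes \<sigma> :: "((int ^ 'n) \<times> (real ^ 'n) \<Rightarrow> complex) \<Rightarrow> complex"
  assumes \<sigma>: "\<sigma> \<in> tempered_ZT"
    and c: "(\<lambda>(k, q). (cmod (\<sigma> (atom k q)))\<^sup>2) summable_on UNIV"
  obtains s where "represents s \<sigma>" "\<And>k. integrable torus (\<lambda>y. s (k, y))"
    "\<And>k. integrable torus (\<lambda>y. (cmod (s (k, y)))\<^sup>2)"
    "\<And>k q. (\<integral>y. s (k, y) * character q y \<partial>torus) = \<sigma> (atom k q)"
    "(\<lambda>k. \<integral>y. (cmod (s (k, y)))\<^sup>2 \<partial>torus) summable_on UNIV"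
proof -
  define c where "c k q = \<sigma> (atom k q)" for k q
  have c': "(\<lambda>(k, q). (cmod (c k q))\<^sup>2) summable_on (SIGMA k:UNIV. UNIV)" using c by (simp add: c_def)
  define E where "E k = (\<Sum>\<^sub>\<infinity>q. (cmod (c k q))\<^sup>2)" for k
  have E: "E summable_on UNIV" using summable_on_Sigma_banach[OF c'] by (simp add: E_def[abs_def])
  have E0: "E k \<ge> 0" for k by (simp add: E_def infsum_nonneg)
  have row: "(\<lambda>q. (cmod (c k q))\<^sup>2) summable_on UNIV" for k using summable_on_SigmaD1[OF c', of k] by simp
  \<comment> \<open>Riesz-Fischer prescribes integrals against conjugate characters, while
    \<open>\<sigma> (atom k q)\<close> must be the integral against \<open>character q\<close>
    itself; hence the reflection.\<close>
  have neg: "bij_betw uminus (UNIV :: (int ^ 'n) set) UNIV"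
    by (rule bij_betwI[where g = uminus]) auto
  have "\<exists>s. integrable torus s \<and> integrable torus (\<lambda>y. (cmod (s y))\<^sup>2) \<and>
      (\<integral>y. (cmod (s y))\<^sup>2 \<partial>torus) \<le> E k \<and> (\<forall>q. (\<integral>y. s y * character q y \<partial>torus) = c k q)" for k
  proof -
    have "(\<lambda>q. (cmod (c k (- q)))\<^sup>2) summable_on UNIV"
      using row[of k] summable_on_reindex_bij_betw[OF neg, of "\<lambda>q. (cmod (c k q))\<^sup>2"] by simp
    from characters.riesz_fischer[OF this] obtain s where s: "integrable torus s" "integrable torus (\<lambda>y. (cmod (s y))\<^sup>2)"
      "(\<integral>y. (cmod (s y))\<^sup>2 \<partial>torus) \<le> (\<Sum>\<^sub>\<infinity>q. (cmod (c k (- q)))\<^sup>2)"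
      "\<And>q. (\<integral>y. s y * cnj (character q y) \<partial>torus) = c k (- q)" by blast
    have Ek: "(\<Sum>\<^sub>\<infinity>q. (cmod (c k (- q)))\<^sup>2) = E k"
      using infsum_reindex_bij_betw[OF neg, of "\<lambda>q. (cmod (c k q))\<^sup>2"] by (simp add: E_def)
    have coeff: "(\<integral>y. s y * character q y \<partial>torus) = c k q" for q
      using s(4)[of "- q"] by (simp add: cnj_character)
    show ?thesis by (intro exI[of _ s] conjI allI s(1,2) coeff s(3)[unfolded Ek])
  qed
  then have "\<exists>s. \<forall>k. integrable torus (s k) \<and> integrable torus (\<lambda>y. (cmod (s k y))\<^sup>2) \<and>
      (\<integral>y. (cmod (s k y))\<^sup>2 \<partial>torus) \<le> E k \<and> (\<forall>q. (\<integral>y. s k y * character q y \<partial>torus) = c k q)"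
    by (intro choice allI)
  then obtain s where s: "\<And>k. integrable torus (s k)" "\<And>k. integrable torus (\<lambda>y. (cmod (s k y))\<^sup>2)"
      "\<And>k. (\<integral>y. (cmod (s k y))\<^sup>2 \<partial>torus) \<le> E k" "\<And>k q. (\<integral>y. s k y * character q y \<partial>torus) = c k q"
    by blast
  define T where "T = infsum E UNIV"
  \<comment> \<open>A crude bound that is uniform in the row, from 2x \<le> 1 + x^2; the decay in
    \<open>k\<close> will come from the Schwartz coefficients.\<close>
  have mean: "(\<integral>y. cmod (s k y) \<partial>torus) \<le> 1 + T" for k
  proof -
    have [measurable]: "s k \<in> borel_measurable torus" using s(1) by auto
    have "(\<integral>y. cmod (s k y) \<partial>torus)\<^sup>2 \<le> (\<integral>y. (cmod (s k y))\<^sup>2 \<partial>torus)"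
      by (rule torus.square_integral_le[OF _ s(2)]) simp
    also have "\<dots> \<le> T"
      using s(3)[of k] finite_sum_le_infsum[OF E, of "{k}"] E0 by (simp add: T_def)
    finally have le: "(\<integral>y. cmod (s k y) \<partial>torus)\<^sup>2 \<le> T" .
    have "2 * (\<integral>y. cmod (s k y) \<partial>torus) \<le> 1 + (\<integral>y. cmod (s k y) \<partial>torus)\<^sup>2"
      using sum_squares_bound[of 1 "\<integral>y. cmod (s k y) \<partial>torus"] by simp
    moreover have "0 \<le> (\<integral>y. cmod (s k y) \<partial>torus)" by (rule Bochner_Integration.integral_nonneg) simp
    ultimately show ?thesis using le by linarith
  qed
  have rep: "represents (\<lambda>(k, y). s k y) \<sigma>"
    unfolding represents_def
  proof (intro conjI ballI)
    show "(\<lambda>(k, y). s k y) \<in> borel_measurable ZT"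
      unfolding ZT_def by (rule measurable_pair_measure_countable1) (use s in auto)
    fix \<phi> :: "(int ^ 'n) \<times> (real ^ 'n) \<Rightarrow> complex" assume "\<phi> \<in> schwartz_ZT"
    then obtain a where a: "rapidly_decreasing a" "\<phi> = synthesis a" using schwartz_ZT_coeff by blast
    define F where "F = (\<lambda>z. (case z of (k, y) \<Rightarrow> s k y) * \<phi> z)"
    have F: "F (k, y) = s k y * (\<Sum>\<^sub>\<infinity>q. a k q * character q y)" for k y
      by (simp add: F_def a(2) synthesis_def fourier_series_def)
    note ak = schwartz_Z_summable[OF rapidly_decreasing_row[OF a(1)]]
    have int: "integrable torus (\<lambda>y. F (k, y))" for k
      unfolding F by (rule characters.integral_mult_series(2)[OF ak s(1)])
    obtain C where C: "\<And>k q. cmod (a k q) \<le> C / (weight k * weight q) ^ (2 * CARD('n))"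
      using a(1) unfolding rapidly_decreasing_def by blast
    define Z where "Z = (\<Sum>\<^sub>\<infinity>q :: int ^ 'n. 1 / weight q ^ (2 * CARD('n)))"
    have rowsum: "(\<Sum>\<^sub>\<infinity>q. cmod (a k q)) \<le> C * Z * (1 / weight k ^ (2 * CARD('n)))" for k
    proof -
      have "(\<Sum>\<^sub>\<infinity>q. cmod (a k q)) \<le> (\<Sum>\<^sub>\<infinity>q :: int ^ 'n. C / weight k ^ (2 * CARD('n)) * (1 / weight q ^ (2 * CARD('n))))"
      proof (rule infsum_mono[OF ak summable_on_cmult_right[OF summable_on_weight]])
        show "cmod (a k q) \<le> C / weight k ^ (2 * CARD('n)) * (1 / weight q ^ (2 * CARD('n)))" for q
          using C[of k q] by (simp add: power_mult_distrib)
      qed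
      also have "\<dots> = C / weight k ^ (2 * CARD('n)) * Z" unfolding Z_def by (rule infsum_cmult_right')
      finally show ?thesis by (simp add: mult_ac)
    qed
    have "(\<lambda>k. \<integral>y. cmod (F (k, y)) \<partial>torus) summable_on UNIV"
    proof (rule summable_on_comparison_test)
      show "(\<lambda>k :: int ^ 'n. (1 + T) * (C * Z * (1 / weight k ^ (2 * CARD('n))))) summable_on UNIV"
        by (intro summable_on_cmult_right summable_on_weight)
      fix k
      have "(\<integral>y. cmod (F (k, y)) \<partial>torus) \<le> (\<integral>y. cmod (s k y) * (\<Sum>\<^sub>\<infinity>q. cmod (a k q)) \<partial>torus)"
        using int s(1) characters.series_norm_le[OF ak]
        by (intro integral_mono integrable_norm integrable_mult_left) (auto simp: F norm_mult intro!: mult_left_mono)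
      also have "\<dots> = (\<integral>y. cmod (s k y) \<partial>torus) * (\<Sum>\<^sub>\<infinity>q. cmod (a k q))" by simp
      also have "\<dots> \<le> (1 + T) * (C * Z * (1 / weight k ^ (2 * CARD('n))))"
        using E0 by (intro mult_mono mean rowsum infsum_nonneg) (auto simp: T_def intro!: add_nonneg_nonneg infsum_nonneg)
      finally show "(\<integral>y. cmod (F (k, y)) \<partial>torus) \<le> (1 + T) * (C * Z * (1 / weight k ^ (2 * CARD('n))))" .
    qed simp
    note ZT = ZT_integral_rows[OF int this]
    show "integrable ZT (\<lambda>z. (case z of (k, y) \<Rightarrow> s k y) * \<phi> z)" using ZT(1) by (simp add: F_def)
    have dbl: "((\<lambda>(k, q). a k q * c k q) has_sum \<sigma> \<phi>) (SIGMA k:UNIV. UNIV)"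
      using tempered_ZT_synthesis_has_sum[OF \<sigma> a(1)] by (simp add: a(2) c_def)
    have inner: "((\<lambda>q. a k q * c k q) has_sum (\<integral>y. F (k, y) \<partial>torus)) UNIV" for k
      using characters.integral_mult_series(1)[OF ak s(1), of k k] by (simp add: F s(4))
    have "((\<lambda>k. \<integral>y. F (k, y) \<partial>torus) has_sum \<sigma> \<phi>) UNIV"
      by (rule has_sum_SigmaD[OF dbl]) (simp add: inner)
    then have "\<sigma> \<phi> = (\<integral>z. F z \<partial>ZT)" using ZT(2) by (rule has_sum_unique)
    then show "\<sigma> \<phi> = (\<integral>z. (case z of (k, y) \<Rightarrow> s k y) * \<phi> z \<partial>ZT)" by (simp add: F_def)
  qed
  have "(\<lambda>k. \<integral>y. (cmod (s k y))\<^sup>2 \<partial>torus) summable_on UNIV"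
    by (rule summable_on_comparison_test[OF E]) (use s(3) in auto)
  then show thesis
    by (intro that[OF rep]) (simp_all add: s c_def[symmetric])
qed

text \<open>This is 1 + a + b \<le> (1 + a)(1 + b) after the triangle inequality.
  Submultiplicativity keeps shifted arrays rapidly decreasing.\<close>

lemma weight_add_le: "weight (k + l) \<le> weight k * weight l"
proof -
  have "norm (ivec (k + l)) \<le> norm (ivec k) + norm (ivec l)" by (simp add: norm_triangle_ineq)
  moreover have "0 \<le> norm (ivec k) * norm (ivec l)" by simp
  ultimately show ?thesis unfolding weight_def by (simp only: distrib_left distrib_right mult_1_left mult_1_right)
qed

lemma weight_uminus [simp]: "weight (- k) = weight k"
  by (simp add: weight_def)

lemma rapidly_decreasing_translate:
  assumes \<gamma>: "rapidly_decreasing \<gamma>" and u: "\<And>k q. cmod (u k q) = 1"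
  shows "rapidly_decreasing (\<lambda>k r. u k r * cnj (\<gamma> (k - m) (- l - r)))"
  unfolding rapidly_decreasing_def
proof
  fix M :: nat
  obtain C where C: "\<And>k q. cmod (\<gamma> k q) \<le> C / (weight k * weight q) ^ M"
    using \<gamma> unfolding rapidly_decreasing_def by blast
  have C0: "C \<ge> 0" using order_trans[OF norm_ge_zero C[of 0 0]] by (simp add: weight_def)
  have "cmod (u k r * cnj (\<gamma> (k - m) (- l - r))) \<le> C * (weight m * weight l) ^ M / (weight k * weight r) ^ M" for k r
  proof -
    have "weight k \<le> weight (k - m) * weight m" using weight_add_le[of "k - m" m] by simp
    moreover have "weight r \<le> weight (- l - r) * weight l"
      using weight_add_le[of "- l - r" l] by simp
    ultimately have "weight k * weight r \<le> (weight (k - m) * weight m) * (weight (- l - r) * weight l)"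
      by (intro mult_mono) (auto simp: less_imp_le)
    then have "(weight k * weight r) ^ M \<le> ((weight (k - m) * weight (- l - r)) * (weight m * weight l)) ^ M"
      by (intro power_mono) (auto simp: mult_ac less_imp_le)
    then have "C * (weight k * weight r) ^ M \<le> C * ((weight (k - m) * weight (- l - r)) ^ M * (weight m * weight l) ^ M)"
      using C0 by (intro mult_left_mono) (auto simp: power_mult_distrib)
    then have "C / (weight (k - m) * weight (- l - r)) ^ M \<le> C * (weight m * weight l) ^ M / (weight k * weight r) ^ M"
      by (simp add: divide_le_eq pos_le_divide_eq mult_ac)
    with C[of "k - m" "- l - r"] show ?thesis by (simp add: norm_mult u)
  qed
  then show "\<exists>C. \<forall>k r. cmod (u k r * cnj (\<gamma> (k - m) (- l - r))) \<le> C / (weight k * weight r) ^ M" by blast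
qed

text \<open>Conjugation negates the frequencies of the window and the modulation shifts them by
  \<open>- l\<close>, so the frequency \<open>r\<close> of the result stems from
  \<open>- l - r\<close>. The parameters \<open>w\<close> and \<open>x\<close> survive only as
  unimodular phases of the coefficients; the shifted window is again a synthesis, on which
  \<open>\<sigma>\<close> acts term by term.\<close>

lemma cnj_tf_shift_synthesis:
  fixes \<gamma> :: "int ^ 'n \<Rightarrow> int ^ 'n \<Rightarrow> complex"
  shows "(\<lambda>a. cnj (tf_shift_ZT (m, w) (x, l) (synthesis \<gamma>) a))
    = synthesis (\<lambda>k r. (character (- k) x * character (- l - r) w) * cnj (\<gamma> (k - m) (- l - r)))"
proof
  fix z :: "(int ^ 'n) \<times> (real ^ 'n)"
  obtain k y where z: "z = (k, y)" by fastforce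
  have refl: "bij_betw (\<lambda>r. - l - r) (UNIV :: (int ^ 'n) set) UNIV"
    by (rule bij_betwI[where g = "\<lambda>r. - l - r"]) auto
  have phase: "cis (2 * pi * (x \<bullet> ivec k + ivec l \<bullet> y)) = character k x * character l y"
    by (simp add: character_def distrib_left cis_mult inner_commute)
  have "cnj (tf_shift_ZT (m, w) (x, l) (synthesis \<gamma>) z)
      = character (- k) x * character (- l) y * (\<Sum>\<^sub>\<infinity>q. cnj (\<gamma> (k - m) q) * character (- q) (y - w))"
    by (simp add: z tf_shift_ZT_def synthesis_def fourier_series_def phase cnj_character flip: infsum_cnj)
  also have "\<dots> = (\<Sum>\<^sub>\<infinity>r. character (- k) x * character (- l) y * (cnj (\<gamma> (k - m) (- l - r)) * character (- (- l - r)) (y - w)))"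
    unfolding infsum_reindex_bij_betw[OF refl, of "\<lambda>q. cnj (\<gamma> (k - m) q) * character (- q) (y - w)", symmetric]
    by (rule infsum_cmult_right'[symmetric])
  also have "\<dots> = (\<Sum>\<^sub>\<infinity>r. (character (- k) x * character (- l - r) w) * cnj (\<gamma> (k - m) (- l - r)) * character r y)"
  proof (rule infsum_cong)
    fix r
    have "character (- l) y * character (- (- l - r)) (y - w) = character (- l - r) w * character r y"
      by (simp add: character_def cis_mult inner_diff_left inner_add_left inner_diff_right algebra_simps)
    then show "character (- k) x * character (- l) y * (cnj (\<gamma> (k - m) (- l - r)) * character (- (- l - r)) (y - w))
        = (character (- k) x * character (- l - r) w) * cnj (\<gamma> (k - m) (- l - r)) * character r y"
      by (simp add: mult_ac) 
  qed
  finally show "cnj (tf_shift_ZT (m, w) (x, l) (synthesis \<gamma>) z)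
    = synthesis (\<lambda>k r. (character (- k) x * character (- l - r) w) * cnj (\<gamma> (k - m) (- l - r))) z"
    by (simp add: z synthesis_def fourier_series_def)
qed

section \<open>Modulation spaces and square-summability\<close>

text \<open>The phase in \<open>cnj_tf_shift_synthesis\<close>, with \<open>z = (w, x)\<close> and
  \<open>i = (k, - l - r)\<close>.\<close>

definition pair_character :: "(int ^ 'n) \<times> (int ^ 'n) \<Rightarrow> (real ^ 'n) \<times> (real ^ 'n) \<Rightarrow> complex" where
  "pair_character i z = character (- fst i) (snd z) * character (snd i) (fst z)"

interpretation torus2: pair_prob_space torus torus ..

interpretation pair_characters: unimodular_system "torus \<Otimes>\<^sub>M torus" pair_character
proof (unfold_locales)
  fix i j :: "(int ^ 'n) \<times> (int ^ 'n)"
  show meas: "pair_character i \<in> borel_measurable (torus \<Otimes>\<^sub>M torus)" for i :: "(int ^ 'n) \<times> (int ^ 'n)"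
    unfolding pair_character_def[abs_def] by measurable
  have 1: "integrable (torus \<Otimes>\<^sub>M torus) (\<lambda>z. pair_character i z * cnj (pair_character j z))"
  proof (rule torus2.P.integrable_const_bound[of _ 1])
    have "(\<lambda>z. cnj (pair_character j z)) \<in> borel_measurable (torus \<Otimes>\<^sub>M torus)"
      by (rule borel_measurable_continuous_on[where f = cnj, OF _ meas]) (intro continuous_intros)
    then show "(\<lambda>z. pair_character i z * cnj (pair_character j z)) \<in> borel_measurable (torus \<Otimes>\<^sub>M torus)"
      by (intro borel_measurable_times meas)
  qed (simp add: pair_character_def norm_mult)
  have "(\<integral>z. pair_character i z * cnj (pair_character j z) \<partial>(torus \<Otimes>\<^sub>M torus))
      = (\<integral>w. (\<integral>x. character (snd i - snd j) w * character (fst j - fst i) x \<partial>torus) \<partial>torus)"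
    unfolding torus2.integral_fst'[OF 1, symmetric]
    by (intro Bochner_Integration.integral_cong refl)
       (simp add: pair_character_def character_def cis_cnj cis_mult algebra_simps inner_diff_left)
  also have "\<dots> = (if i = j then 1 else 0)"
    by (auto simp: integral_character prod_eq_iff)
  finally show "(\<integral>z. pair_character i z * cnj (pair_character j z) \<partial>(torus \<Otimes>\<^sub>M torus)) = (if i = j then 1 else 0)" .
qed (simp add: pair_character_def norm_mult)

text \<open>Tonelli regroups the variables of the transform: the discrete pair outside, the pair
  ranging over a probability space inside. This is the shape that
  \<open>square_summable_mean\<close> asks for.\<close>

lemma nn_integral_ZT_dual_rearrange:
  fixes H :: "((int ^ 'n) \<times> (int ^ 'n)) \<times> ((real ^ 'n) \<times> (real ^ 'n)) \<Rightarrow> ennreal"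
  assumes H: "\<And>i. (\<lambda>z. H (i, z)) \<in> borel_measurable (torus \<Otimes>\<^sub>M torus)"
  shows "(\<integral>\<^sup>+i. (\<integral>\<^sup>+z. H (i, z) \<partial>(torus \<Otimes>\<^sub>M torus)) \<partial>count_space UNIV)
    = (\<integral>\<^sup>+((m, w), (x, l)). H ((m, l), (w, x)) \<partial>(ZT \<Otimes>\<^sub>M (torus \<Otimes>\<^sub>M count_space UNIV)))"
proof -
  let ?C = "count_space (UNIV :: (int ^ 'n) set)"
  let ?T = "torus :: (real ^ 'n) measure"
  interpret C: sigma_finite_measure ?C
    by (rule sigma_finite_measure_count_space_countable) simp
  interpret TC: pair_sigma_finite ?T ?C ..
  interpret CT: pair_sigma_finite ?C ?T ..
  have CC: "count_space UNIV = ?C \<Otimes>\<^sub>M ?C" by (simp add: pair_measure_countable)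
  have [measurable]: "H \<in> borel_measurable ((?C \<Otimes>\<^sub>M ?C) \<Otimes>\<^sub>M (?T \<Otimes>\<^sub>M ?T))"
    unfolding CC[symmetric] by (rule measurable_pair_measure_countable1[OF _ H]) simp
  have "(\<integral>\<^sup>+i. (\<integral>\<^sup>+z. H (i, z) \<partial>(?T \<Otimes>\<^sub>M ?T)) \<partial>count_space UNIV)
      = (\<integral>\<^sup>+m. (\<integral>\<^sup>+l. (\<integral>\<^sup>+z. H ((m, l), z) \<partial>(?T \<Otimes>\<^sub>M ?T)) \<partial>?C) \<partial>?C)"
    unfolding CC by (subst C.nn_integral_fst[symmetric]) simp_all
  also have "\<dots> = (\<integral>\<^sup>+m. (\<integral>\<^sup>+l. (\<integral>\<^sup>+w. (\<integral>\<^sup>+x. H ((m, l), (w, x)) \<partial>?T) \<partial>?T) \<partial>?C) \<partial>?C)"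
    by (subst torus.nn_integral_fst[symmetric]) simp_all
  also have "\<dots> = (\<integral>\<^sup>+m. (\<integral>\<^sup>+w. (\<integral>\<^sup>+l. (\<integral>\<^sup>+x. H ((m, l), (w, x)) \<partial>?T) \<partial>?C) \<partial>?T) \<partial>?C)"
    by (intro nn_integral_cong TC.Fubini') simp
  also have "\<dots> = (\<integral>\<^sup>+m. (\<integral>\<^sup>+w. (\<integral>\<^sup>+x. (\<integral>\<^sup>+l. H ((m, l), (w, x)) \<partial>?C) \<partial>?T) \<partial>?T) \<partial>?C)"
    by (intro nn_integral_cong TC.Fubini') simp
  also have "\<dots> = (\<integral>\<^sup>+m. (\<integral>\<^sup>+w. (\<integral>\<^sup>+\<zeta>. H ((m, snd \<zeta>), (w, fst \<zeta>)) \<partial>(?T \<Otimes>\<^sub>M ?C)) \<partial>?T) \<partial>?C)"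
    by (intro nn_integral_cong, subst C.nn_integral_fst[symmetric]) simp_all
  also have "\<dots> = (\<integral>\<^sup>+z. (\<integral>\<^sup>+\<zeta>. H ((fst z, snd \<zeta>), (snd z, fst \<zeta>)) \<partial>(?T \<Otimes>\<^sub>M ?C)) \<partial>(?C \<Otimes>\<^sub>M ?T))"
    by (subst torus.nn_integral_fst[symmetric]) simp_all
  also have "\<dots> = (\<integral>\<^sup>+u. H ((fst (fst u), snd (snd u)), (snd (fst u), fst (snd u))) \<partial>((?C \<Otimes>\<^sub>M ?T) \<Otimes>\<^sub>M (?T \<Otimes>\<^sub>M ?C)))"
    by (subst TC.P.nn_integral_fst[symmetric]) simp_all
  finally show ?thesis by (simp add: ZT_def case_prod_unfold)
qed

text \<open>Below 1 a larger exponent gives a smaller power, and \<open>p\<close> is at most 2;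
  above 1 the order is reversed, and \<open>p\<close> is at least 1.\<close>

lemma min_square_le_powr:
  fixes t p :: real
  assumes "t \<ge> 0" "1 \<le> p" "p \<le> 2"
  shows "min (t\<^sup>2) t \<le> t powr p"
proof (cases "t \<le> 1")
  case True
  have "t\<^sup>2 \<le> t powr p"
  proof (cases "t = 0")
    case False
    then have "t\<^sup>2 = t powr 2" using assms by (simp add: powr_numeral)
    also have "\<dots> \<le> t powr p" using False True assms by (intro powr_mono') auto
    finally show ?thesis .
  qed simp
  then show ?thesis by simp
next
  case False
  then have "t powr 1 \<le> t powr p" using assms by (intro powr_mono) auto
  then show ?thesis using False by simp
qed

text \<open>
  The coefficients of \<open>(w, x) \<mapsto> stft_ZT G \<sigma> (m, w) (x, l)\<close> in the characters of the square of the torus,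
  where \<open>\<gamma>\<close> are the Fourier coefficients of the window \<open>G\<close>.
\<close>

definition stft_coeff ::
  "(((int ^ 'n) \<times> (real ^ 'n) \<Rightarrow> complex) \<Rightarrow> complex) \<Rightarrow> (int ^ 'n \<Rightarrow> int ^ 'n \<Rightarrow> complex) \<Rightarrow>
   int ^ 'n \<Rightarrow> int ^ 'n \<Rightarrow> (int ^ 'n) \<times> (int ^ 'n) \<Rightarrow> complex" where
  "stft_coeff \<sigma> \<gamma> m l = (\<lambda>(k, q). cnj (\<gamma> (k - m) q) * \<sigma> (atom k (- l - q)))"

text \<open>After \<open>cnj_tf_shift_synthesis\<close> the functional acts term by term. The
  substitution of \<open>- l - r\<close> for the frequency puts all dependence on \<open>w\<close>
  and \<open>x\<close> into the pair character and leaves coefficients that depend only on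
  \<open>m\<close> and \<open>l\<close>.\<close>

lemma stft_ZT_pair_character_series:
  fixes \<gamma> :: "int ^ 'n \<Rightarrow> int ^ 'n \<Rightarrow> complex"
  assumes \<sigma>: "\<sigma> \<in> tempered_ZT" and \<gamma>: "rapidly_decreasing \<gamma>"
  shows "(\<lambda>i. cmod (stft_coeff \<sigma> \<gamma> m l i)) summable_on UNIV"
    and "stft_ZT (synthesis \<gamma>) \<sigma> (m, w) (x, l) = (\<Sum>\<^sub>\<infinity>i. stft_coeff \<sigma> \<gamma> m l i * pair_character i (w, x))"
proof -
  define b where "b = stft_coeff \<sigma> \<gamma>"
  define h :: "(int ^ 'n) \<times> (int ^ 'n) \<Rightarrow> _" where "h = (\<lambda>(k, r). (k, - l - r))"
  have h: "bij_betw h UNIV UNIV" by (rule bij_betwI[where g = h]) (auto simp: h_def)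
  have *: "((\<lambda>i. b m l i * pair_character i (w, x)) has_sum stft_ZT (synthesis \<gamma>) \<sigma> (m, w) (x, l)) UNIV" for w x
  proof -
    have "rapidly_decreasing (\<lambda>k r. (character (- k) x * character (- l - r) w) * cnj (\<gamma> (k - m) (- l - r)))"
      by (rule rapidly_decreasing_translate[OF \<gamma>]) (simp add: norm_mult)
    from tempered_ZT_synthesis_has_sum[OF \<sigma> this]
    have "((\<lambda>i. b m l (h i) * pair_character (h i) (w, x)) has_sum stft_ZT (synthesis \<gamma>) \<sigma> (m, w) (x, l)) UNIV"
      unfolding stft_ZT_def cnj_tf_shift_synthesis
      by (simp add: b_def stft_coeff_def h_def pair_character_def case_prod_unfold mult_ac)
    then show ?thesis
      by (simp add: has_sum_reindex_bij_betw[OF h, of "\<lambda>i. b m l i * pair_character i (w, x)"])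
  qed
  show "stft_ZT (synthesis \<gamma>) \<sigma> (m, w) (x, l) = (\<Sum>\<^sub>\<infinity>i. stft_coeff \<sigma> \<gamma> m l i * pair_character i (w, x))"
    using * unfolding b_def by (rule infsumI[symmetric])
  \<comment> \<open>Any point would do: pair characters have modulus 1, and summability of a complex
    family is absolute, so convergence at one point gives absolute summability of the
    coefficients.\<close>
  have "(\<lambda>i. b m l i * pair_character i (0, 0)) summable_on UNIV" using * by (rule has_sum_imp_summable)
  then have "(\<lambda>i. norm (b m l i * pair_character i (0, 0))) summable_on UNIV"
    by (simp only: summable_on_iff_abs_summable_on_complex)
  then show "(\<lambda>i. cmod (stft_coeff \<sigma> \<gamma> m l i)) summable_on UNIV"
    by (simp add: norm_mult pair_character_def b_def)
qed

text \<open>Fix an index with \<open>\<gamma> k0 q0\<close> nonzero. In the series for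
  \<open>(m, l)\<close> the coefficient at \<open>(m + k0, q0)\<close> is the constant
  \<open>cnj (\<gamma> k0 q0)\<close> times \<open>\<sigma> (atom (m + k0) (- l - q0))\<close>, and
  the mean of the modulus of the transform bounds it. As \<open>(m, l)\<close> varies, every atom is
  met exactly once.\<close>

lemma modulation_space_ZT_coefficients:
  fixes \<sigma> :: "((int ^ 'n) \<times> (real ^ 'n) \<Rightarrow> complex) \<Rightarrow> complex"
  assumes p: "1 \<le> p" "p \<le> 2" and G: "G \<in> schwartz_ZT" "G \<noteq> (\<lambda>_. 0)"
    and \<sigma>: "\<sigma> \<in> modulation_space_ZT G p"
  shows "(\<lambda>(k, q). (cmod (\<sigma> (atom k q)))\<^sup>2) summable_on UNIV"
proof -
  obtain \<gamma> where \<gamma>: "rapidly_decreasing \<gamma>" "G = synthesis \<gamma>" using schwartz_ZT_coeff[OF G(1)] by blast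
  have \<sigma>t: "\<sigma> \<in> tempered_ZT" using \<sigma> by (simp add: modulation_space_ZT_def)
  have "\<exists>k0 q0. \<gamma> k0 q0 \<noteq> 0"
  proof (rule ccontr)
    assume "\<not> ?thesis"
    then have "G = (\<lambda>_. 0)" by (auto simp: \<gamma>(2) synthesis_def fourier_series_def fun_eq_iff)
    with G show False by simp
  qed
  then obtain k0 q0 where \<gamma>0: "\<gamma> k0 q0 \<noteq> 0" by blast
  define b where "b = stft_coeff \<sigma> \<gamma>"
  note b = stft_ZT_pair_character_series[OF \<sigma>t \<gamma>(1), folded b_def]
  define V where "V i z = (\<Sum>\<^sub>\<infinity>j. b (fst i) (snd i) j * pair_character j z)" for i z
  have V_int: "integrable (torus \<Otimes>\<^sub>M torus) (V i)" for i
    unfolding V_def by (rule pair_characters.integrable_series[OF b(1)])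
  have [measurable]: "V i \<in> borel_measurable (torus \<Otimes>\<^sub>M torus)" for i using V_int by auto
  define H where "H = (\<lambda>(i, z). ennreal (min ((cmod (V i z))\<^sup>2) (cmod (V i z))))"
  have "(\<integral>\<^sup>+i. (\<integral>\<^sup>+z. ennreal (min ((cmod (V i z))\<^sup>2) (cmod (V i z))) \<partial>(torus \<Otimes>\<^sub>M torus)) \<partial>count_space UNIV)
      = (\<integral>\<^sup>+i. (\<integral>\<^sup>+z. H (i, z) \<partial>(torus \<Otimes>\<^sub>M torus)) \<partial>count_space UNIV)" by (simp add: H_def)
  also have "\<dots> = (\<integral>\<^sup>+((m, w), (x, l)). H ((m, l), (w, x)) \<partial>(ZT \<Otimes>\<^sub>M (torus \<Otimes>\<^sub>M count_space UNIV)))"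
    by (rule nn_integral_ZT_dual_rearrange) (simp add: H_def)
  also have "\<dots> \<le> (\<integral>\<^sup>+(z, \<zeta>). ennreal (cmod (stft_ZT G \<sigma> z \<zeta>) powr p) \<partial>(ZT \<Otimes>\<^sub>M (torus \<Otimes>\<^sub>M count_space UNIV)))"
  proof (rule nn_integral_mono, clarify)
    fix m l :: "int ^ 'n" and w x :: "real ^ 'n"
    have "stft_ZT G \<sigma> (m, w) (x, l) = V (m, l) (w, x)" unfolding \<gamma>(2) b(2) V_def by simp
    then show "H ((m, l), (w, x)) \<le> ennreal (cmod (stft_ZT G \<sigma> (m, w) (x, l)) powr p)"
      using min_square_le_powr[OF norm_ge_zero p] by (simp add: H_def ennreal_leI)
  qed
  also have "\<dots> < \<infinity>" using \<sigma> by (simp add: modulation_space_ZT_def)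
  finally have "(\<lambda>i. (\<integral>z. cmod (V i z) \<partial>(torus \<Otimes>\<^sub>M torus))\<^sup>2) summable_on UNIV"
    by (rule torus2.P.square_summable_mean[OF V_int])
  then have sum: "(\<lambda>i. (cmod (b (fst i) (snd i) (fst i + k0, q0)))\<^sup>2) summable_on UNIV"
    by (rule summable_on_comparison_test)
      (use pair_characters.coeff_norm_le[OF b(1)] in \<open>auto simp: V_def intro!: power_mono\<close>)
  \<comment> \<open>Solves \<open>m + k0 = k\<close> and \<open>- l - q0 = q\<close> for
    \<open>(m, l)\<close>.\<close>
  define h :: "(int ^ 'n) \<times> (int ^ 'n) \<Rightarrow> _" where "h = (\<lambda>(k, q). (k - k0, - q0 - q))"
  have h: "bij_betw h UNIV UNIV" by (rule bij_betwI[where g = "\<lambda>(m, l). (m + k0, - q0 - l)"]) (auto simp: h_def)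
  have "(\<lambda>i. (cmod (b (fst (h i)) (snd (h i)) (fst (h i) + k0, q0)))\<^sup>2) summable_on UNIV"
    using sum summable_on_reindex_bij_betw[OF h, of "\<lambda>i. (cmod (b (fst i) (snd i) (fst i + k0, q0)))\<^sup>2"] by simp
  then have "(\<lambda>(k, q). (cmod (\<gamma> k0 q0))\<^sup>2 * (cmod (\<sigma> (atom k q)))\<^sup>2) summable_on UNIV"
    by (simp add: h_def b_def stft_coeff_def case_prod_unfold norm_mult power_mult_distrib)
  then have "(\<lambda>i. (1 / (cmod (\<gamma> k0 q0))\<^sup>2) * (case i of (k, q) \<Rightarrow> (cmod (\<gamma> k0 q0))\<^sup>2 * (cmod (\<sigma> (atom k q)))\<^sup>2)) summable_on UNIV"
    by (rule summable_on_cmult_right)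
  then show ?thesis using \<gamma>0 by (simp add: case_prod_unfold)
qed

text \<open>Up to \<open>r\<close>, which is at most exp (- 2/3), the negative logarithm is at least
  2/3. Beyond \<open>r\<close>, convexity keeps \<open>\<Phi>\<close> above the line through the
  origin and its value at \<open>r\<close>, and the slope of that line is at least 2/3 r. Since r
  \<le> 1, this constant serves both ranges.\<close>

lemma young_function_lower_bound:
  assumes Y: "young_function \<Phi>" and r: "0 < r" "r \<le> exp (- 2/3)" and E: "entropy_like_upto r \<Phi>" and t: "t \<ge> 0"
  shows "ennreal (2/3 * r * min (t\<^sup>2) t) \<le> \<Phi> (ennreal t)"
proof -
  have r1: "r \<le> 1" using r(2) one_le_exp_iff[of "- 2/3 :: real"] by (meson exp_le_one_iff order_trans divide_nonpos_pos neg_le_0_iff_le zero_le_numeral zero_less_numeral)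
  have small: "\<Phi> (ennreal u) = ennreal (- (u\<^sup>2 * ln u)) \<and> 2/3 * u\<^sup>2 \<le> - (u\<^sup>2 * ln u)" if "0 < u" "u \<le> r" for u
  proof
    show "\<Phi> (ennreal u) = ennreal (- (u\<^sup>2 * ln u))" using E that by (simp add: entropy_like_upto_def)
    have "ln u \<le> ln (exp (- 2/3))" using that r by (subst ln_le_cancel_iff) auto
    then have "u\<^sup>2 * (2/3) \<le> u\<^sup>2 * (- ln u)" by (intro mult_left_mono) auto
    then show "2/3 * u\<^sup>2 \<le> - (u\<^sup>2 * ln u)" by simp
  qed
  consider "t = 0" | "0 < t" "t \<le> r" | "r < t" using t by linarith
  then show ?thesis
  proof cases
    case 1
    then show ?thesis by simp
  next
    case 2
    have "2/3 * r * min (t\<^sup>2) t \<le> 2/3 * 1 * t\<^sup>2" using r1 r 2 by (intro mult_mono) auto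
    also have "\<dots> \<le> - (t\<^sup>2 * ln t)" using small[OF 2] by simp
    finally show ?thesis using small[OF 2] by (simp add: ennreal_leI)
  next
    case 3
    \<comment> \<open>Convexity between \<open>0\<close> and \<open>t\<close> puts the point \<open>(r, \<Phi> r)\<close> below the chord.\<close>
    have q: "0 \<le> r / t" "r / t \<le> 1" using 3 r by (auto simp: divide_le_eq)
    have "\<Phi> (ennreal (r / t) * ennreal t + ennreal (1 - r / t) * 0) \<le> ennreal (r / t) * \<Phi> (ennreal t) + ennreal (1 - r / t) * \<Phi> 0"
      using Y q unfolding young_function_def by blast
    moreover have "ennreal (r / t) * ennreal t = ennreal r"
      using 3 r by (simp add: ennreal_mult[symmetric])
    moreover have "\<Phi> 0 = 0" using Y by (simp add: young_function_def)
    ultimately have "\<Phi> (ennreal r) \<le> ennreal (r / t) * \<Phi> (ennreal t)" by simp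
    then have "ennreal (t / r) * \<Phi> (ennreal r) \<le> ennreal (t / r) * (ennreal (r / t) * \<Phi> (ennreal t))"
      by (rule mult_left_mono) simp
    also have "\<dots> = \<Phi> (ennreal t)"
      using 3 r by (simp add: mult.assoc[symmetric] ennreal_mult[symmetric])
    finally have "ennreal (t / r) * \<Phi> (ennreal r) \<le> \<Phi> (ennreal t)" .
    moreover have "ennreal (2/3 * r * min (t\<^sup>2) t) \<le> ennreal (t / r) * \<Phi> (ennreal r)"
    proof -
      have "2/3 * r * min (t\<^sup>2) t \<le> 2/3 * r * t" using r by (intro mult_left_mono) auto
      also have "\<dots> = t / r * (2/3 * r\<^sup>2)" using r by (simp add: power2_eq_square)
      also have "\<dots> \<le> t / r * (- (r\<^sup>2 * ln r))" using small[of r] r 3 by (intro mult_left_mono) auto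
      finally have "ennreal (2/3 * r * min (t\<^sup>2) t) \<le> ennreal (t / r * (- (r\<^sup>2 * ln r)))" by (rule ennreal_leI)
      also have "\<dots> = ennreal (t / r) * ennreal (- (r\<^sup>2 * ln r))"
      proof (rule ennreal_mult)
        show "0 \<le> - (r\<^sup>2 * ln r)" using small[of r] r zero_le_power2[of r] by linarith
      qed (use r 3 in auto)
      also have "ennreal (- (r\<^sup>2 * ln r)) = \<Phi> (ennreal r)" using small[of r] r by simp
      finally show ?thesis .
    qed
    ultimately show ?thesis by (rule order_trans[rotated])
  qed
qed

text \<open>The lattice transform carries \<open>exp (- 2 \<pi> \<i> w \<bullet> k)\<close>, so it is a series in the reflected characters.\<close>

definition reflected_character :: "int ^ 'n \<Rightarrow> real ^ 'n \<Rightarrow> complex" where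
  "reflected_character k = character (- k)"

interpretation reflected: unimodular_system torus reflected_character
  by unfold_locales
     (auto simp: reflected_character_def cnj_character character_add[symmetric] integral_character)

lemma stft_eq_series:
  "stft g f m w = (\<Sum>\<^sub>\<infinity>k. (f k * cnj (g (k - m))) * reflected_character k w)"
  by (simp add: stft_def modulate_def translate_def reflected_character_def character_def cis_cnj mult_ac inner_commute)

lemma schwartz_Z_translate_cnj:
  assumes "g \<in> schwartz_Z" shows "(\<lambda>k. cnj (g (k - m))) \<in> schwartz_Z"
  unfolding schwartz_Z_weight
proof
  fix M
  obtain C where C: "\<And>k. cmod (g k) \<le> C / weight k ^ M" using assms unfolding schwartz_Z_weight by blast
  have C0: "C \<ge> 0" using order_trans[OF norm_ge_zero C[of 0]] by (simp add: weight_def)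
  have "cmod (cnj (g (k - m))) \<le> C * weight m ^ M / weight k ^ M" for k
  proof -
    have "weight k ^ M \<le> (weight (k - m) * weight m) ^ M"
      using weight_add_le[of "k - m" m] by (intro power_mono) (auto simp: less_imp_le)
    then have "C * weight k ^ M \<le> C * (weight (k - m) ^ M * weight m ^ M)"
      using C0 by (intro mult_left_mono) (auto simp: power_mult_distrib)
    then have "C / weight (k - m) ^ M \<le> C * weight m ^ M / weight k ^ M"
      by (simp add: divide_le_eq pos_le_divide_eq mult_ac)
    with C[of "k - m"] show ?thesis by simp
  qed
  then show "\<exists>C. \<forall>k. cmod (cnj (g (k - m))) \<le> C / weight k ^ M" by blast
qed

text \<open>The scheme of \<open>modulation_space_ZT_coefficients\<close> on the lattice alone.
  Divided by an admissible \<open>b\<close> of the Orlicz norm, the transform at \<open>m\<close> is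
  a series with coefficients \<open>u m k\<close>; with \<open>g0 k0\<close> nonzero, the one at
  \<open>k = m + k0\<close> is \<open>g (m + k0)\<close> times a fixed nonzero number.\<close>

lemma orlicz_modulation_space_subset_ell2:
  fixes g g0 :: "int ^ 'n \<Rightarrow> complex"
  assumes Y: "young_function \<Phi>" and r: "0 < r" "r \<le> exp (- 2/3)" and E: "entropy_like_upto r \<Phi>"
    and g0: "g0 \<in> schwartz_Z" "g0 \<noteq> (\<lambda>_. 0)" and g: "g \<in> orlicz_modulation_space g0 \<Phi>"
  shows "g \<in> ell2"
proof -
  obtain k0 where k0: "g0 k0 \<noteq> 0" using g0(2) by auto
  have "orlicz_norm \<Phi> (\<lambda>(m, w). stft g0 g m w) < \<infinity>" using g by (simp add: orlicz_modulation_space_def)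
  then obtain b where b: "b > 0" "(\<integral>\<^sup>+z. \<Phi> (ennreal (cmod (case z of (m, w) \<Rightarrow> stft g0 g m w) / b)) \<partial>ZT) \<le> 1"
    unfolding orlicz_norm_def Inf_less_iff by auto
  define u where "u m k = (g k * cnj (g0 (k - m))) / of_real b" for m k
  have u: "(\<lambda>k. cmod (u m k)) summable_on UNIV" for m
  proof -
    \<comment> \<open>Temperedness includes summability against every Schwartz function, here the
      conjugate of a translated window.\<close>
    have "(\<lambda>k. g k * cnj (g0 (k - m))) summable_on UNIV"
      using g schwartz_Z_translate_cnj[OF g0(1)] by (auto simp: orlicz_modulation_space_def tempered_Z_def)
    then have "(\<lambda>k. (1 / of_real b) * (g k * cnj (g0 (k - m)))) summable_on UNIV" by (rule summable_on_cmult_right)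
    then show ?thesis
      unfolding summable_on_iff_abs_summable_on_complex by (simp add: u_def)
  qed
  define V where "V m w = (\<Sum>\<^sub>\<infinity>k. u m k * reflected_character k w)" for m w
  have V: "V m w = stft g0 g m w / of_real b" for m w
    unfolding V_def stft_eq_series u_def divide_inverse
    by (subst infsum_cmult_left'[symmetric]) (simp add: mult_ac)
  have V_int: "integrable torus (V m)" for m
    unfolding V_def by (rule reflected.integrable_series[OF u])
  have [measurable]: "V m \<in> borel_measurable torus" for m using V_int by auto
  define H where "H = (\<lambda>(m, w). ennreal (min ((cmod (V m w))\<^sup>2) (cmod (V m w))))"
  have [measurable]: "H \<in> borel_measurable (count_space UNIV \<Otimes>\<^sub>M torus)"
    by (rule measurable_pair_measure_countable1) (simp_all add: H_def)
  have "ennreal (2/3 * r) * (\<integral>\<^sup>+z. H z \<partial>ZT) = (\<integral>\<^sup>+z. ennreal (2/3 * r) * H z \<partial>ZT)"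
    by (rule nn_integral_cmult[symmetric]) (simp add: ZT_def)
  also have "\<dots> \<le> (\<integral>\<^sup>+z. \<Phi> (ennreal (cmod (case z of (m, w) \<Rightarrow> stft g0 g m w) / b)) \<partial>ZT)"
  proof (rule nn_integral_mono)
    fix z :: "(int ^ 'n) \<times> (real ^ 'n)"
    obtain m w where z: "z = (m, w)" by fastforce
    have "ennreal (2/3 * r) * H z = ennreal (2/3 * r * min ((cmod (V m w))\<^sup>2) (cmod (V m w)))"
      using r by (simp add: H_def z ennreal_mult[symmetric])
    also have "\<dots> \<le> \<Phi> (ennreal (cmod (V m w)))" by (rule young_function_lower_bound[OF Y r E]) simp
    finally show "ennreal (2/3 * r) * H z \<le> \<Phi> (ennreal (cmod (case z of (m, w) \<Rightarrow> stft g0 g m w) / b))"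
      using b by (simp add: z V norm_divide)
  qed
  also have "\<dots> < \<infinity>" using b(2) by (rule le_less_trans) simp
  finally have "(\<integral>\<^sup>+z. H z \<partial>ZT) < \<infinity>" using r by (auto simp: ennreal_mult_less_top)
  moreover have "(\<integral>\<^sup>+z. H z \<partial>ZT) = (\<integral>\<^sup>+m. (\<integral>\<^sup>+w. ennreal (min ((cmod (V m w))\<^sup>2) (cmod (V m w))) \<partial>torus) \<partial>count_space UNIV)"
    unfolding ZT_def by (subst torus.nn_integral_fst[symmetric]) (simp_all add: H_def)
  ultimately have "(\<lambda>m. (\<integral>w. cmod (V m w) \<partial>torus)\<^sup>2) summable_on UNIV"
    by (intro torus.square_summable_mean[OF V_int]) simp
  then have sum: "(\<lambda>m. (cmod (u m (m + k0)))\<^sup>2) summable_on UNIV"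
    by (rule summable_on_comparison_test) (use reflected.coeff_norm_le[OF u] in \<open>auto simp: V_def intro!: power_mono\<close>)
  have h: "bij_betw (\<lambda>k. k - k0) (UNIV :: (int ^ 'n) set) UNIV" by (rule bij_betwI[where g = "\<lambda>m. m + k0"]) auto
  have "(\<lambda>k. (cmod (u (k - k0) k))\<^sup>2) summable_on UNIV"
    using sum summable_on_reindex_bij_betw[OF h, of "\<lambda>m. (cmod (u m (m + k0)))\<^sup>2"] by simp
  then have "(\<lambda>k. (b / cmod (g0 k0))\<^sup>2 * (cmod (u (k - k0) k))\<^sup>2) summable_on UNIV" by (rule summable_on_cmult_right)
  then show ?thesis
    using b k0 by (simp add: ell2_def u_def norm_mult norm_divide power_mult_distrib power_divide)
qed

section \<open>The kernel of the localization operator\<close>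

lemma ell2_reindex:
  assumes "f \<in> ell2" "bij h"
  shows "(\<lambda>m. f (h m)) \<in> ell2" and "ell2_dist (\<lambda>m. f (h m)) (\<lambda>_. 0) = ell2_dist f (\<lambda>_. 0)"
  using assms summable_on_reindex_bij_betw[of h UNIV UNIV "\<lambda>k. (cmod (f k))\<^sup>2"]
    infsum_reindex_bij_betw[of h UNIV UNIV "\<lambda>k. (cmod (f k))\<^sup>2"]
  by (simp_all add: ell2_def ell2_dist_def)

lemma bij_group_shifts: "bij (\<lambda>m. k - m)" "bij (\<lambda>m. m - k)" "bij (\<lambda>m. m + k)" for k :: "'a :: ab_group_add"
proof -
  show "bij (\<lambda>m. k - m)" by (rule bij_betwI[where g = "\<lambda>m. k - m"]) auto
  show "bij (\<lambda>m. m - k)" by (rule bij_betwI[where g = "\<lambda>m. m + k"]) auto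
  show "bij (\<lambda>m. m + k)" by (rule bij_betwI[where g = "\<lambda>m. m - k"]) auto
qed

text \<open>What remains is a statement about square-summable arrays on an abelian group. In the
  application \<open>c m q\<close> is the integral of the row \<open>m\<close> of the symbol against
  \<open>character q\<close>.\<close>

locale localization_kernel =
  fixes c :: "'a :: ab_group_add \<Rightarrow> 'a \<Rightarrow> complex" and g1 g2 :: "'a \<Rightarrow> complex"
  assumes c: "(\<lambda>(m, q). (cmod (c m q))\<^sup>2) summable_on UNIV"
    and g1: "g1 \<in> ell2" and g2: "g2 \<in> ell2"
begin

definition kernel :: "'a \<Rightarrow> 'a \<Rightarrow> complex" where
  "kernel j k = (\<Sum>\<^sub>\<infinity>m. c m (j - k) * cnj (g1 (k - m)) * g2 (j - m))"

text \<open>The majorant obtained from moduli. Its square-summability both bounds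
  \<open>kernel\<close> and supplies the absolute convergence behind the interchanges in
  \<open>kernel_weak_form\<close>.\<close>

definition abs_kernel :: "'a \<Rightarrow> 'a \<Rightarrow> real" where
  "abs_kernel j k = (\<Sum>\<^sub>\<infinity>m. cmod (c m (j - k)) * (cmod (g1 (k - m)) * cmod (g2 (j - m))))"

definition A :: real where "A = ell2_dist g1 (\<lambda>_. 0) * ell2_dist g2 (\<lambda>_. 0)"

lemma window_product:
  assumes "bij h1" "bij h2"
  shows "(\<lambda>m. cmod (g1 (h1 m)) * cmod (g2 (h2 m))) summable_on UNIV"
    and "(\<Sum>\<^sub>\<infinity>m. cmod (g1 (h1 m)) * cmod (g2 (h2 m))) \<le> A"
  using ell2_mult_abs_summable[OF ell2_reindex(1)[OF g1 assms(1)] ell2_reindex(1)[OF g2 assms(2)]]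
    ell2_mult_abs_infsum_le[OF ell2_reindex(1)[OF g1 assms(1)] ell2_reindex(1)[OF g2 assms(2)]]
  by (simp_all add: A_def ell2_reindex(2)[OF g1 assms(1)] ell2_reindex(2)[OF g2 assms(2)])

text \<open>
  Cauchy-Schwarz must split the windows symmetrically, as \<open>|c| \<surd>|g1 g2| \<cdot> \<surd>|g1 g2|\<close>: with
  \<open>|c| \<cdot> |g1 g2|\<close> the bound would not be summable along the diagonals \<open>j - k = q\<close>.
\<close>

lemma weighted_square_summable:
  "(\<lambda>((j, k), m). (cmod (c m (j - k)))\<^sup>2 * (cmod (g1 (k - m)) * cmod (g2 (j - m)))) summable_on UNIV"
proof -
  \<comment> \<open>In the coordinates \<open>((m, q), k)\<close> with \<open>q = j - k\<close>, the
    argument \<open>j - m\<close> reads \<open>k + (q - m)\<close>. For fixed \<open>(m, q)\<close>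
    the sum over \<open>k\<close> of the window product is at most \<open>A\<close>, which leaves
    the summable squares of \<open>c\<close>.\<close>
  define f where "f = (\<lambda>((m, q), k). (cmod (c m q))\<^sup>2 * (cmod (g1 (k - m)) * cmod (g2 (k + (q - m)))))"
  have "f summable_on (SIGMA i:UNIV. UNIV)"
  proof (rule summable_on_SigmaI)
    fix i :: "'a \<times> 'a"
    obtain m q where i: "i = (m, q)" by fastforce
    have "((\<lambda>k. cmod (g1 (k - m)) * cmod (g2 (k + (q - m)))) has_sum
        (\<Sum>\<^sub>\<infinity>k. cmod (g1 (k - m)) * cmod (g2 (k + (q - m))))) UNIV"
      by (rule has_sum_infsum[OF window_product(1)[OF bij_group_shifts(2,3)]])
    then show "((\<lambda>k. f (i, k)) has_sum
        (case i of (m, q) \<Rightarrow> (cmod (c m q))\<^sup>2 * (\<Sum>\<^sub>\<infinity>k. cmod (g1 (k - m)) * cmod (g2 (k + (q - m)))))) UNIV"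
      by (simp add: f_def i has_sum_cmult_right)
  next
    show "(\<lambda>(m, q). (cmod (c m q))\<^sup>2 * (\<Sum>\<^sub>\<infinity>k. cmod (g1 (k - m)) * cmod (g2 (k + (q - m))))) summable_on UNIV"
    proof (rule summable_on_comparison_test)
      show "(\<lambda>i. (case i of (m, q) \<Rightarrow> (cmod (c m q))\<^sup>2) * A) summable_on UNIV"
        by (rule summable_on_cmult_left[OF c])
    qed (auto intro!: mult_left_mono mult_nonneg_nonneg infsum_nonneg window_product(2)[OF bij_group_shifts(2,3)])
  qed (auto simp: f_def)
  then have f: "f summable_on UNIV" by simp
  define h :: "('a \<times> 'a) \<times> 'a \<Rightarrow> ('a \<times> 'a) \<times> 'a" where "h = (\<lambda>((j, k), m). ((m, j - k), k))"
  have "bij h" by (rule bij_betwI[where g = "\<lambda>((m, q), k). ((k + q, k), m)"]) (auto simp: h_def)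
  then have "(\<lambda>x. f (h x)) summable_on UNIV" using f by (simp add: summable_on_reindex_bij_betw)
  then show ?thesis by (simp add: f_def h_def case_prod_unfold)
qed

lemma abs_kernel_summable:
  "(\<lambda>m. cmod (c m (j - k)) * (cmod (g1 (k - m)) * cmod (g2 (j - m)))) summable_on UNIV" (is ?sum)
  and abs_kernel_square_le: "(abs_kernel j k)\<^sup>2
    \<le> (\<Sum>\<^sub>\<infinity>m. (cmod (c m (j - k)))\<^sup>2 * (cmod (g1 (k - m)) * cmod (g2 (j - m)))) * A" (is ?le)
proof -
  define v where "v m = sqrt (cmod (g1 (k - m)) * cmod (g2 (j - m)))" for m
  have v2: "(v m)\<^sup>2 = cmod (g1 (k - m)) * cmod (g2 (j - m))" for m by (simp add: v_def)
  have v: "(\<lambda>m. (v m)\<^sup>2) summable_on UNIV" "(\<Sum>\<^sub>\<infinity>m. (v m)\<^sup>2) \<le> A"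
    unfolding v2 by (rule window_product[OF bij_group_shifts(1,1)])+
  have "(\<lambda>(i, m). (case i of (j, k) \<Rightarrow> \<lambda>m. (cmod (c m (j - k)))\<^sup>2 * (cmod (g1 (k - m)) * cmod (g2 (j - m)))) m)
      summable_on (SIGMA i:UNIV. UNIV)"
    using weighted_square_summable by (simp add: case_prod_unfold)
  from summable_on_SigmaD1[OF this, of "(j, k)"]
  have u: "(\<lambda>m. (cmod (c m (j - k)) * v m)\<^sup>2) summable_on UNIV"
    by (simp add: power_mult_distrib v2)
  have eq: "cmod (c m (j - k)) * v m * v m = cmod (c m (j - k)) * (cmod (g1 (k - m)) * cmod (g2 (j - m)))" for m
    using v2[of m] by (simp add: power2_eq_square mult.assoc)
  show ?sum using cauchy_schwarz_infsum(1)[OF u v(1)] unfolding eq .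
  have "(abs_kernel j k)\<^sup>2 \<le> (\<Sum>\<^sub>\<infinity>m. (cmod (c m (j - k)) * v m)\<^sup>2) * (\<Sum>\<^sub>\<infinity>m. (v m)\<^sup>2)"
    using cauchy_schwarz_infsum(2)[OF u v(1)] unfolding eq abs_kernel_def .
  also have "\<dots> \<le> (\<Sum>\<^sub>\<infinity>m. (cmod (c m (j - k)) * v m)\<^sup>2) * A"
    by (intro mult_left_mono v infsum_nonneg) auto
  finally show ?le by (simp add: power_mult_distrib v2)
qed

lemma abs_kernel_hilbert_schmidt: "(\<lambda>(j, k). (abs_kernel j k)\<^sup>2) summable_on UNIV"
proof -
  have "(\<lambda>(i, m). (case i of (j, k) \<Rightarrow> \<lambda>m. (cmod (c m (j - k)))\<^sup>2 * (cmod (g1 (k - m)) * cmod (g2 (j - m)))) m)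
      summable_on (SIGMA i:UNIV. UNIV)"
    using weighted_square_summable by (simp add: case_prod_unfold)
  from summable_on_cmult_left[OF summable_on_Sigma_banach[OF this], of A]
  show ?thesis
    by (rule summable_on_comparison_test) (auto intro: order_trans[OF abs_kernel_square_le] simp: mult.commute)
qed

lemma kernel_norm_le: "cmod (kernel j k) \<le> abs_kernel j k"
  using norm_infsum_bound[of "\<lambda>m. c m (j - k) * cnj (g1 (k - m)) * g2 (j - m)" UNIV] abs_kernel_summable[of j k]
  by (simp add: kernel_def abs_kernel_def norm_mult mult.assoc)

lemma kernel_hilbert_schmidt: "(\<lambda>(j, k). (cmod (kernel j k))\<^sup>2) summable_on UNIV"
  by (rule summable_on_comparison_test[OF abs_kernel_hilbert_schmidt])
    (auto intro!: power_mono kernel_norm_le)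

text \<open>The sum over \<open>m\<close> is \<open>cmod (h j) * cmod (f k)\<close> times
  \<open>abs_kernel j k\<close>, a product of two square-summable functions of the pair
  \<open>(j, k)\<close>.\<close>

lemma triple_abs_summable:
  assumes f: "f \<in> ell2" and h: "h \<in> ell2"
  shows "(\<lambda>((j, k), m). cmod (f k * cnj (g1 (k - m)) * (cnj (h j) * g2 (j - m)) * c m (j - k))) summable_on UNIV"
proof -
  let ?F = "\<lambda>((j, k), m). cmod (f k * cnj (g1 (k - m)) * (cnj (h j) * g2 (j - m)) * c m (j - k))"
  have "(\<lambda>(j, k). (cmod (h j))\<^sup>2 * (cmod (f k))\<^sup>2) summable_on (SIGMA j:UNIV. UNIV)"
  proof (rule summable_on_SigmaI)
    show "((\<lambda>k. case (j, k) of (j, k) \<Rightarrow> (cmod (h j))\<^sup>2 * (cmod (f k))\<^sup>2) has_sum (cmod (h j))\<^sup>2 * (\<Sum>\<^sub>\<infinity>k. (cmod (f k))\<^sup>2)) UNIV" for j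
      using f by (simp add: has_sum_cmult_right ell2_def)
    show "(\<lambda>j. (cmod (h j))\<^sup>2 * (\<Sum>\<^sub>\<infinity>k. (cmod (f k))\<^sup>2)) summable_on UNIV"
      using h by (intro summable_on_cmult_left) (simp add: ell2_def)
  qed auto
  then have "(\<lambda>i. (case i of (j, k) \<Rightarrow> cmod (h j) * cmod (f k))\<^sup>2) summable_on UNIV"
    by (simp add: case_prod_unfold power_mult_distrib)
  moreover have "(\<lambda>i. (case i of (j, k) \<Rightarrow> abs_kernel j k)\<^sup>2) summable_on UNIV"
    using abs_kernel_hilbert_schmidt by (simp add: case_prod_unfold)
  ultimately have "(\<lambda>i. (case i of (j, k) \<Rightarrow> cmod (h j) * cmod (f k)) * (case i of (j, k) \<Rightarrow> abs_kernel j k)) summable_on UNIV"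
    by (rule cauchy_schwarz_infsum(1))
  then have "?F summable_on (SIGMA i:UNIV. UNIV)"
  proof (rule summable_on_SigmaI[rotated])
    fix i :: "'a \<times> 'a"
    obtain j k where i: "i = (j, k)" by fastforce
    have "((\<lambda>m. cmod (h j) * cmod (f k) * (cmod (c m (j - k)) * (cmod (g1 (k - m)) * cmod (g2 (j - m))))) has_sum
        (cmod (h j) * cmod (f k) * abs_kernel j k)) UNIV"
      unfolding abs_kernel_def by (intro has_sum_cmult_right has_sum_infsum abs_kernel_summable)
    then show "((\<lambda>m. ?F (i, m)) has_sum (case i of (j, k) \<Rightarrow> cmod (h j) * cmod (f k)) * (case i of (j, k) \<Rightarrow> abs_kernel j k)) UNIV"
      by (simp add: i norm_mult mult_ac)
  qed auto
  then show ?thesis by simp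
qed

text \<open>Fubini for one triple sum in two groupings: with \<open>m\<close> innermost it produces
  the kernel, with \<open>m\<close> outermost the order in which the integral over \<open>ZT\<close>
  is computed row by row.\<close>

lemma kernel_weak_form:
  assumes f: "f \<in> ell2" and h: "h \<in> ell2"
  shows "ell2_inner (\<lambda>j. \<Sum>\<^sub>\<infinity>k. kernel j k * f k) h
    = (\<Sum>\<^sub>\<infinity>m. \<Sum>\<^sub>\<infinity>k. \<Sum>\<^sub>\<infinity>j. f k * cnj (g1 (k - m)) * (cnj (h j) * g2 (j - m)) * c m (j - k))"
proof -
  define t where "t = (\<lambda>((j, k), m). f k * cnj (g1 (k - m)) * (cnj (h j) * g2 (j - m)) * c m (j - k))"
  have "(\<lambda>x. norm (t x)) summable_on UNIV"
    using triple_abs_summable[OF assms] by (simp add: t_def case_prod_unfold)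
  then have t: "t summable_on (UNIV \<times> UNIV) \<times> UNIV" using abs_summable_summable by simp
  have "infsum t ((UNIV \<times> UNIV) \<times> UNIV) = (\<Sum>\<^sub>\<infinity>i\<in>UNIV \<times> UNIV. \<Sum>\<^sub>\<infinity>m. t (i, m))"
    by (rule infsum_Sigma_banach[OF t, symmetric])
  also have "\<dots> = (\<Sum>\<^sub>\<infinity>(j, k)\<in>UNIV \<times> UNIV. f k * cnj (h j) * kernel j k)"
  proof (rule infsum_cong)
    fix i :: "'a \<times> 'a"
    obtain j k where i: "i = (j, k)" by fastforce
    have "(\<Sum>\<^sub>\<infinity>m. t (i, m)) = (\<Sum>\<^sub>\<infinity>m. f k * cnj (h j) * (c m (j - k) * cnj (g1 (k - m)) * g2 (j - m)))"
      by (simp add: t_def i mult_ac)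
    also have "\<dots> = f k * cnj (h j) * kernel j k" unfolding kernel_def by (rule infsum_cmult_right')
    finally show "(\<Sum>\<^sub>\<infinity>m. t (i, m)) = (case i of (j, k) \<Rightarrow> f k * cnj (h j) * kernel j k)" by (simp add: i)
  qed
  also have "\<dots> = (\<Sum>\<^sub>\<infinity>j. \<Sum>\<^sub>\<infinity>k. f k * cnj (h j) * kernel j k)"
  proof -
    have "(\<lambda>i. \<Sum>\<^sub>\<infinity>m. t (i, m)) summable_on UNIV \<times> UNIV"
      using summable_on_Sigma_banach[of "\<lambda>i m. t (i, m)" "UNIV \<times> UNIV" "\<lambda>_. UNIV"] t by (simp add: case_prod_eta)
    also have "(\<lambda>i. \<Sum>\<^sub>\<infinity>m. t (i, m)) = (\<lambda>(j, k). f k * cnj (h j) * kernel j k)"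
    proof
      fix i :: "'a \<times> 'a"
      obtain j k where i: "i = (j, k)" by fastforce
      show "(\<Sum>\<^sub>\<infinity>m. t (i, m)) = (case i of (j, k) \<Rightarrow> f k * cnj (h j) * kernel j k)"
        by (simp add: i t_def kernel_def mult_ac flip: infsum_cmult_right')
    qed
    finally show ?thesis by (rule infsum_Sigma'_banach[symmetric])
  qed
  also have "\<dots> = ell2_inner (\<lambda>j. \<Sum>\<^sub>\<infinity>k. kernel j k * f k) h"
    unfolding ell2_inner_def by (intro infsum_cong, subst infsum_cmult_left'[symmetric]) (simp add: mult_ac)
  finally have lhs: "infsum t UNIV = ell2_inner (\<lambda>j. \<Sum>\<^sub>\<infinity>k. kernel j k * f k) h" by simp
  define \<phi> :: "'a \<times> 'a \<times> 'a \<Rightarrow> ('a \<times> 'a) \<times> 'a" where "\<phi> = (\<lambda>(m, k, j). ((j, k), m))"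
  have \<phi>: "bij \<phi>" by (rule bij_betwI[where g = "\<lambda>((j, k), m). (m, k, j)"]) (auto simp: \<phi>_def)
  have s: "(\<lambda>x. t (\<phi> x)) summable_on UNIV \<times> UNIV \<times> UNIV" using t summable_on_reindex_bij_betw[OF \<phi>, of t] by simp
  have "infsum t UNIV = infsum (\<lambda>x. t (\<phi> x)) (UNIV \<times> UNIV \<times> UNIV)" using infsum_reindex_bij_betw[OF \<phi>, of t] by simp
  also have "\<dots> = (\<Sum>\<^sub>\<infinity>m. \<Sum>\<^sub>\<infinity>y\<in>UNIV \<times> UNIV. t (\<phi> (m, y)))"
    by (rule infsum_Sigma_banach[OF s, symmetric])
  also have "\<dots> = (\<Sum>\<^sub>\<infinity>m. \<Sum>\<^sub>\<infinity>k. \<Sum>\<^sub>\<infinity>j. t (\<phi> (m, k, j)))"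
  proof (rule infsum_cong)
    fix m
    have "(\<lambda>y. t (\<phi> (m, y))) summable_on UNIV \<times> UNIV"
      using summable_on_SigmaD1[of "\<lambda>m y. t (\<phi> (m, y))" UNIV "\<lambda>_. UNIV \<times> UNIV" m] s
      by (simp add: case_prod_unfold)
    then show "(\<Sum>\<^sub>\<infinity>y\<in>UNIV \<times> UNIV. t (\<phi> (m, y))) = (\<Sum>\<^sub>\<infinity>k. \<Sum>\<^sub>\<infinity>j. t (\<phi> (m, k, j)))"
      by (rule infsum_Sigma_banach[symmetric])
  qed
  finally show ?thesis using lhs by (simp add: t_def \<phi>_def)
qed

end

section \<open>The weak form of the localization operator\<close>

lemma ell2_shift_product_summable:
  fixes f g :: "'a :: ab_group_add \<Rightarrow> complex"
  assumes f: "f \<in> ell2" and g: "g \<in> ell2"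
  shows "(\<lambda>m. \<Sum>\<^sub>\<infinity>k. (cmod (f k * cnj (g (k - m))))\<^sup>2) summable_on UNIV"
proof -
  \<comment> \<open>Summed over \<open>m\<close> first, each \<open>k\<close> contributes the square
    of \<open>cmod (f k)\<close> times the squared norm of \<open>g\<close>, independent of
    \<open>k\<close>; the order is swapped afterwards.\<close>
  have "(\<lambda>(k, m). (cmod (f k * cnj (g (k - m))))\<^sup>2) summable_on (SIGMA k:UNIV. UNIV)"
  proof (rule summable_on_SigmaI)
    fix k
    note gk = ell2_reindex[OF g bij_group_shifts(1)[of k]]
    have "((\<lambda>m. (cmod (f k))\<^sup>2 * (cmod (g (k - m)))\<^sup>2) has_sum (cmod (f k))\<^sup>2 * (\<Sum>\<^sub>\<infinity>m. (cmod (g (k - m)))\<^sup>2)) UNIV"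
      using gk(1) by (intro has_sum_cmult_right has_sum_infsum) (simp add: ell2_def)
    moreover have "(\<Sum>\<^sub>\<infinity>m. (cmod (g (k - m)))\<^sup>2) = (\<Sum>\<^sub>\<infinity>m. (cmod (g m))\<^sup>2)"
      by (rule infsum_reindex_bij_betw[OF bij_group_shifts(1)])
    ultimately show "((\<lambda>m. case (k, m) of (k, m) \<Rightarrow> (cmod (f k * cnj (g (k - m))))\<^sup>2) has_sum
        (cmod (f k))\<^sup>2 * (\<Sum>\<^sub>\<infinity>m. (cmod (g m))\<^sup>2)) UNIV"
      by (simp add: norm_mult power_mult_distrib)
    show "(\<lambda>k. (cmod (f k))\<^sup>2 * (\<Sum>\<^sub>\<infinity>m. (cmod (g m))\<^sup>2)) summable_on UNIV"
      using f by (intro summable_on_cmult_left) (simp add: ell2_def)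
  qed auto
  then have "(\<lambda>(m, k). (cmod (f k * cnj (g (k - m))))\<^sup>2) summable_on (SIGMA m:UNIV. UNIV)"
    using summable_on_swap[of "\<lambda>(k, m). (cmod (f k * cnj (g (k - m))))\<^sup>2" UNIV UNIV] by simp
  then show ?thesis by (rule summable_on_Sigma_banach)
qed

text \<open>In row \<open>m\<close> both transforms are absolutely convergent character series, so
  the integral can be expanded twice; the characters of frequencies \<open>- k\<close> and
  \<open>j\<close> multiply to that of \<open>j - k\<close>, whose integral against the symbol is
  \<open>c m (j - k)\<close>. Across the rows \<open>W\<close> is bounded by \<open>B\<close>, and
  the symbol times \<open>V\<close> is dominated by the sum of their squared moduli, whose integrals
  are summable by Parseval.\<close>

lemma localization_weak_form:
  fixes s :: "(int ^ 'n) \<times> (real ^ 'n) \<Rightarrow> complex"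
  assumes s: "\<And>m. integrable torus (\<lambda>w. s (m, w))" "\<And>m. integrable torus (\<lambda>w. (cmod (s (m, w)))\<^sup>2)"
      "(\<lambda>m. \<integral>w. (cmod (s (m, w)))\<^sup>2 \<partial>torus) summable_on UNIV"
    and c: "\<And>m q. (\<integral>w. s (m, w) * character q w \<partial>torus) = c m q"
    and ell2: "f \<in> ell2" "h \<in> ell2" "g1 \<in> ell2" "g2 \<in> ell2"
  shows "integrable ZT (\<lambda>(m, w). s (m, w) * stft g1 f m w * cnj (stft g2 h m w))"
    and "(LINT (m, w)|ZT. s (m, w) * stft g1 f m w * cnj (stft g2 h m w))
      = (\<Sum>\<^sub>\<infinity>m. \<Sum>\<^sub>\<infinity>k. \<Sum>\<^sub>\<infinity>j. f k * cnj (g1 (k - m)) * (cnj (h j) * g2 (j - m)) * c m (j - k))"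
proof -
  define u where "u m k = f k * cnj (g1 (k - m))" for m k
  define v where "v m j = cnj (h j) * g2 (j - m)" for m j
  have u: "(\<lambda>k. cmod (u m k)) summable_on UNIV" for m
    using ell2_mult_abs_summable[OF ell2(1) ell2_reindex(1)[OF ell2(3) bij_group_shifts(2)[of m]]]
    by (simp add: u_def norm_mult)
  have v: "(\<lambda>j. cmod (v m j)) summable_on UNIV" for m
    using ell2_mult_abs_summable[OF ell2(2) ell2_reindex(1)[OF ell2(4) bij_group_shifts(2)[of m]]]
    by (simp add: v_def norm_mult)
  define V where "V m w = (\<Sum>\<^sub>\<infinity>k. u m k * reflected_character k w)" for m w
  define W where "W m w = (\<Sum>\<^sub>\<infinity>j. v m j * character j w)" for m w
  have V_eq: "stft g1 f m w = V m w" for m w by (simp add: stft_eq_series V_def u_def)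
  have W_eq: "cnj (stft g2 h m w) = W m w" for m w
    by (simp add: stft_eq_series W_def v_def reflected_character_def cnj_character flip: infsum_cnj)
  define B where "B = ell2_dist h (\<lambda>_. 0) * ell2_dist g2 (\<lambda>_. 0)"
  have B: "cmod (W m w) \<le> B" for m w
  proof -
    have "cmod (W m w) \<le> (\<Sum>\<^sub>\<infinity>j. cmod (v m j))" unfolding W_def by (rule characters.series_norm_le[OF v])
    also have "\<dots> \<le> B"
      using ell2_mult_abs_infsum_le[OF ell2(2) ell2_reindex(1)[OF ell2(4) bij_group_shifts(2)[of m]]]
      by (simp add: v_def norm_mult B_def ell2_reindex(2)[OF ell2(4) bij_group_shifts(2)])
    finally show ?thesis .
  qed
  have B0: "B \<ge> 0" using order_trans[OF norm_ge_zero B] .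
  define F where "F = (\<lambda>(m, w). s (m, w) * stft g1 f m w * cnj (stft g2 h m w))"
  have F: "F (m, w) = s (m, w) * W m w * V m w" for m w by (simp add: F_def V_eq W_eq mult_ac)
  have sW: "integrable torus (\<lambda>w. s (m, w) * W m w)" for m
    unfolding W_def by (rule characters.integral_mult_series(2)[OF v s(1)])
  have F_int: "integrable torus (\<lambda>w. F (m, w))" for m
    unfolding F V_def by (rule reflected.integral_mult_series(2)[OF u sW])
  have V2: "integrable torus (\<lambda>w. (cmod (V m w))\<^sup>2)"
      "(\<integral>w. (cmod (V m w))\<^sup>2 \<partial>torus) = (\<Sum>\<^sub>\<infinity>k. (cmod (u m k))\<^sup>2)" for m
    using reflected.parseval_series[OF u[of m]] by (simp_all add: V_def infsumI)
  have F_sum: "(\<lambda>m. \<integral>w. cmod (F (m, w)) \<partial>torus) summable_on UNIV"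
  proof (rule summable_on_comparison_test)
    show "(\<lambda>m. B * ((\<integral>w. (cmod (s (m, w)))\<^sup>2 \<partial>torus) + (\<Sum>\<^sub>\<infinity>k. (cmod (u m k))\<^sup>2))) summable_on UNIV"
      unfolding u_def
      by (intro summable_on_cmult_right summable_on_add s(3) ell2_shift_product_summable ell2)
    fix m
    have "(\<integral>w. cmod (F (m, w)) \<partial>torus) \<le> (\<integral>w. B * ((cmod (s (m, w)))\<^sup>2 + (cmod (V m w))\<^sup>2) \<partial>torus)"
    proof (rule integral_mono)
      fix w
      have "0 \<le> cmod (s (m, w)) * cmod (V m w)" by simp
      then have "cmod (s (m, w)) * cmod (V m w) \<le> (cmod (s (m, w)))\<^sup>2 + (cmod (V m w))\<^sup>2"
        using sum_squares_bound[of "cmod (s (m, w))" "cmod (V m w)"] by linarith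
      then have "cmod (W m w) * (cmod (s (m, w)) * cmod (V m w)) \<le> B * ((cmod (s (m, w)))\<^sup>2 + (cmod (V m w))\<^sup>2)"
        by (intro mult_mono B B0) auto
      then show "cmod (F (m, w)) \<le> B * ((cmod (s (m, w)))\<^sup>2 + (cmod (V m w))\<^sup>2)"
        by (simp add: F norm_mult mult_ac)
    qed (use F_int s(2) V2(1) in auto)
    also have "\<dots> = B * ((\<integral>w. (cmod (s (m, w)))\<^sup>2 \<partial>torus) + (\<Sum>\<^sub>\<infinity>k. (cmod (u m k))\<^sup>2))"
      using s(2) V2 by simp
    finally show "(\<integral>w. cmod (F (m, w)) \<partial>torus) \<le> B * ((\<integral>w. (cmod (s (m, w)))\<^sup>2 \<partial>torus) + (\<Sum>\<^sub>\<infinity>k. (cmod (u m k))\<^sup>2))" .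
  qed simp
  note ZT = ZT_integral_rows[OF F_int F_sum]
  show "integrable ZT (\<lambda>(m, w). s (m, w) * stft g1 f m w * cnj (stft g2 h m w))"
    using ZT(1) by (simp add: F_def)
  have row: "(\<integral>w. F (m, w) \<partial>torus) = (\<Sum>\<^sub>\<infinity>k. \<Sum>\<^sub>\<infinity>j. u m k * v m j * c m (j - k))" for m
  proof -
    have "(\<integral>w. F (m, w) \<partial>torus) = (\<Sum>\<^sub>\<infinity>k. u m k * (\<integral>w. s (m, w) * W m w * reflected_character k w \<partial>torus))"
      unfolding F V_def by (rule infsumI[OF reflected.integral_mult_series(1)[OF u sW], symmetric])
    also have "\<dots> = (\<Sum>\<^sub>\<infinity>k. \<Sum>\<^sub>\<infinity>j. u m k * v m j * c m (j - k))"
    proof (rule infsum_cong)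
      fix k
      have sk: "integrable torus (\<lambda>w. s (m, w) * reflected_character k w)"
        by (rule reflected.integrable_mult_\<psi>(1)[OF s(1)])
      have "(\<integral>w. s (m, w) * W m w * reflected_character k w \<partial>torus)
          = (\<integral>w. (s (m, w) * reflected_character k w) * W m w \<partial>torus)" by (simp add: mult_ac)
      also have "\<dots> = (\<Sum>\<^sub>\<infinity>j. v m j * (\<integral>w. s (m, w) * reflected_character k w * character j w \<partial>torus))"
        unfolding W_def by (rule infsumI[OF characters.integral_mult_series(1)[OF v sk], symmetric])
      also have "\<dots> = (\<Sum>\<^sub>\<infinity>j. v m j * c m (j - k))"
        by (simp add: reflected_character_def mult.assoc character_add[symmetric] c)
      finally show "u m k * (\<integral>w. s (m, w) * W m w * reflected_character k w \<partial>torus)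
          = (\<Sum>\<^sub>\<infinity>j. u m k * v m j * c m (j - k))"
        by (simp add: mult.assoc infsum_cmult_right')
    qed
    finally show ?thesis .
  qed
  show "(LINT (m, w)|ZT. s (m, w) * stft g1 f m w * cnj (stft g2 h m w))
      = (\<Sum>\<^sub>\<infinity>m. \<Sum>\<^sub>\<infinity>k. \<Sum>\<^sub>\<infinity>j. f k * cnj (g1 (k - m)) * (cnj (h j) * g2 (j - m)) * c m (j - k))"
    using infsumI[OF ZT(2)] unfolding row by (simp add: F_def u_def v_def)
qed

theorem theorem4p6:
  fixes p r :: real
    and \<Phi> :: "ennreal \<Rightarrow> ennreal"
    and g0 g1 g2 :: "int ^ 'n \<Rightarrow> complex"
    and G :: "(int ^ 'n) \<times> (real ^ 'n) \<Rightarrow> complex"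
    and \<sigma> :: "((int ^ 'n) \<times> (real ^ 'n) \<Rightarrow> complex) \<Rightarrow> complex"
  assumes "1 \<le> p" and "p \<le> 2"
    and "G \<in> schwartz_ZT" and "G \<noteq> (\<lambda>_. 0)"
    and "\<sigma> \<in> modulation_space_ZT G p"
    and "young_function \<Phi>"
    and "0 < r" and "r \<le> exp (- 2/3)"
    and "entropy_like_upto r \<Phi>"
    and "g0 \<in> schwartz_Z" and "g0 \<noteq> (\<lambda>_. 0)"
    and "g1 \<in> orlicz_modulation_space g0 \<Phi>" and "g2 \<in> orlicz_modulation_space g0 \<Phi>"
  shows "\<exists>T. is_localization_operator \<sigma> g1 g2 T \<and> compact_operator_ell2 T"
proof -
  define c where "c m q = \<sigma> (atom m q)" for m q
  have coeff: "(\<lambda>(m, q). (cmod (\<sigma> (atom m q)))\<^sup>2) summable_on UNIV"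
    by (rule modulation_space_ZT_coefficients[OF assms(1-5)])
  have "\<sigma> \<in> tempered_ZT" using assms(5) by (simp add: modulation_space_ZT_def)
  then obtain s where s: "represents s \<sigma>" "\<And>m. integrable torus (\<lambda>w. s (m, w))"
    "\<And>m. integrable torus (\<lambda>w. (cmod (s (m, w)))\<^sup>2)"
    "\<And>m q. (\<integral>w. s (m, w) * character q w \<partial>torus) = c m q"
    "(\<lambda>m. \<integral>w. (cmod (s (m, w)))\<^sup>2 \<partial>torus) summable_on UNIV"
    unfolding c_def using represents_of_coefficients[OF _ coeff] by blast
  have g: "g1 \<in> ell2" "g2 \<in> ell2"
    by (rule orlicz_modulation_space_subset_ell2[OF assms(6-11)], fact)+
  interpret localization_kernel c g1 g2
    by unfold_locales (use coeff g in \<open>simp_all add: c_def\<close>)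
  \<comment> \<open>The witness is given by its matrix. The weak identity then compares two
    expressions for the same triple sum.\<close>
  define T where "T = (\<lambda>f j. \<Sum>\<^sub>\<infinity>k. kernel j k * f k)"
  have compact: "compact_operator_ell2 T"
    unfolding T_def by (rule hilbert_schmidt_compact[OF kernel_hilbert_schmidt])
  moreover have "is_localization_operator \<sigma> g1 g2 T"
    unfolding is_localization_operator_def
  proof (intro exI[of _ s] conjI ballI s(1))
    show "T f \<in> ell2" if "f \<in> ell2" for f
      using compact that unfolding compact_operator_ell2_def by blast
    fix f h :: "int ^ 'n \<Rightarrow> complex" assume fh: "f \<in> ell2" "h \<in> ell2"
    note weak = localization_weak_form[OF s(2,3,5,4) fh g]
    show "integrable ZT (\<lambda>(m, w). s (m, w) * stft g1 f m w * cnj (stft g2 h m w))" by (rule weak(1))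
    show "ell2_inner (T f) h = (LINT (m, w)|ZT. s (m, w) * stft g1 f m w * cnj (stft g2 h m w))"
      unfolding weak(2) T_def by (rule kernel_weak_form[OF fh])
  qed
  ultimately show ?thesis by blast
qed

end
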